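(* Let $n\ge2$ and let $(\mathbb P^n\vert\Delta)$ be a smooth Fano orbifold of type $(m_0,\dots,m_{n+1})$. Then $(\mathbb P^n\vert\Delta)$ is uniruled, unless (maybe) the following three conditions are all realised: 1. $\sum_{j=0}^{n+1}\frac1{m_j}>1$; 2. $\sum_{j\neq n}\frac1{m_j}\leq1$ (sum over $j\in\{0,\dots,n+1\}$, $j\ne n$); 3. if $n=3$: $\sum_{j=0}^{n+1}\frac1{m_j^*}\leq1$, where $m_j^*:=\max\{m_j,n\}$. Moreover: 4. If $n=3$, then $(\mathbb P^3\vert\Delta)$ is uniruled, unless possibly if $m_0=2$, $m_1\geq3$, and $m_2\geq4$.
   Context: Everything is over $\mathbb C$. $(\mathbb P^n\vert\Delta)$ is of type $(m_0,\dots,m_{n+1})$ if $\Delta=\sum_{j=0}^{n+1}(1-\frac1{m_j})H_j$, where $H_0,\dots,H_{n+1}$ are $n+2$ hyperplanes in general position (the intersection of any $n+1$ of them is empty) and the $m_j$ are finite integers with $2\le m_0\le m_1\le\dots\le m_{n+1}$. It is Fano if $-(K_{\mathbb P^n}+\Delta)$ is ample, i.e. $\sum_{j=0}^{n+1}(1-\frac1{m_j})<n+1$. Let $C$ be a smooth connected projective curve and $g:C\to\mathbb P^n$ a map birational onto its image, with $g(C)\not\subset\mathrm{Supp}(\Delta)$. For $a\in C$ let $J(a)=\{j: g(a)\in H_j\}$ and, for $j\in J(a)$, let $t_{j,a}$ be the multiplicity of $a$ in $g^*(H_j)$. Let $\Delta_g=\sum_{a\in C}(1-\frac1{m_g(a)})\{a\}$,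 where $m_g(a)=1$ if $g(a)\notin\mathrm{Supp}(\Delta)$, and otherwise $m_g(a)=\max_{j\in J(a)}\max\{1,\frac{m_j}{t_{j,a}}\}$. Then $g$ is a $\Delta$-rational curve if $\deg(K_C+\Delta_g)<0$ (so $C\cong\mathbb P^1$). $(\mathbb P^n\vert\Delta)$ is uniruled if any generic point of $\mathbb P^n$ is contained in (the image of) some $\Delta$-rational curve. *)

theory Defs
  imports "HOL-Analysis.Abstract_Topology" "Jordan_Normal_Form.Matrix"
begin

section \<open>Projective space and its Zariski topology\<close>

text \<open>A point of complex projective \<open>n\<close>-space is the set of all its homogeneous coordinate
  vectors, i.e. the punctured line spanned by a nonzero vector of dimension \<open>n + 1\<close>.\<close>

type_synonym point = "complex vec set"

definition proj_pt :: "complex vec \<Rightarrow> point" where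
  "proj_pt x = {c \<cdot>\<^sub>v x | c. c \<noteq> 0}"

definition proj_space :: "nat \<Rightarrow> point set" where
  "proj_space n = proj_pt ` (carrier_vec (Suc n) - {0\<^sub>v (Suc n)})"

text \<open>\<open>hom_poly n d f\<close>: \<open>f\<close> is (the function given by) a homogeneous polynomial of degree \<open>d\<close> in
  the variables \<open>x\<^sub>0, \<dots>, x\<^sub>n\<close>; the zero polynomial counts as homogeneous of every degree.
  Over an infinite field polynomials may be identified with polynomial functions.\<close>

inductive hom_poly :: "nat \<Rightarrow> nat \<Rightarrow> (complex vec \<Rightarrow> complex) \<Rightarrow> bool" for n where
  const: "hom_poly n 0 (\<lambda>x. c)"
| var: "i \<le> n \<Longrightarrow> hom_poly n 1 (\<lambda>x. x $ i)"
| add: "hom_poly n d f \<Longrightarrow> hom_poly n d g \<Longrightarrow> hom_poly n d (\<lambda>x. f x + g x)"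
| mult: "hom_poly n d f \<Longrightarrow> hom_poly n e g \<Longrightarrow> hom_poly n (d + e) (\<lambda>x. f x * g x)"

definition zariski :: "nat \<Rightarrow> point topology" where
  "zariski n = topology_generated_by
     {{p \<in> proj_space n. \<forall>x\<in>p. f x \<noteq> 0} | f. \<exists>d. hom_poly n d f}"

section \<open>Smooth projective curves\<close>

text \<open>Throughout, \<open>C\<close> is a subset of projective \<open>N\<close>-space. Germs at \<open>a \<in> C\<close> are represented by total
  functions on points, of which only the values on a Zariski neighbourhood of \<open>a\<close> in \<open>C\<close> matter.\<close>

definition near :: "nat \<Rightarrow> point set \<Rightarrow> point \<Rightarrow> (point \<Rightarrow> bool) \<Rightarrow> bool" where
  "near N C a P \<longleftrightarrow> (\<exists>U. openin (zariski N) U \<and> a \<in> U \<and> (\<forall>p\<in>U \<inter> C. P p))"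

text \<open>Membership in the local ring of \<open>C\<close> at \<open>a\<close>.\<close>

definition regular_at :: "nat \<Rightarrow> point set \<Rightarrow> point \<Rightarrow> (point \<Rightarrow> complex) \<Rightarrow> bool" where
  "regular_at N C a f \<longleftrightarrow> (\<exists>d P Q. hom_poly N d P \<and> hom_poly N d Q \<and>
     near N C a (\<lambda>p. \<forall>x\<in>p. Q x \<noteq> 0 \<and> f p = P x / Q x))"

text \<open>\<open>t\<close> generates the maximal ideal of the local ring of \<open>C\<close> at \<open>a\<close>.\<close>

definition uniformizer :: "nat \<Rightarrow> point set \<Rightarrow> point \<Rightarrow> (point \<Rightarrow> complex) \<Rightarrow> bool" where
  "uniformizer N C a t \<longleftrightarrow> regular_at N C a t \<and> t a = 0 \<and>
     (\<forall>f. regular_at N C a f \<and> f a = 0 \<longrightarrow>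
        (\<exists>u. regular_at N C a u \<and> near N C a (\<lambda>p. f p = t p * u p)))"

text \<open>Smoothness is regularity of all local rings, which in dimension one means that the maximal
  ideals are principal. Principality bounds the local dimensions by one (Krull), and a connected
  infinite \<open>C\<close> has no isolated points, so the dimension is exactly one.\<close>

definition smooth_proj_curve :: "nat \<Rightarrow> point set \<Rightarrow> bool" where
  "smooth_proj_curve N C \<longleftrightarrow> closedin (zariski N) C \<and> connectedin (zariski N) C \<and> infinite C \<and>
     (\<forall>a\<in>C. \<exists>t. uniformizer N C a t)"

text \<open>Membership in the \<open>k\<close>-th power of the (principal) maximal ideal at \<open>a\<close>.\<close>

definition in_max_pow :: "nat \<Rightarrow> point set \<Rightarrow> point \<Rightarrow> nat \<Rightarrow> (point \<Rightarrow> complex) \<Rightarrow> bool" where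
  "in_max_pow N C a k f \<longleftrightarrow> (\<exists>t u. uniformizer N C a t \<and> regular_at N C a u \<and>
     near N C a (\<lambda>p. f p = t p ^ k * u p))"

definition has_order :: "nat \<Rightarrow> point set \<Rightarrow> point \<Rightarrow> (point \<Rightarrow> complex) \<Rightarrow> nat \<Rightarrow> bool" where
  "has_order N C a f k \<longleftrightarrow> in_max_pow N C a k f \<and> \<not> in_max_pow N C a (Suc k) f"

text \<open>A nonzero rational differential form \<open>\<omega>\<close> on \<open>C\<close> is given by its values \<open>\<omega> p\<close>, at all but
  finitely many points \<open>p\<close>, in the cotangent space \<open>\<mm>\<^sub>p / \<mm>\<^sub>p\<^sup>2\<close>; we represent such a value by a function in
  \<open>\<mm>\<^sub>p\<close>. In particular the value of \<open>dt\<close> at \<open>p\<close> is the class of \<open>t - t p\<close>. The following says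
  that \<open>\<omega> = (u / v) dt\<close> near \<open>a\<close>, for a uniformizer \<open>t\<close> at \<open>a\<close> and nonzero germs \<open>u\<close> and \<open>v\<close>, with
  \<open>k = ord\<^sub>a (u / v)\<close>. The point \<open>a\<close> itself is exempted as \<open>\<omega>\<close> need not be defined there.\<close>

definition form_order ::
  "nat \<Rightarrow> point set \<Rightarrow> (point \<Rightarrow> point \<Rightarrow> complex) \<Rightarrow> point \<Rightarrow> int \<Rightarrow> bool" where
  "form_order N C \<omega> a k \<longleftrightarrow> (\<exists>t u v i j. uniformizer N C a t \<and>
     has_order N C a u i \<and> has_order N C a v j \<and> k = int i - int j \<and>
     near N C a (\<lambda>p. p \<noteq> a \<longrightarrow>
       in_max_pow N C p 2 (\<lambda>q. v p * \<omega> p q - u p * (t q - t p))))"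

definition canonical_divisor :: "nat \<Rightarrow> point set \<Rightarrow> (point \<Rightarrow> int) \<Rightarrow> bool" where
  "canonical_divisor N C K \<longleftrightarrow> (\<exists>\<omega>. \<forall>a\<in>C. form_order N C \<omega> a (K a))"

definition divisor_degree :: "point set \<Rightarrow> (point \<Rightarrow> int) \<Rightarrow> int" where
  "divisor_degree C K = (\<Sum>a | a \<in> C \<and> K a \<noteq> 0. K a)"

section \<open>Maps from curves to projective space\<close>

definition local_lift ::
  "nat \<Rightarrow> point set \<Rightarrow> nat \<Rightarrow> (point \<Rightarrow> point) \<Rightarrow> point \<Rightarrow> (point \<Rightarrow> complex vec) \<Rightarrow> bool" where
  "local_lift N C n g a \<phi> \<longleftrightarrow> (\<forall>i\<le>n. regular_at N C a (\<lambda>p. \<phi> p $ i)) \<and>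
     near N C a (\<lambda>p. \<phi> p \<in> carrier_vec (Suc n) - {0\<^sub>v (Suc n)} \<and> g p = proj_pt (\<phi> p))"

definition curve_map :: "nat \<Rightarrow> point set \<Rightarrow> nat \<Rightarrow> (point \<Rightarrow> point) \<Rightarrow> bool" where
  "curve_map N C n g \<longleftrightarrow> (\<forall>a\<in>C. \<exists>\<phi>. local_lift N C n g a \<phi>)"

text \<open>The rational inverse is given by homogeneous polynomials \<open>R\<^sub>0, \<dots>, R\<^sub>N\<close> of a common degree; since
  \<open>proj_pt\<close> of the zero vector is not in \<open>C\<close>, they do not all vanish at \<open>g a\<close> for general \<open>a\<close>.
  The nonempty open subsets of the curve \<open>C\<close> are the complements of finite sets.\<close>

definition birational_onto_image :: "nat \<Rightarrow> point set \<Rightarrow> nat \<Rightarrow> (point \<Rightarrow> point) \<Rightarrow> bool" where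
  "birational_onto_image N C n g \<longleftrightarrow> (\<exists>d R. (\<forall>i\<le>N. hom_poly n d (R i)) \<and>
     finite {a \<in> C. \<not> (\<forall>x\<in>g a. proj_pt (vec (Suc N) (\<lambda>i. R i x)) = a)})"

definition hyperplane :: "nat \<Rightarrow> complex vec \<Rightarrow> point set" where
  "hyperplane n h = {p \<in> proj_space n. \<forall>x\<in>p. h \<bullet> x = 0}"

text \<open>The multiplicity of \<open>a\<close> in the pullback by \<open>g\<close> of the hyperplane \<open>h\<close>; meaningful
  if \<open>g ` C\<close> is not contained in that hyperplane.\<close>

definition pullback_mult ::
  "nat \<Rightarrow> point set \<Rightarrow> nat \<Rightarrow> (point \<Rightarrow> point) \<Rightarrow> complex vec \<Rightarrow> point \<Rightarrow> nat" where
  "pullback_mult N C n g h a =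
     (THE k. \<exists>\<phi>. local_lift N C n g a \<phi> \<and> has_order N C a (\<lambda>p. h \<bullet> \<phi> p) k)"

section \<open>Orbifolds supported on \<open>n + 2\<close> hyperplanes\<close>

text \<open>The orbifold divisor \<open>\<Delta> = \<Sum>\<^sub>j (1 - 1 / m\<^sub>j) H\<^sub>j\<close> is given by the linear forms \<open>h j\<close> defining
  the hyperplanes and by the multiplicities \<open>m j\<close>, for \<open>j \<le> n + 1\<close>.\<close>

definition general_position :: "nat \<Rightarrow> (nat \<Rightarrow> complex vec) \<Rightarrow> bool" where
  "general_position n h \<longleftrightarrow> (\<forall>j\<le>n + 1. h j \<in> carrier_vec (Suc n) - {0\<^sub>v (Suc n)}) \<and>
     (\<forall>I\<subseteq>{..n + 1}. card I = n + 1 \<longrightarrow> (\<Inter>j\<in>I. hyperplane n (h j)) = {})"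

definition orbifold_type :: "nat \<Rightarrow> (nat \<Rightarrow> complex vec) \<Rightarrow> (nat \<Rightarrow> nat) \<Rightarrow> bool" where
  "orbifold_type n h m \<longleftrightarrow> general_position n h \<and>
     (\<forall>j\<le>n + 1. 2 \<le> m j) \<and> mono_on {..n + 1} m"

text \<open>Ampleness of \<open>-(K + \<Delta>)\<close>, by degrees.\<close>

definition fano :: "nat \<Rightarrow> (nat \<Rightarrow> nat) \<Rightarrow> bool" where
  "fano n m \<longleftrightarrow> (\<Sum>j\<le>n + 1. 1 - 1 / real (m j)) < real n + 1"

definition orb_support :: "nat \<Rightarrow> (nat \<Rightarrow> complex vec) \<Rightarrow> point set" where
  "orb_support n h = (\<Union>j\<le>n + 1. hyperplane n (h j))"

definition curve_mult ::
  "nat \<Rightarrow> (nat \<Rightarrow> complex vec) \<Rightarrow> (nat \<Rightarrow> nat) \<Rightarrow> nat \<Rightarrow> point set \<Rightarrow> (point \<Rightarrow> point) \<Rightarrow> point \<Rightarrow> real"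
where
  "curve_mult n h m N C g a =
     (if g a \<notin> orb_support n h then 1
      else Max ((\<lambda>j. max 1 (real (m j) / real (pullback_mult N C n g (h j) a)))
             ` {j. j \<le> n + 1 \<and> g a \<in> hyperplane n (h j)}))"

definition orb_degree ::
  "nat \<Rightarrow> (nat \<Rightarrow> complex vec) \<Rightarrow> (nat \<Rightarrow> nat) \<Rightarrow> nat \<Rightarrow> point set \<Rightarrow> (point \<Rightarrow> point) \<Rightarrow> real" where
  "orb_degree n h m N C g =
     (\<Sum>a | a \<in> C \<and> g a \<in> orb_support n h. 1 - 1 / curve_mult n h m N C g a)"

text \<open>All canonical divisors of \<open>C\<close> have the same degree, the degree of \<open>K\<^sub>C\<close>, so it does not matter
  which of them is taken.\<close>

definition orb_rational_curve ::
  "nat \<Rightarrow> (nat \<Rightarrow> complex vec) \<Rightarrow> (nat \<Rightarrow> nat) \<Rightarrow> nat \<Rightarrow> point set \<Rightarrow> (point \<Rightarrow> point) \<Rightarrow> bool" where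
  "orb_rational_curve n h m N C g \<longleftrightarrow>
     smooth_proj_curve N C \<and> curve_map N C n g \<and> birational_onto_image N C n g \<and>
     \<not> g ` C \<subseteq> orb_support n h \<and>
     (\<exists>K. canonical_divisor N C K \<and>
        real_of_int (divisor_degree C K) + orb_degree n h m N C g < 0)"

text \<open>A generic point is a point of some nonempty Zariski open subset.\<close>

definition uniruled :: "nat \<Rightarrow> (nat \<Rightarrow> complex vec) \<Rightarrow> (nat \<Rightarrow> nat) \<Rightarrow> bool" where
  "uniruled n h m \<longleftrightarrow> (\<exists>U. openin (zariski n) U \<and> U \<noteq> {} \<and>
     (\<forall>p\<in>U. \<exists>N C g. orb_rational_curve n h m N C g \<and> p \<in> g ` C))"

end

theory Submission
  imports Defs "HOL-Computational_Algebra.Polynomial_Factorial" "HOL-Computational_Algebra.Field_as_Ring"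
    "HOL-Computational_Algebra.Fundamental_Theorem_Algebra" "HOL-Analysis.Continuum_Not_Denumerable"
begin

text \<open>
  Scale the linear forms so that their values \<open>z\<^sub>0, \<dots>, z\<^sub>n\<^sub>+\<^sub>1\<close> satisfy just \<open>\<Sum>\<^sub>j z\<^sub>j = 0\<close>. The Fano condition
  is \<open>\<Sum>\<^sub>j 1 / m\<^sub>j > 1\<close>, and two families of curves parametrised by polynomials suffice.

  If \<open>\<Sum>\<^sub>j\<^sub>\<le>\<^sub>n 1 / m\<^sub>j > 1\<close>, which follows when the sum over \<open>j \<noteq> n\<close> exceeds \<open>1\<close>, look for
  polynomials \<open>y\<^sub>j\<close> with \<open>y\<^sub>j(0) = 1\<close> and \<open>\<Sum>\<^sub>j\<^sub>\<le>\<^sub>n z\<^sub>j y\<^sub>j ^ m\<^sub>j = - z\<^sub>n\<^sub>+\<^sub>1\<close>. With \<open>d = \<Prod>\<^sub>j m\<^sub>j\<close> and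
  \<open>deg y\<^sub>j \<le> d / m\<^sub>j\<close> these are \<open>d\<close> weighted homogeneous equations in \<open>\<Sum>\<^sub>j d / m\<^sub>j > d\<close> coefficients,
  so there is a nontrivial solution. As the last coordinate is constant, the coordinates have no
  common zero, and the only orbifold point is at infinity. The resulting map may be a multiple
  cover of its image; by Lueroth's theorem it factors through a polynomial \<open>w\<close> with a birational
  second factor, and by Riemann--Hurwitz the finite part of the orbifold degree of the latter is at
  most \<open>1 - 1 / deg w\<close>.

  If \<open>\<Sum>\<^sub>j 1 / max m\<^sub>j n > 1\<close>, use the rational normal curves \<open>(z\<^sub>j (1 + a\<^sub>j t)\<^sup>n)\<^sub>j\<close>, where
  \<open>\<Sum>\<^sub>j z\<^sub>j a\<^sub>j\<^sup>k = 0\<close> for \<open>k \<le> n\<close>. The \<open>a\<^sub>j\<close> are distinct when no proper partial sum of the \<open>z\<^sub>j\<close> vanishes.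
\<close>

section \<open>Common zeros of weighted homogeneous polynomials\<close>

text \<open>A curve on the line is admissible when its costs \<open>1 - 1 / mult\<close> add up to
  less than 2. In the first family this splits into two amounts below 1: infinity costs less than 1
  whatever the multiplicity there, which is why the largest \<open>m j\<close> may stay out of the
  sum, and ramification bounds the rest. Two obstacles shape the proof. The weighted system has no
  explicit solution: if the origin were its only zero, the polynomial ring would be a finite module
  over the algebra of the equations, and there are too many monomials for that. And the curve must
  be birational onto its image: the functions induced on it by homogeneous forms make up an algebra
  of polynomials in \<open>t\<close>, and a generator of its field of fractions gives both the
  factorisation and the rational inverse. In the second family every hyperplane is met in one point
  with contact order \<open>n\<close>; this produces the truncation \<open>max (m j) n\<close>. For
  \<open>n = 3\<close> truncation only affects multiplicities equal to 2.\<close>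

lemma underdetermined_system:
  fixes C :: "'a \<Rightarrow> 'b \<Rightarrow> 'c::field"
  assumes "finite T" "finite S" "card T < card S"
  shows "\<exists>c. (\<exists>s\<in>S. c s \<noteq> 0) \<and> (\<forall>t\<in>T. (\<Sum>s\<in>S. c s * C s t) = 0)"
  using assms
proof (induction T arbitrary: S C rule: finite_induct)
  case empty
  then obtain s where "s \<in> S" by (metis card_gt_0_iff card.empty ex_in_conv)
  then show ?case by (intro exI[of _ "\<lambda>_. 1"]) auto
next
  case (insert t T)
  show ?case
  proof (cases "\<forall>s\<in>S. C s t = 0")
    case True
    have "card T < card S" using insert by simp
    from insert.IH[OF \<open>finite S\<close> this, of C] True show ?thesis by auto
  next
    case False
    then obtain r where r: "r \<in> S" "C r t \<noteq> 0" by auto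
    let ?S = "S - {r}"
    define D where "D = (\<lambda>s u. C s u - C s t / C r t * C r u)"
    have "card T < card ?S" using insert r by simp
    from insert.IH[OF _ this, of D] \<open>finite S\<close> obtain c where
      c: "\<exists>s\<in>?S. c s \<noteq> 0" "\<And>u. u \<in> T \<Longrightarrow> (\<Sum>s\<in>?S. c s * D s u) = 0" by auto
    define c' where "c' = c(r := - (\<Sum>s\<in>?S. c s * C s t) / C r t)"
    have eq: "(\<Sum>s\<in>S. c' s * C s u) = (\<Sum>s\<in>?S. c s * D s u)" for u
    proof -
      have "(\<Sum>s\<in>S. c' s * C s u) = c' r * C r u + (\<Sum>s\<in>?S. c' s * C s u)"
        using r \<open>finite S\<close> by (intro sum.remove) auto
      also have "(\<Sum>s\<in>?S. c' s * C s u) = (\<Sum>s\<in>?S. c s * C s u)"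
        by (rule sum.cong) (auto simp: c'_def)
      also have "c' r * C r u = - (\<Sum>s\<in>?S. c s * (C s t / C r t * C r u))"
        by (simp add: c'_def sum_distrib_left sum_divide_distrib sum_negf mult_ac)
      finally show ?thesis
        by (simp add: D_def right_diff_distrib sum_subtractf)
    qed
    have "(\<Sum>s\<in>S. c' s * C s t) = 0" unfolding eq using r by (simp add: D_def)
    moreover have "\<exists>s\<in>S. c' s \<noteq> 0" using c(1) by (auto simp: c'_def)
    ultimately show ?thesis using c(2) eq by (intro exI[of _ c']) auto
  qed
qed

section \<open>Complex spans of functions\<close>

inductive lin_comb :: "('a \<Rightarrow> complex) set \<Rightarrow> ('a \<Rightarrow> complex) \<Rightarrow> bool" for B where
  zero: "lin_comb B (\<lambda>_. 0)"
| add: "lin_comb B f \<Longrightarrow> b \<in> B \<Longrightarrow> lin_comb B (\<lambda>x. f x + c * b x)"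

lemma lin_comb_base: "b \<in> B \<Longrightarrow> lin_comb B b"
  using lin_comb.add[OF lin_comb.zero, of b B 1] by simp

lemma lin_comb_plus: "lin_comb B g \<Longrightarrow> lin_comb B f \<Longrightarrow> lin_comb B (\<lambda>x. f x + g x)"
proof (induction rule: lin_comb.induct)
  case (add g b c)
  then have "lin_comb B (\<lambda>x. (f x + g x) + c * b x)" by (intro lin_comb.add) auto
  then show ?case by (simp add: add.assoc)
qed simp

lemma lin_comb_scale: "lin_comb B f \<Longrightarrow> lin_comb B (\<lambda>x. c * f x)"
proof (induction rule: lin_comb.induct)
  case (add f b a)
  then have "lin_comb B (\<lambda>x. c * f x + (c * a) * b x)" by (intro lin_comb.add) auto
  then show ?case by (simp add: algebra_simps)
qed (simp add: lin_comb.zero)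

lemma lin_comb_sum: "(\<And>i. i \<in> S \<Longrightarrow> lin_comb B (f i)) \<Longrightarrow> lin_comb B (\<lambda>x. \<Sum>i\<in>S. f i x)"
  by (induction S rule: infinite_finite_induct) (auto intro: lin_comb.zero lin_comb_plus)

lemma lin_comb_trans: "lin_comb B f \<Longrightarrow> (\<And>b. b \<in> B \<Longrightarrow> lin_comb B' b) \<Longrightarrow> lin_comb B' f"
proof (induction rule: lin_comb.induct)
  case (add f b c)
  then show ?case by (intro lin_comb_plus[of B' "\<lambda>x. c * b x"] lin_comb_scale) auto
qed (simp add: lin_comb.zero)

lemma lin_comb_mult_right:
  assumes "lin_comb B f" "\<And>b. b \<in> B \<Longrightarrow> lin_comb B' (\<lambda>x. b x * g x)"
  shows "lin_comb B' (\<lambda>x. f x * g x)"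
  using assms
proof (induction rule: lin_comb.induct)
  case (add f b c)
  then have "lin_comb B' (\<lambda>x. f x * g x + c * (b x * g x))"
    by (intro lin_comb_plus lin_comb_scale) auto
  then show ?case by (simp add: algebra_simps)
qed (simp add: lin_comb.zero)

lemma lin_comb_mult:
  assumes "lin_comb B f" "lin_comb B' g" "\<And>b b'. b \<in> B \<Longrightarrow> b' \<in> B' \<Longrightarrow> (\<lambda>x. b x * b' x) \<in> B''"
  shows "lin_comb B'' (\<lambda>x. f x * g x)"
proof (rule lin_comb_mult_right[OF assms(1)])
  fix b assume b: "b \<in> B"
  have "lin_comb B'' (\<lambda>x. g x * b x)"
    using assms(3)[OF b]
    by (intro lin_comb_mult_right[OF assms(2)] lin_comb_base) (simp add: mult.commute)
  then show "lin_comb B'' (\<lambda>x. b x * g x)" by (simp add: mult.commute)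
qed

lemma lin_comb_coeffs:
  assumes "lin_comb B f" "finite B"
  shows "\<exists>c. \<forall>x. f x = (\<Sum>b\<in>B. c b * b x)"
  using assms(1)
proof (induction rule: lin_comb.induct)
  case (add f b a)
  then obtain c where "\<forall>x. f x = (\<Sum>b\<in>B. c b * b x)" by auto
  moreover have "(\<Sum>b'\<in>B. (c(b := c b + a)) b' * b' x) = (\<Sum>b'\<in>B. c b' * b' x) + a * b x" for x
  proof -
    have "(\<Sum>b'\<in>B. (c(b := c b + a)) b' * b' x) =
        (\<Sum>b'\<in>B. c b' * b' x + (if b' = b then a * b x else 0))"
      by (rule sum.cong) (auto simp: algebra_simps)
    then show ?thesis using \<open>b \<in> B\<close> \<open>finite B\<close> by (simp add: sum.distrib)
  qed
  ultimately have "\<forall>x. f x + a * b x = (\<Sum>b'\<in>B. (c(b := c b + a)) b' * b' x)" by simp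
  then show ?case by blast
qed (auto intro: exI[of _ "\<lambda>_. 0"])

lemma lin_comb_dependent:
  fixes g :: "'i \<Rightarrow> 'a \<Rightarrow> complex"
  assumes "finite B" "finite S" "card B < card S" "\<And>s. s \<in> S \<Longrightarrow> lin_comb B (g s)"
  shows "\<exists>c. (\<exists>s\<in>S. c s \<noteq> 0) \<and> (\<forall>x. (\<Sum>s\<in>S. c s * g s x) = 0)"
proof -
  have "\<forall>s\<in>S. \<exists>C. \<forall>x. g s x = (\<Sum>b\<in>B. C b * b x)"
    using assms(1,4) lin_comb_coeffs by blast
  then obtain C where C: "\<And>s x. s \<in> S \<Longrightarrow> g s x = (\<Sum>b\<in>B. C s b * b x)" by metis
  obtain c where c: "\<exists>s\<in>S. c s \<noteq> 0" "\<And>b. b \<in> B \<Longrightarrow> (\<Sum>s\<in>S. c s * C s b) = 0"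
    using underdetermined_system[OF assms(1-3), of C] by auto
  have "(\<Sum>s\<in>S. c s * g s x) = 0" for x
  proof -
    have "(\<Sum>s\<in>S. c s * g s x) = (\<Sum>s\<in>S. \<Sum>b\<in>B. c s * C s b * b x)"
      by (rule sum.cong) (auto simp: C sum_distrib_left mult.assoc)
    also have "\<dots> = (\<Sum>b\<in>B. (\<Sum>s\<in>S. c s * C s b) * b x)"
      by (subst sum.swap) (simp add: sum_distrib_right)
    also have "\<dots> = 0" using c(2) by simp
    finally show ?thesis .
  qed
  with c(1) show ?thesis by blast
qed

section \<open>Polynomial functions, weights and monomials\<close>

definition monomial :: "'i set \<Rightarrow> ('i \<Rightarrow> nat) \<Rightarrow> ('i \<Rightarrow> complex) \<Rightarrow> complex" where
  "monomial I e = (\<lambda>x. \<Prod>i\<in>I. x i ^ e i)"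

inductive poly_fun :: "'i set \<Rightarrow> (('i \<Rightarrow> complex) \<Rightarrow> complex) \<Rightarrow> bool" for I where
  const: "poly_fun I (\<lambda>x. c)"
| var: "i \<in> I \<Longrightarrow> poly_fun I (\<lambda>x. x i)"
| add: "poly_fun I f \<Longrightarrow> poly_fun I g \<Longrightarrow> poly_fun I (\<lambda>x. f x + g x)"
| mult: "poly_fun I f \<Longrightarrow> poly_fun I g \<Longrightarrow> poly_fun I (\<lambda>x. f x * g x)"

text \<open>The clause \<open>zero\<close> makes zero homogeneous of every weight; a given
  \<open>d\<close> need not be the weight of any product of variables, so the other clauses would
  not yield it.\<close>

inductive wt_hom :: "'i set \<Rightarrow> ('i \<Rightarrow> nat) \<Rightarrow> nat \<Rightarrow> (('i \<Rightarrow> complex) \<Rightarrow> complex) \<Rightarrow> bool" for I w where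
  zero: "wt_hom I w d (\<lambda>x. 0)"
| const: "wt_hom I w 0 (\<lambda>x. c)"
| var: "i \<in> I \<Longrightarrow> wt_hom I w (w i) (\<lambda>x. x i)"
| add: "wt_hom I w d f \<Longrightarrow> wt_hom I w d g \<Longrightarrow> wt_hom I w d (\<lambda>x. f x + g x)"
| mult: "wt_hom I w d f \<Longrightarrow> wt_hom I w e g \<Longrightarrow> wt_hom I w (d + e) (\<lambda>x. f x * g x)"

lemma wt_hom_pfun: "wt_hom I w d f \<Longrightarrow> poly_fun I f"
  by (induction rule: wt_hom.induct) (auto intro: poly_fun.intros)

lemma wt_hom_sum: "(\<And>i. i \<in> S \<Longrightarrow> wt_hom I w d (f i)) \<Longrightarrow> wt_hom I w d (\<lambda>x. \<Sum>i\<in>S. f i x)"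
  by (induction S rule: infinite_finite_induct) (auto intro: wt_hom.intros)

lemma wt_hom_scale: "wt_hom I w d f \<Longrightarrow> wt_hom I w d (\<lambda>x. c * f x)"
  using wt_hom.mult[OF wt_hom.const] by (metis add_0)

lemma wt_hom_power: "i \<in> I \<Longrightarrow> wt_hom I w (k * w i) (\<lambda>x. x i ^ k)"
  by (induction k) (auto intro: wt_hom.const wt_hom.mult wt_hom.var)

lemma wt_hom_scaling:
  "wt_hom I w d f \<Longrightarrow> f (\<lambda>i. l ^ w i * x i) = l ^ d * f x"
  by (induction rule: wt_hom.induct) (auto simp: power_add algebra_simps)

lemma poly_fun_sum: "(\<And>i. i \<in> S \<Longrightarrow> poly_fun I (f i)) \<Longrightarrow> poly_fun I (\<lambda>x. \<Sum>i\<in>S. f i x)"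
  by (induction S rule: infinite_finite_induct) (auto intro: poly_fun.intros)

lemma poly_fun_prod: "(\<And>i. i \<in> S \<Longrightarrow> poly_fun I (f i)) \<Longrightarrow> poly_fun I (\<lambda>x. \<Prod>i\<in>S. f i x)"
  by (induction S rule: infinite_finite_induct) (auto intro: poly_fun.const poly_fun.mult)

lemma poly_fun_poly: "poly_fun I g \<Longrightarrow> poly_fun I (\<lambda>x. poly p (g x))"
  by (induction p) (simp_all add: poly_fun.const poly_fun.add[OF poly_fun.const poly_fun.mult])

lemma poly_fun_power: "poly_fun I f \<Longrightarrow> poly_fun I (\<lambda>x. f x ^ k)"
  by (induction k) (auto intro: poly_fun.intros)

text \<open>\<open>U k\<close> is homogeneous also for \<open>k > T\<close>, where it is unrelated
  to \<open>f\<close>; hence the cut-offs at \<open>T\<close> whenever components are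
  combined.\<close>

lemma poly_fun_decomp:
  "poly_fun I f \<Longrightarrow> \<exists>T U. (\<forall>k. wt_hom I w k (U k)) \<and> (\<forall>x. f x = (\<Sum>k\<le>(T::nat). U k x))"
proof (induction rule: poly_fun.induct)
  case (const c)
  then show ?case
    by (intro exI[of _ 0] exI[of _ "\<lambda>k x. if k = 0 then c else 0"]) (auto intro: wt_hom.intros)
next
  case (var i)
  have "wt_hom I w k (\<lambda>x. if k = w i then x i else 0)" for k
    using var by (cases "k = w i") (auto intro: wt_hom.intros)
  moreover have "x i = (\<Sum>k\<le>w i. if k = w i then x i else 0)" for x :: "'a \<Rightarrow> complex"
    by simp
  ultimately show ?case by (intro exI[of _ "w i"] exI[of _ "\<lambda>k x. if k = w i then x i else 0"]) simp
next
  case (add f g)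
  then obtain T U T' U' where *: "\<forall>k. wt_hom I w k (U k)" "\<forall>x. f x = (\<Sum>k\<le>(T::nat). U k x)"
    "\<forall>k. wt_hom I w k (U' k)" "\<forall>x. g x = (\<Sum>k\<le>(T'::nat). U' k x)" by metis
  let ?U = "\<lambda>k x. (if k \<le> T then U k x else 0) + (if k \<le> T' then U' k x else 0)"
  have "wt_hom I w k (?U k)" for k
  proof (rule wt_hom.add)
    show "wt_hom I w k (\<lambda>x. if k \<le> T then U k x else 0)"
      using * by (cases "k \<le> T") (auto intro: wt_hom.intros)
    show "wt_hom I w k (\<lambda>x. if k \<le> T' then U' k x else 0)"
      using * by (cases "k \<le> T'") (auto intro: wt_hom.intros)
  qed
  moreover have "f x + g x = (\<Sum>k\<le>max T T'. ?U k x)" for x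
  proof -
    have "(\<Sum>k\<le>max T T'. if k \<le> T then U k x else 0) = (\<Sum>k\<le>T. U k x)"
      by (rule sum.mono_neutral_cong_right) auto
    moreover have "(\<Sum>k\<le>max T T'. if k \<le> T' then U' k x else 0) = (\<Sum>k\<le>T'. U' k x)"
      by (rule sum.mono_neutral_cong_right) auto
    ultimately show ?thesis using * by (simp add: sum.distrib)
  qed
  ultimately show ?case by (intro exI[of _ "max T T'"] exI[of _ ?U]) simp
next
  case (mult f g)
  then obtain T U T' U' where *: "\<forall>k. wt_hom I w k (U k)" "\<forall>x. f x = (\<Sum>k\<le>(T::nat). U k x)"
    "\<forall>k. wt_hom I w k (U' k)" "\<forall>x. g x = (\<Sum>k\<le>(T'::nat). U' k x)" by metis
  let ?P = "\<lambda>n. {(i, j). i \<le> T \<and> j \<le> T' \<and> i + j = n}"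
  let ?U = "\<lambda>n x. \<Sum>(i, j)\<in>?P n. U i x * U' j x"
  have "wt_hom I w n (?U n)" for n
    unfolding case_prod_unfold using * by (intro wt_hom_sum) (auto intro: wt_hom.mult)
  moreover have "f x * g x = (\<Sum>n\<le>T+T'. ?U n x)" for x
  proof -
    have "f x * g x = (\<Sum>(i, j)\<in>{..T}\<times>{..T'}. U i x * U' j x)"
      using * by (simp add: sum_product sum.cartesian_product)
    also have "\<dots> = (\<Sum>n\<le>T+T'. \<Sum>p\<in>{p \<in> {..T}\<times>{..T'}. fst p + snd p = n}. (\<lambda>(i, j). U i x * U' j x) p)"
      by (rule sum.group[symmetric]) auto
    also have "\<dots> = (\<Sum>n\<le>T+T'. ?U n x)"
      by (intro sum.cong) auto
    finally show ?thesis .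
  qed
  ultimately show ?case by (intro exI[of _ "T + T'"] exI[of _ ?U]) simp
qed

lemma monomial_mult: "(\<lambda>x. monomial I e x * monomial I e' x) = monomial I (\<lambda>i. e i + e' i)"
  by (simp add: monomial_def power_add prod.distrib)

lemma monomial_single:
  assumes "finite I" "i \<in> I"
  shows "monomial I (\<lambda>j. if j = i then k else 0) = (\<lambda>x. x i ^ k)"
proof
  fix x
  show "monomial I (\<lambda>j. if j = i then k else 0) x = x i ^ k"
    using assms by (simp add: monomial_def if_distrib[of "\<lambda>k. x _ ^ k"] prod.delta cong: if_cong)
qed

lemma monomial_0: "monomial I (\<lambda>_. 0) = (\<lambda>_. 1)"
  by (simp add: monomial_def)

lemma wt_hom_monomial:
  assumes "finite I"
  shows "wt_hom I w (\<Sum>i\<in>I. e i * w i) (monomial I e)"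
proof -
  have "wt_hom I w (\<Sum>i\<in>S. e i * w i) (\<lambda>x. \<Prod>i\<in>S. x i ^ e i)" if "S \<subseteq> I" for S
    using finite_subset[OF that assms] that
    by (induction S rule: finite_induct) (auto intro: wt_hom.const wt_hom.mult wt_hom_power)
  then show ?thesis by (simp add: monomial_def)
qed

lemma wt_hom_monomials:
  assumes "wt_hom I w d f" "finite I"
  shows "lin_comb {monomial I e | e. (\<Sum>i\<in>I. e i * w i) = d} f"
  using assms(1)
proof (induction rule: wt_hom.induct)
  case (const c)
  have "lin_comb {monomial I e | e. (\<Sum>i\<in>I. e i * w i) = 0} (\<lambda>x. c * monomial I (\<lambda>_. 0) x)"
    by (intro lin_comb_scale lin_comb_base) auto
  then show ?case by (simp add: monomial_0)
next
  case (var i)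
  have "lin_comb {monomial I e | e. (\<Sum>i\<in>I. e i * w i) = w i} (monomial I (\<lambda>j. if j = i then 1 else 0))"
    using var \<open>finite I\<close>
    by (intro lin_comb_base CollectI exI[of _ "\<lambda>j. if j = i then 1 else 0"])
       (simp add: if_distrib[of "\<lambda>a. a * _"] cong: if_cong)
  then show ?case using monomial_single[OF \<open>finite I\<close> var, of 1] by simp
next
  case (mult d f e g)
  show ?case
  proof (rule lin_comb_mult[OF mult.IH])
    fix b b' assume "b \<in> {monomial I e | e. (\<Sum>i\<in>I. e i * w i) = d}"
      "b' \<in> {monomial I e' | e'. (\<Sum>i\<in>I. e' i * w i) = e}"
    then obtain u v where "b = monomial I u" "b' = monomial I v"
      "(\<Sum>i\<in>I. u i * w i) = d" "(\<Sum>i\<in>I. v i * w i) = e" by auto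
    then show "(\<lambda>x. b x * b' x) \<in> {monomial I e' | e'. (\<Sum>i\<in>I. e' i * w i) = d + e}"
      by (auto simp: monomial_mult add_mult_distrib sum.distrib intro!: exI[of _ "\<lambda>i. u i + v i"])
  qed
qed (auto intro: lin_comb.zero lin_comb_plus)

lemma monomial_restrict: "monomial I (restrict e I) = monomial I e"
  by (auto simp: monomial_def intro!: prod.cong)

text \<open>With all weights 1 the components are graded by total degree, which bounds every single
  exponent. This confines \<open>f\<close> to a finite-dimensional space.\<close>

lemma poly_fun_bounded_degree:
  assumes "poly_fun I f" "finite I"
  shows "\<exists>s. lin_comb (monomial I ` (I \<rightarrow>\<^sub>E {..s})) f"
proof -
  obtain T U where U: "\<And>k. wt_hom I (\<lambda>_. 1) k (U k)" "\<And>x. f x = (\<Sum>k\<le>(T::nat). U k x)"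
    using poly_fun_decomp[OF assms(1), of "\<lambda>_. 1"] by auto
  have "lin_comb (monomial I ` (I \<rightarrow>\<^sub>E {..T})) (\<lambda>x. \<Sum>k\<le>T. U k x)"
  proof (rule lin_comb_sum)
    fix k assume k: "k \<in> {..T}"
    show "lin_comb (monomial I ` (I \<rightarrow>\<^sub>E {..T})) (U k)"
    proof (rule lin_comb_trans[OF wt_hom_monomials[OF U(1) assms(2)]])
      fix b assume "b \<in> {monomial I e | e. (\<Sum>i\<in>I. e i * 1) = k}"
      then obtain e where e: "b = monomial I e" "(\<Sum>i\<in>I. e i) = k" by auto
      have "e i \<le> T" if "i \<in> I" for i
        using e(2) k member_le_sum[OF that _ assms(2), of e] by simp
      then have "restrict e I \<in> I \<rightarrow>\<^sub>E {..T}" by auto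
      then show "lin_comb (monomial I ` (I \<rightarrow>\<^sub>E {..T})) b"
        using e(1) by (metis imageI lin_comb_base monomial_restrict)
    qed
  qed
  moreover have "f = (\<lambda>x. \<Sum>k\<le>T. U k x)" using U(2) by (rule ext)
  ultimately show ?thesis by auto
qed

section \<open>Ideals of polynomial functions and the Nullstellensatz\<close>

definition pideal :: "'i set \<Rightarrow> (('i \<Rightarrow> complex) \<Rightarrow> complex) set \<Rightarrow> bool" where
  "pideal I J \<longleftrightarrow> J \<subseteq> Collect (poly_fun I) \<and> (\<lambda>_. 0) \<in> J \<and>
     (\<forall>f\<in>J. \<forall>g\<in>J. (\<lambda>x. f x + g x) \<in> J) \<and> (\<forall>f\<in>J. \<forall>g. poly_fun I g \<longrightarrow> (\<lambda>x. f x * g x) \<in> J)"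

lemma pidealD:
  assumes "pideal I J"
  shows "f \<in> J \<Longrightarrow> poly_fun I f" "(\<lambda>_. 0) \<in> J" "f \<in> J \<Longrightarrow> g \<in> J \<Longrightarrow> (\<lambda>x. f x + g x) \<in> J"
    "f \<in> J \<Longrightarrow> poly_fun I g \<Longrightarrow> (\<lambda>x. f x * g x) \<in> J"
  using assms by (auto simp: pideal_def)

lemma pideal_scale: "pideal I J \<Longrightarrow> f \<in> J \<Longrightarrow> (\<lambda>x. c * f x) \<in> J"
  using pidealD(4)[OF _ _ poly_fun.const[of I c]] by (simp add: mult.commute)

lemma pideal_sum: "pideal I J \<Longrightarrow> (\<And>i. i \<in> S \<Longrightarrow> f i \<in> J) \<Longrightarrow> (\<lambda>x. \<Sum>i\<in>S. f i x) \<in> J"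
  by (induction S rule: infinite_finite_induct) (auto intro: pidealD)

text \<open>An ideal maximal among those avoiding the powers of a coordinate function \<open>z\<close> is the ideal of
  a point with \<open>z \<noteq> 0\<close>: otherwise some \<open>x\<^sub>l - a\<close> would be invertible modulo the ideal, up to powers
  of \<open>z\<close>, for all of the uncountably many \<open>a\<close>, whereas the inverses live in a space of countable
  dimension.\<close>

locale maximal_avoiding =
  fixes I :: "'i set" and J :: "(('i \<Rightarrow> complex) \<Rightarrow> complex) set" and z :: 'i
  assumes fin: "finite I" and z: "z \<in> I" and J: "pideal I J"
    and avoid: "\<And>k. (\<lambda>x. x z ^ k) \<notin> J"
    and maximal: "\<And>J'. pideal I J' \<Longrightarrow> J \<subseteq> J' \<Longrightarrow> (\<And>k. (\<lambda>x. x z ^ k) \<notin> J') \<Longrightarrow> J' = J"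
begin

lemma poly_fun_z: "poly_fun I (\<lambda>x. x z ^ k)"
  using z by (intro poly_fun_power poly_fun.var)

text \<open>The ideal \<open>J + (g)\<close> is strictly larger than \<open>J\<close>, so maximality
  forces it to contain a power of the coordinate \<open>z\<close>.\<close>

lemma invertible_mod:
  assumes g: "poly_fun I g" "g \<notin> J"
  shows "\<exists>k u j. poly_fun I u \<and> j \<in> J \<and> (\<forall>x. x z ^ k = j x + g x * u x)"
proof (rule ccontr)
  assume neg: "\<not> ?thesis"
  let ?J = "{f. \<exists>j u. j \<in> J \<and> poly_fun I u \<and> f = (\<lambda>x. j x + g x * u x)}"
  have 1: "pideal I ?J"
    unfolding pideal_def
  proof (intro conjI ballI allI impI)
    show "?J \<subseteq> Collect (poly_fun I)" using pidealD(1)[OF J] g by (auto intro!: poly_fun.add poly_fun.mult)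
    show "(\<lambda>_. 0) \<in> ?J"
      by (intro CollectI exI[of _ "\<lambda>_. 0"] conjI) (auto intro: pidealD[OF J] poly_fun.const)
    fix f assume "f \<in> ?J"
    then obtain j u where f: "j \<in> J" "poly_fun I u" "f = (\<lambda>x. j x + g x * u x)" by auto
    {
      fix f' assume "f' \<in> ?J"
      then obtain j' u' where f': "j' \<in> J" "poly_fun I u'" "f' = (\<lambda>x. j' x + g x * u' x)" by auto
      have "(\<lambda>x. f x + f' x) = (\<lambda>x. (j x + j' x) + g x * (u x + u' x))"
        using f f' by (simp add: algebra_simps)
      then show "(\<lambda>x. f x + f' x) \<in> ?J"
        using pidealD(3)[OF J f(1) f'(1)] poly_fun.add[OF f(2) f'(2)] by blast
    next
      fix h assume h: "poly_fun I h"
      have "(\<lambda>x. f x * h x) = (\<lambda>x. (j x * h x) + g x * (u x * h x))"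
        using f by (simp add: algebra_simps)
      then show "(\<lambda>x. f x * h x) \<in> ?J"
        using pidealD(4)[OF J f(1) h] poly_fun.mult[OF f(2) h] by blast
    }
  qed
  have 2: "J \<subseteq> ?J"
  proof
    fix j assume "j \<in> J"
    then show "j \<in> ?J"
      by (intro CollectI exI[of _ j] exI[of _ "\<lambda>_. 0"] conjI) (auto intro: poly_fun.const)
  qed
  have "(\<lambda>x. x z ^ k) \<notin> ?J" for k
  proof
    assume "(\<lambda>x. x z ^ k) \<in> ?J"
    then obtain j u where "j \<in> J" "poly_fun I u" "(\<lambda>x. x z ^ k) = (\<lambda>x. j x + g x * u x)" by auto
    then have "\<forall>x. x z ^ k = j x + g x * u x" by metis
    with neg \<open>j \<in> J\<close> \<open>poly_fun I u\<close> show False by blast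
  qed
  from maximal[OF 1 2 this] have "?J = J" .
  moreover have "g \<in> ?J"
    by (intro CollectI exI[of _ "\<lambda>_. 0"] exI[of _ "\<lambda>_. 1"] conjI)
       (auto intro: pidealD[OF J] poly_fun.const)
  ultimately show False using g by simp
qed

text \<open>If neither factor lay in \<open>J\<close>, multiplying the two relations of
  \<open>invertible_mod\<close> would put a power of \<open>z\<close> into \<open>J\<close>.\<close>

lemma prime:
  assumes "poly_fun I f" "poly_fun I g" "(\<lambda>x. f x * g x) \<in> J"
  shows "f \<in> J \<or> g \<in> J"
proof (rule ccontr)
  assume "\<not> ?thesis"
  then obtain k u j k' u' j' where
    *: "poly_fun I u" "j \<in> J" "\<And>x. x z ^ k = j x + f x * u x"
    "poly_fun I u'" "j' \<in> J" "\<And>x. x z ^ k' = j' x + g x * u' x"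
    using invertible_mod[OF assms(1)] invertible_mod[OF assms(2)] by blast
  have "(\<lambda>x. x z ^ (k + k')) =
    (\<lambda>x. (j x * (x z ^ k') + j' x * (f x * u x)) + (f x * g x) * (u x * u' x))"
  proof
    fix x
    have "x z ^ (k + k') = (j x + f x * u x) * x z ^ k'" by (simp add: power_add *(3))
    also have "\<dots> = j x * x z ^ k' + f x * u x * (j' x + g x * u' x)"
      by (simp add: *(6) algebra_simps)
    finally show "x z ^ (k + k') =
      (j x * (x z ^ k') + j' x * (f x * u x)) + (f x * g x) * (u x * u' x)"
      by (simp add: algebra_simps)
  qed
  also have "\<dots> \<in> J"
    using * assms by (intro pidealD(3)[OF J] pidealD(4)[OF J _ poly_fun.mult]
      pidealD(4)[OF J _ poly_fun_z]) auto
  finally show False using avoid by blast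
qed

text \<open>The polynomial \<open>p\<close> splits into linear factors and \<open>J\<close> is
  prime, so one of them lies in \<open>J\<close>. A nonzero constant cannot: \<open>x z ^ 0\<close>
  is the function 1, which \<open>J\<close> avoids.\<close>

lemma poly_root_in:
  assumes g: "poly_fun I g" and p: "p \<noteq> 0" "(\<lambda>x. poly p (g x)) \<in> J"
  shows "\<exists>a. (\<lambda>x. g x - a) \<in> J"
  using p
proof (induction "degree p" arbitrary: p)
  case 0
  then obtain c where c: "p = [:c:]" by (auto elim: degree_eq_zeroE)
  have "(\<lambda>x. inverse c * poly p (g x)) \<in> J" using 0 by (intro pideal_scale[OF J])
  then show ?case using c 0 avoid[of 0] by simp
next
  case (Suc n)
  have "\<not> constant (poly p)" using Suc.hyps(2) by (simp add: constant_degree)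
  then obtain a where "poly p a = 0" using fundamental_theorem_of_algebra by blast
  then obtain q where q: "p = [:-a, 1:] * q" by (auto simp: poly_eq_0_iff_dvd elim: dvdE)
  have q0: "q \<noteq> 0" using q Suc.prems by auto
  have "degree p = Suc (degree q)" unfolding q using q0 by (subst degree_mult_eq) auto
  then have d: "n = degree q" using Suc.hyps by simp
  note pf = poly_fun_poly[OF g]
  have "(\<lambda>x. poly [:-a, 1:] (g x) * poly q (g x)) \<in> J"
    using Suc.prems(2) unfolding q poly_mult .
  from prime[OF pf pf this] show ?case
  proof
    assume "(\<lambda>x. poly [:-a, 1:] (g x)) \<in> J"
    then show ?thesis by (intro exI[of _ a]) (simp add: algebra_simps)
  next
    assume "(\<lambda>x. poly q (g x)) \<in> J"
    then show ?thesis using Suc.hyps(1)[OF d q0] by blast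
  qed
qed

lemma coordinate_in:
  assumes l: "l \<in> I"
  shows "\<exists>a. (\<lambda>x. x l - a) \<in> J"
proof (rule ccontr)
  assume neg: "\<not> ?thesis"
  have pf: "poly_fun I (\<lambda>x. x l - a)" for a
    using poly_fun.add[OF poly_fun.var[OF l] poly_fun.const[of I "-a"]] by simp
  have "\<forall>a. \<exists>k u j. poly_fun I u \<and> j \<in> J \<and> (\<forall>x. x z ^ k = j x + (x l - a) * u x)"
    using invertible_mod[OF pf] neg by blast
  then obtain k u j where kuj: "\<And>a. poly_fun I (u a)" "\<And>a. j a \<in> J"
    "\<And>a x. x z ^ k a = j a x + (x l - a) * u a x" by metis
  have "\<forall>a. \<exists>s. lin_comb (monomial I ` (I \<rightarrow>\<^sub>E {..s})) (u a)"
    using poly_fun_bounded_degree[OF kuj(1) fin] by blast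
  then obtain s where s: "\<And>a. lin_comb (monomial I ` (I \<rightarrow>\<^sub>E {..s a})) (u a)" by metis
  \<comment> \<open>Pigeonhole: uncountably many \<open>a\<close> are distributed over countably
    many pairs of an exponent and a degree bound.\<close>
  have "\<exists>K S. infinite {a. k a = K \<and> s a = S}"
  proof (rule ccontr)
    assume "\<not> ?thesis"
    then have "countable (\<Union>(K, S). {a. k a = K \<and> s a = S})"
      by (intro countable_UN) (auto intro: countable_finite)
    moreover have "(\<Union>(K, S). {a. k a = K \<and> s a = S}) = UNIV" by auto
    ultimately show False using uncountable_UNIV_complex by simp
  qed
  then obtain K S where inf: "infinite {a. k a = K \<and> s a = S}" by blast
  let ?B = "monomial I ` (I \<rightarrow>\<^sub>E {..S})"
  have finB: "finite ?B" using fin by (intro finite_imageI finite_PiE) auto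
  obtain A where A: "A \<subseteq> {a. k a = K \<and> s a = S}" "finite A" "card A = Suc (card ?B)"
    using infinite_arbitrarily_large[OF inf] by blast
  have lc: "lin_comb ?B (u a)" if "a \<in> A" for a using s[of a] A(1) that by auto
  have "card ?B < card A" using A by simp
  then have "\<exists>c. (\<exists>a\<in>A. c a \<noteq> 0) \<and> (\<forall>x. (\<Sum>a\<in>A. c a * u a x) = 0)"
    by (intro lin_comb_dependent[OF finB A(2) _ lc])
  then obtain c where c': "(\<exists>a\<in>A. c a \<noteq> 0) \<and> (\<forall>x. (\<Sum>a\<in>A. c a * u a x) = 0)" ..
  then have c: "\<exists>a\<in>A. c a \<noteq> 0" "\<And>x. (\<Sum>a\<in>A. c a * u a x) = 0" by simp_all
  \<comment> \<open>Modulo \<open>J\<close>, each \<open>u a\<close> behaves like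
    \<open>z ^ K / (x l - a)\<close>. So \<open>P\<close> is the numerator of the sum of the
    fractions \<open>c a / (X - a)\<close>; at a node with \<open>c a \<noteq> 0\<close> only one
    summand survives.\<close>
  define P where "P = (\<Sum>a\<in>A. smult (c a) (\<Prod>b\<in>A - {a}. [:-b, 1:]))"
  have "P \<noteq> 0"
  proof
    assume P: "P = 0"
    obtain a where a: "a \<in> A" "c a \<noteq> 0" using c by blast
    have "poly P a = (\<Sum>a'\<in>A. c a' * (\<Prod>b\<in>A - {a'}. a - b))"
      by (simp add: P_def poly_sum poly_prod algebra_simps)
    also have "\<dots> = (\<Sum>a'\<in>A. if a' = a then c a * (\<Prod>b\<in>A - {a}. a - b) else 0)"
      using a A(2) by (intro sum.cong) auto
    also have "\<dots> = c a * (\<Prod>b\<in>A - {a}. a - b)" using a A(2) by simp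
    finally show False using P a A(2) by simp
  qed
  \<comment> \<open>Each \<open>x z ^ K\<close> is replaced by
    \<open>j a x + (x l - a) * u a x\<close>; the second terms share the factor
    \<open>\<Prod>b\<in>A. x l - b\<close> and cancel by the dependence of the
    \<open>u a\<close>.\<close>
  have "(\<lambda>x. x z ^ K * poly P (x l)) = (\<lambda>x. \<Sum>a\<in>A. j a x * (c a * (\<Prod>b\<in>A - {a}. x l - b)))"
  proof
    fix x :: "'i \<Rightarrow> complex"
    have "x z ^ K * poly P (x l) = (\<Sum>a\<in>A. x z ^ k a * (c a * (\<Prod>b\<in>A - {a}. x l - b)))"
      using A(1) by (auto simp: P_def poly_sum poly_prod sum_distrib_left intro!: sum.cong)
    also have "\<dots> = (\<Sum>a\<in>A. j a x * (c a * (\<Prod>b\<in>A - {a}. x l - b))) +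
        (\<Sum>a\<in>A. c a * u a x * ((x l - a) * (\<Prod>b\<in>A - {a}. x l - b)))"
      unfolding kuj(3) sum.distrib[symmetric] by (intro sum.cong) (auto simp: algebra_simps)
    also have "(\<Sum>a\<in>A. c a * u a x * ((x l - a) * (\<Prod>b\<in>A - {a}. x l - b))) =
        (\<Sum>a\<in>A. c a * u a x) * (\<Prod>b\<in>A. x l - b)"
      unfolding sum_distrib_right using A(2)
      by (intro sum.cong) (auto simp: prod.remove[symmetric])
    finally show "x z ^ K * poly P (x l) = (\<Sum>a\<in>A. j a x * (c a * (\<Prod>b\<in>A - {a}. x l - b)))"
      by (simp add: c(2))
  qed
  also have "\<dots> \<in> J"
  proof (intro pideal_sum[OF J] pidealD(4)[OF J] kuj(2) poly_fun.mult poly_fun.const)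
    fix a
    show "poly_fun I (\<lambda>x. \<Prod>b\<in>A - {a}. x l - b)" by (intro poly_fun_prod pf)
  qed
  finally have in_J: "(\<lambda>x. x z ^ K * poly P (x l)) \<in> J" .
  have "poly_fun I (\<lambda>x. poly P (x l))"
    by (intro poly_fun_poly poly_fun.var l)
  from prime[OF poly_fun_z this in_J] avoid have "(\<lambda>x. poly P (x l)) \<in> J" by blast
  from poly_root_in[OF poly_fun.var[OF l] \<open>P \<noteq> 0\<close> this] neg show False by blast
qed

text \<open>Every coordinate is constant modulo \<open>J\<close>, hence so is every polynomial
  \<open>f\<close>, the constant being its value at \<open>a\<close>. For \<open>f\<close> in
  \<open>J\<close> this constant lies in \<open>J\<close>, so it vanishes.\<close>

lemma common_zero: "\<exists>a. a z \<noteq> 0 \<and> (\<forall>f\<in>J. f a = 0)"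
proof -
  obtain a where a: "\<And>l. l \<in> I \<Longrightarrow> (\<lambda>x. x l - a l) \<in> J" using coordinate_in by metis
  have eval: "(\<lambda>x. u x - u a) \<in> J" if "poly_fun I u" for u
    using that
  proof (induction rule: poly_fun.induct)
    case (const c)
    then show ?case using pidealD(2)[OF J] by simp
  next
    case (var i)
    then show ?case using a by simp
  next
    case (add f g)
    then show ?case using pidealD(3)[OF J add.IH] by (simp add: algebra_simps)
  next
    case (mult f g)
    have "(\<lambda>x. (f x - f a) * g x + (g x - g a) * f a) \<in> J"
      using mult by (intro pidealD(3,4)[OF J] poly_fun.const)
    then show ?case by (simp add: algebra_simps)
  qed
  have "f a = 0" if "f \<in> J" for f
  proof (rule ccontr)
    assume "f a \<noteq> 0"
    have "(\<lambda>x. f x + (- 1) * (f x - f a)) \<in> J"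
      using that pidealD(1)[OF J that] by (intro pidealD(3)[OF J] pideal_scale[OF J] eval)
    then have "(\<lambda>x. inverse (f a) * (f a)) \<in> J" by (intro pideal_scale[OF J]) simp
    then show False using \<open>f a \<noteq> 0\<close> avoid[of 0] by simp
  qed
  moreover have "a z \<noteq> 0" using a[OF z] avoid[of 1] by auto
  ultimately show ?thesis by blast
qed

end

text \<open>Zorn's lemma enlarges \<open>J\<close> to an ideal maximal among those avoiding the
  powers of \<open>z\<close>, to which \<open>common_zero\<close> applies. Read contrapositively: a
  coordinate vanishing at all common zeros is nilpotent modulo \<open>J\<close>.\<close>

lemma nullstellensatz:
  assumes "finite I" "z \<in> I" "pideal I J" "\<And>k. (\<lambda>x. x z ^ k) \<notin> J"
  shows "\<exists>a. a z \<noteq> 0 \<and> (\<forall>f\<in>J. f a = 0)"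
proof -
  let ?F = "{J'. pideal I J' \<and> J \<subseteq> J' \<and> (\<forall>k. (\<lambda>x. x z ^ k) \<notin> J')}"
  have "\<exists>M\<in>?F. \<forall>X\<in>?F. M \<subseteq> X \<longrightarrow> X = M"
  proof (rule subset_Zorn_nonempty)
    show "?F \<noteq> {}" using assms by auto
    fix C assume C: "C \<noteq> {}" "subset.chain ?F C"
    have C1: "\<And>X. X \<in> C \<Longrightarrow> X \<in> ?F" "\<And>X Y. X \<in> C \<Longrightarrow> Y \<in> C \<Longrightarrow> X \<subseteq> Y \<or> Y \<subseteq> X"
      using C(2) by (auto simp: subset.chain_def)
    have "pideal I (\<Union>C)"
      unfolding pideal_def
    proof (intro conjI ballI allI impI)
      show "\<Union>C \<subseteq> Collect (poly_fun I)" using C1(1) unfolding pideal_def by blast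
      show "(\<lambda>_. 0) \<in> \<Union>C" using C1(1) C(1) unfolding pideal_def by blast
      fix f assume "f \<in> \<Union>C"
      then obtain X where X: "X \<in> C" "f \<in> X" by auto
      {
        fix g assume "g \<in> \<Union>C"
        then obtain Y where Y: "Y \<in> C" "g \<in> Y" by auto
        obtain Z where "Z \<in> C" "f \<in> Z" "g \<in> Z" using C1(2)[OF X(1) Y(1)] X Y by auto
        then show "(\<lambda>x. f x + g x) \<in> \<Union>C" using C1(1)[of Z] pidealD(3) by blast
      next
        fix g assume "poly_fun I g"
        then show "(\<lambda>x. f x * g x) \<in> \<Union>C" using C1(1)[OF X(1)] X pidealD(4) by blast
      }
    qed
    then show "\<Union>C \<in> ?F" using C1(1) C(1) by auto
  qed
  then obtain M where M: "M \<in> ?F" and max: "\<forall>X\<in>?F. M \<subseteq> X \<longrightarrow> X = M" by (elim bexE)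
  have M1: "pideal I M" "J \<subseteq> M" "\<And>k. (\<lambda>x. x z ^ k) \<notin> M" using M by simp_all
  interpret maximal_avoiding I M z
  proof
    fix J' assume "pideal I J'" "M \<subseteq> J'" "\<And>k. (\<lambda>x. x z ^ k) \<notin> J'"
    then show "J' = M" using M1(2) by (intro max[rule_format]) auto
  qed (use assms(1,2) M1 in simp_all)
  show ?thesis using common_zero M1(2) by blast
qed

text \<open>If the coordinates are nilpotent modulo the ideal of the \<open>f\<^sub>j\<close>, then they are so with homogeneous
  cofactors; for this, compare coefficients along the weighted scaling.\<close>

lemma homogeneous_cofactors:
  fixes N :: nat
  assumes f: "\<And>j. j < N \<Longrightarrow> wt_hom I w (d j) (f j)" and i: "i \<in> I"
    and u: "\<And>j. j < N \<Longrightarrow> poly_fun I (u j)"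
    and eq: "\<And>x. x i ^ K = (\<Sum>j<N. u j x * f j x)"
  shows "\<exists>U. (\<forall>j<N. d j \<le> K * w i \<longrightarrow> wt_hom I w (K * w i - d j) (U j)) \<and>
    (\<forall>x. x i ^ K = (\<Sum>j\<in>{j. j < N \<and> d j \<le> K * w i}. U j x * f j x))"
proof -
  have "\<forall>j. \<exists>T V. j < N \<longrightarrow> (\<forall>k. wt_hom I w k (V k)) \<and> (\<forall>x. u j x = (\<Sum>k\<le>(T::nat). V k x))"
    using poly_fun_decomp[OF u] by blast
  then obtain T V where V: "\<And>j k. j < N \<Longrightarrow> wt_hom I w k (V j k)"
    "\<And>j x. j < N \<Longrightarrow> u j x = (\<Sum>k\<le>T j. V j k x)" by metis
  \<comment> \<open>The component of \<open>u j\<close> of weight complementary to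
    \<open>d j\<close>. Subtraction is truncated, so it has this meaning only for
    \<open>d j \<le> K * w i\<close>; no other \<open>j\<close> contributes in weight
    \<open>K * w i\<close>.\<close>
  define U where "U = (\<lambda>j x. if K * w i - d j \<le> T j then V j (K * w i - d j) x else 0)"
  have "wt_hom I w (K * w i - d j) (U j)" if "j < N" for j
    using V(1)[OF that] by (cases "K * w i - d j \<le> T j") (auto simp: U_def intro: wt_hom.zero)
  moreover have "x i ^ K = (\<Sum>j\<in>{j. j < N \<and> d j \<le> K * w i}. U j x * f j x)" for x
  proof -
    let ?q = "\<Sum>j<N. \<Sum>k\<le>T j. monom (V j k x * f j x) (k + d j)"
    have "poly (monom (x i ^ K) (K * w i)) l = poly ?q l" for l
    proof -
      have "poly (monom (x i ^ K) (K * w i)) l = (l ^ w i * x i) ^ K"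
        by (simp add: poly_monom power_mult_distrib power_mult[symmetric] mult.commute)
      also have "\<dots> = (\<Sum>j<N. u j (\<lambda>i. l ^ w i * x i) * f j (\<lambda>i. l ^ w i * x i))"
        using eq[of "\<lambda>i. l ^ w i * x i"] .
      also have "\<dots> = (\<Sum>j<N. (\<Sum>k\<le>T j. l ^ k * V j k x) * (l ^ d j * f j x))"
        by (rule sum.cong) (auto simp: V wt_hom_scaling[OF f] wt_hom_scaling[OF V(1)])
      also have "\<dots> = poly ?q l"
        by (simp add: poly_sum poly_monom power_add sum_distrib_right sum_distrib_left mult_ac)
      finally show ?thesis .
    qed
    then have "monom (x i ^ K) (K * w i) = ?q" by (intro poly_ext) auto
    from arg_cong[OF this, of "\<lambda>p. coeff p (K * w i)"]
    have "x i ^ K = (\<Sum>j<N. \<Sum>k\<le>T j. if k + d j = K * w i then V j k x * f j x else 0)"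
      by (simp add: coeff_sum)
    also have "\<dots> = (\<Sum>j<N. if d j \<le> K * w i then U j x * f j x else 0)"
    proof (rule sum.cong)
      fix j
      show "(\<Sum>k\<le>T j. if k + d j = K * w i then V j k x * f j x else 0) =
          (if d j \<le> K * w i then U j x * f j x else 0)"
      proof (cases "d j \<le> K * w i")
        case True
        then have "(k + d j = K * w i) = (k = K * w i - d j)" for k by auto
        then show ?thesis using True by (simp add: U_def)
      next
        case False
        then show ?thesis by (auto intro!: sum.neutral)
      qed
    qed simp
    also have "\<dots> = (\<Sum>j\<in>{j. j < N \<and> d j \<le> K * w i}. U j x * f j x)"
      by (rule sum.mono_neutral_cong_right) auto
    finally show ?thesis .
  qed
  ultimately show ?thesis by blast
qed

section \<open>Counting monomials: a bound on the number of variables\<close>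

lemma digits_inj:
  assumes "\<And>i. i < n \<Longrightarrow> e i \<le> s" "\<And>i. i < n \<Longrightarrow> e' i \<le> s"
    and "(\<Sum>i<n. e i * Suc s ^ i) = (\<Sum>i<n. e' i * Suc s ^ i)" and "i < n"
  shows "e i = e' i"
  using assms
proof (induction n arbitrary: e e' i)
  case (Suc n)
  have split: "(\<Sum>i<Suc n. a i * Suc s ^ i) = a 0 + Suc s * (\<Sum>i<n. a (Suc i) * Suc s ^ i)" for a
    by (subst sum.lessThan_Suc_shift) (simp add: sum_distrib_left algebra_simps)
  let ?E = "\<Sum>i<n. e (Suc i) * Suc s ^ i" and ?E' = "\<Sum>i<n. e' (Suc i) * Suc s ^ i"
  have eq: "e 0 + Suc s * ?E = e' 0 + Suc s * ?E'" using Suc.prems(3) unfolding split .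
  have lt: "e 0 < Suc s" "e' 0 < Suc s" using Suc.prems(1,2)[of 0] by auto
  have "e 0 = (e 0 + Suc s * ?E) mod Suc s" using lt by (simp del: mult_Suc)
  also have "\<dots> = e' 0" unfolding eq using lt by (simp del: mult_Suc)
  finally have e0: "e 0 = e' 0" .
  with eq have E: "?E = ?E'" by (simp del: mult_Suc)
  show ?case
  proof (cases i)
    case 0
    with e0 show ?thesis by simp
  next
    case (Suc k)
    then show ?thesis
      using Suc.IH[of "\<lambda>i. e (Suc i)" "\<lambda>i. e' (Suc i)" k] Suc.prems E by auto
  qed
qed simp

text \<open>Kronecker's substitution reduces the independence of monomials to one variable.\<close>

lemma monomials_independent:
  assumes fin: "finite I" and c: "\<And>x. (\<Sum>e\<in>I \<rightarrow>\<^sub>E {..s}. c e * monomial I e x) = 0"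
    and e: "e \<in> I \<rightarrow>\<^sub>E {..s}"
  shows "c e = 0"
proof -
  obtain idx where idx: "bij_betw idx {..<card I} I"
    using ex_bij_betw_nat_finite[OF fin] by (auto simp: atLeast0LessThan)
  define num where "num = the_inv_into {..<card I} idx"
  have num: "bij_betw num I {..<card I}" "\<And>k. k < card I \<Longrightarrow> num (idx k) = k"
    using bij_betw_the_inv_into[OF idx] the_inv_into_f_f[of idx "{..<card I}"] idx
    by (auto simp: num_def bij_betw_def)
  define code where "code = (\<lambda>e. \<Sum>i\<in>I. e i * Suc s ^ num i)"
  have code: "code e = (\<Sum>k<card I. e (idx k) * Suc s ^ k)" for e
  proof -
    have "code e = (\<Sum>k<card I. e (idx k) * Suc s ^ num (idx k))"
      unfolding code_def by (rule sum.reindex_bij_betw[OF idx, symmetric])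
    then show ?thesis using num(2) by simp
  qed
  have inj: "e = e'" if "e \<in> I \<rightarrow>\<^sub>E {..s}" "e' \<in> I \<rightarrow>\<^sub>E {..s}" "code e = code e'" for e e'
  proof (rule PiE_ext[OF that(1,2)])
    fix i assume "i \<in> I"
    then obtain k where k: "k < card I" "i = idx k" using idx by (auto simp: bij_betw_def)
    have "idx k \<in> I" if "k < card I" for k using that idx by (auto simp: bij_betw_def)
    then show "e i = e' i"
      unfolding k(2) using that(1,2) that(3)[unfolded code] k(1)
      by (intro digits_inj[where e = "\<lambda>k. e (idx k)" and e' = "\<lambda>k. e' (idx k)" and s = s]) auto
  qed
  \<comment> \<open>Substituting \<open>l ^ (Suc s ^ num i)\<close> for the variable
    \<open>i\<close> turns \<open>monomial I e\<close> into \<open>l ^ code e\<close>.\<close>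
  let ?p = "\<Sum>e\<in>I \<rightarrow>\<^sub>E {..s}. monom (c e) (code e)"
  have "poly ?p l = poly 0 l" for l
  proof -
    have "poly ?p l = (\<Sum>e\<in>I \<rightarrow>\<^sub>E {..s}. c e * monomial I e (\<lambda>i. l ^ (Suc s ^ num i)))"
      by (simp add: poly_sum poly_monom monomial_def code_def power_sum power_mult[symmetric]
          mult.commute[of "Suc s ^ _"])
    also have "\<dots> = 0" by (rule c)
    finally show ?thesis by simp
  qed
  then have "?p = 0" by (intro poly_ext) auto
  have fE: "finite (I \<rightarrow>\<^sub>E {..s})" using fin by (intro finite_PiE) auto
  from \<open>?p = 0\<close> have "0 = coeff ?p (code e)" by simp
  also have "\<dots> = (\<Sum>e'\<in>I \<rightarrow>\<^sub>E {..s}. if e' = e then c e else 0)"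
    unfolding coeff_sum using inj e by (intro sum.cong) (auto simp: )
  also have "\<dots> = c e" using e fE by simp
  finally show ?thesis by simp
qed

text \<open>The situation when the origin is the only common zero: all coordinates are nilpotent
  modulo the \<open>f j\<close>, with one exponent \<open>K\<close> and homogeneous cofactors.
  Positivity of the \<open>d j\<close> makes every rewriting of \<open>x i ^ K\<close> leave
  cofactors of smaller weight. The aim is \<open>card I \<le> N\<close>.\<close>

locale nilpotent_coordinates =
  fixes I :: "'i set" and w :: "'i \<Rightarrow> nat" and N K :: nat and d :: "nat \<Rightarrow> nat"
    and f :: "nat \<Rightarrow> ('i \<Rightarrow> complex) \<Rightarrow> complex" and U :: "'i \<Rightarrow> nat \<Rightarrow> ('i \<Rightarrow> complex) \<Rightarrow> complex"
  assumes fin: "finite I" and d: "\<And>j. j < N \<Longrightarrow> d j \<ge> 1"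
    and U: "\<And>i j. i \<in> I \<Longrightarrow> j < N \<Longrightarrow> d j \<le> K * w i \<Longrightarrow> wt_hom I w (K * w i - d j) (U i j)"
    and eq: "\<And>i x. i \<in> I \<Longrightarrow> x i ^ K = (\<Sum>j\<in>{j. j < N \<and> d j \<le> K * w i}. U i j x * f j x)"
begin

text \<open>The monomials with exponents below \<open>K\<close> generate the polynomial ring as a
  module over the algebra of the \<open>f j\<close>. Bounding the exponents of the
  \<open>f j\<close> by \<open>s\<close> cuts out a finite set.\<close>

definition products :: "nat \<Rightarrow> (('i \<Rightarrow> complex) \<Rightarrow> complex) set" where
  "products s = (\<lambda>(e, r) x. monomial I e x * (\<Prod>j<N. f j x ^ r j)) `
     ((I \<rightarrow>\<^sub>E {..<K}) \<times> ({..<N} \<rightarrow>\<^sub>E {..s}))"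

lemma productsI:
  assumes "\<And>i. i \<in> I \<Longrightarrow> e i < K" "\<And>j. j < N \<Longrightarrow> r j \<le> s"
  shows "(\<lambda>x. monomial I e x * (\<Prod>j<N. f j x ^ r j)) \<in> products s"
proof -
  have "(\<lambda>x. monomial I e x * (\<Prod>j<N. f j x ^ r j)) =
      (\<lambda>(e, r) x. monomial I e x * (\<Prod>j<N. f j x ^ r j)) (restrict e I, restrict r {..<N})"
    by (simp add: monomial_restrict)
  moreover have "(restrict e I, restrict r {..<N}) \<in> (I \<rightarrow>\<^sub>E {..<K}) \<times> ({..<N} \<rightarrow>\<^sub>E {..s})"
    using assms by auto
  ultimately show ?thesis unfolding products_def by blast
qed

lemma productsE:
  assumes "b \<in> products s"
  obtains e r where "\<And>i. i \<in> I \<Longrightarrow> e i < K" "\<And>j. j < N \<Longrightarrow> r j \<le> s"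
    "b = (\<lambda>x. monomial I e x * (\<Prod>j<N. f j x ^ r j))"
  using assms unfolding products_def by (auto simp: PiE_iff)

lemma products_mono: "s \<le> s' \<Longrightarrow> products s \<subseteq> products s'"
  by (auto elim!: productsE intro!: productsI le_trans[of _ s s'])

lemma card_products: "finite (products s)" "card (products s) \<le> K ^ card I * Suc s ^ N"
proof -
  let ?P = "(I \<rightarrow>\<^sub>E {..<K}) \<times> ({..<N} \<rightarrow>\<^sub>E {..s})"
  have "finite ?P" using fin by (intro finite_cartesian_product finite_PiE) auto
  moreover have "card ?P = K ^ card I * Suc s ^ N"
    using fin by (simp add: card_cartesian_product card_PiE)
  ultimately show "finite (products s)" "card (products s) \<le> K ^ card I * Suc s ^ N"
    unfolding products_def using card_image_le[of ?P] by auto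
qed

lemma products_mult_f:
  assumes "b \<in> products s" "j < N"
  shows "(\<lambda>x. b x * f j x) \<in> products (Suc s)"
proof -
  obtain e r where b: "\<And>i. i \<in> I \<Longrightarrow> e i < K" "\<And>j. j < N \<Longrightarrow> r j \<le> s"
    "b = (\<lambda>x. monomial I e x * (\<Prod>j<N. f j x ^ r j))" using productsE[OF assms(1)] by metis
  have "(\<Prod>k<N. f k x ^ (r(j := Suc (r j))) k) = (\<Prod>k<N. f k x ^ r k) * f j x" for x
  proof -
    have "(\<Prod>k<N. f k x ^ (r(j := Suc (r j))) k) = (\<Prod>k<N. f k x ^ r k * (if k = j then f j x else 1))"
      by (rule prod.cong) auto
    then show ?thesis using assms(2) by (simp add: prod.distrib)
  qed
  then have "(\<lambda>x. b x * f j x) =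
      (\<lambda>x. monomial I e x * (\<Prod>k<N. f k x ^ (r(j := Suc (r j))) k))"
    by (simp add: b(3) mult.assoc)
  also have "\<dots> \<in> products (Suc s)"
    using b(1,2) by (intro productsI) (auto simp: le_SucI)
  finally show ?thesis .
qed

text \<open>A monomial with some exponent at least \<open>K\<close> is rewritten by
  \<open>eq\<close>. Each resulting term is an \<open>f j\<close> times a form of smaller weight, so
  induction applies; the extra factor raises the exponent bound by one, which the drop in weight
  pays for.\<close>

lemma wt_hom_in_span: "wt_hom I w s g \<Longrightarrow> lin_comb (products s) g"
proof (induction s arbitrary: g rule: less_induct)
  case (less s)
  show ?case
  proof (rule lin_comb_trans[OF wt_hom_monomials[OF less.prems fin]])
    fix b assume "b \<in> {monomial I e | e. (\<Sum>i\<in>I. e i * w i) = s}"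
    then obtain e where e: "b = monomial I e" "(\<Sum>i\<in>I. e i * w i) = s" by auto
    show "lin_comb (products s) b"
    proof (cases "\<forall>i\<in>I. e i < K")
      case True
      then have "(\<lambda>x. monomial I e x * (\<Prod>j<N. f j x ^ (\<lambda>_. 0) j)) \<in> products s"
        by (intro productsI) auto
      then show ?thesis unfolding e(1) by (intro lin_comb_base) simp
    next
      case False
      then obtain i where i: "i \<in> I" "K \<le> e i" by (auto simp: not_less)
      define e' where "e' = e(i := e i - K)"
      have "e = (\<lambda>j. e' j + (if j = i then K else 0))" using i(2) by (auto simp: e'_def)
      then have mon: "monomial I e = (\<lambda>x. monomial I e' x * x i ^ K)"
        using monomial_mult[of I e' "\<lambda>j. if j = i then K else 0"] monomial_single[OF fin i(1), of K]
        by metis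
      have deg: "(\<Sum>j\<in>I. e' j * w j) + K * w i = s"
        using i fin unfolding e(2)[symmetric] e'_def
        by (simp add: sum.remove[OF fin i(1)] add_mult_distrib[symmetric])
      have b: "b = (\<lambda>x. \<Sum>j\<in>{j. j < N \<and> d j \<le> K * w i}. monomial I e' x * U i j x * f j x)"
        unfolding e(1) mon by (simp add: eq[OF i(1)] sum_distrib_left mult.assoc)
      show ?thesis
        unfolding b
      proof (rule lin_comb_sum)
        fix j assume "j \<in> {j. j < N \<and> d j \<le> K * w i}"
        then have j: "j < N" "d j \<le> K * w i" by auto
        let ?s = "(\<Sum>j\<in>I. e' j * w j) + (K * w i - d j)"
        have s: "?s < s" using d[OF j(1)] j(2) deg by linarith
        have "lin_comb (products ?s) (\<lambda>x. monomial I e' x * U i j x)"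
          by (intro less.IH[OF s] wt_hom.mult wt_hom_monomial fin U i j)
        then show "lin_comb (products s) (\<lambda>x. monomial I e' x * U i j x * f j x)"
        proof (rule lin_comb_mult_right)
          fix b assume "b \<in> products ?s"
          from products_mult_f[OF this j(1)] products_mono[of "Suc ?s" s] s
          show "lin_comb (products s) (\<lambda>x. b x * f j x)" by (intro lin_comb_base) auto
        qed
      qed
    qed
  qed
qed

text \<open>Comparison of growth: the box of monomials has \<open>Suc s ^ card I\<close> elements,
  whereas the size of its spanning set is of order \<open>s ^ N\<close>.\<close>

lemma card_le: "card I \<le> N"
proof (rule ccontr)
  assume "\<not> card I \<le> N"
  \<comment> \<open>A monomial with exponents at most \<open>s\<close> has weight at most
    \<open>s * W\<close>; the extra 1 gives \<open>Suc (s * W) \<le> W * Suc s\<close>.\<close>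
  define W where "W = Suc (\<Sum>i\<in>I. w i)"
  \<comment> \<open>Equal to the constant factor of the upper bound, which thereby becomes
    \<open>s * Suc s ^ N\<close> and stays below \<open>Suc s ^ Suc N\<close>.\<close>
  define s where "s = K ^ card I * W ^ N"
  let ?E = "I \<rightarrow>\<^sub>E {..s}"
  have fE: "finite ?E" using fin by (intro finite_PiE) auto
  have lc: "lin_comb (products (s * W)) (monomial I e)" if e: "e \<in> ?E" for e
  proof -
    have "(\<Sum>i\<in>I. e i * w i) \<le> (\<Sum>i\<in>I. s * w i)"
      using e by (intro sum_mono mult_right_mono) auto
    then have le: "(\<Sum>i\<in>I. e i * w i) \<le> s * W" by (simp add: W_def sum_distrib_left[symmetric])
    from wt_hom_in_span[OF wt_hom_monomial[OF fin]] show ?thesis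
      by (rule lin_comb_trans) (use products_mono[OF le] in \<open>auto intro: lin_comb_base\<close>)
  qed
  have "card (products (s * W)) \<le> K ^ card I * Suc (s * W) ^ N" by (rule card_products)
  also have "\<dots> \<le> K ^ card I * (W * Suc s) ^ N"
    by (intro mult_left_mono power_mono) (auto simp: W_def)
  also have "\<dots> = s * Suc s ^ N" by (simp only: s_def power_mult_distrib mult.assoc)
  also have "\<dots> < Suc s * Suc s ^ N" by simp
  also have "\<dots> \<le> Suc s ^ card I"
    using \<open>\<not> card I \<le> N\<close> by (subst power_Suc[symmetric], intro power_increasing) auto
  also have "\<dots> = card ?E" using fin by (simp add: card_PiE)
  finally have "card (products (s * W)) < card ?E" .
  from lin_comb_dependent[OF card_products(1) fE this lc]
  obtain c where c: "(\<exists>e\<in>?E. c e \<noteq> 0) \<and> (\<forall>x. (\<Sum>e\<in>?E. c e * monomial I e x) = 0)" ..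
  then show False using monomials_independent[OF fin, where s = s and c = c] by blast
qed

end

text \<open>A weighted form of the projective dimension theorem. If only the origin were a common
  zero, the Nullstellensatz would make every coordinate nilpotent modulo the \<open>f j\<close>, and
  \<open>card_le\<close> would bound the number of variables by \<open>N\<close>.\<close>

theorem nontrivial_common_zero:
  fixes N :: nat
  assumes fin: "finite I"
    and f: "\<And>j. j < N \<Longrightarrow> wt_hom I w (d j) (f j)" and d: "\<And>j. j < N \<Longrightarrow> d j \<ge> 1"
    and card: "N < card I"
  shows "\<exists>x. (\<exists>i\<in>I. x i \<noteq> 0) \<and> (\<forall>j<N. f j x = 0)"
proof (rule ccontr)
  assume neg: "\<not> ?thesis"
  let ?J = "{g. \<exists>u. (\<forall>j<N. poly_fun I (u j)) \<and> g = (\<lambda>x. \<Sum>j<N. u j x * f j x)}"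
  have ideal: "pideal I ?J"
    unfolding pideal_def
  proof (intro conjI ballI allI impI)
    show "?J \<subseteq> Collect (poly_fun I)"
      by (auto intro!: poly_fun_sum poly_fun.mult wt_hom_pfun[OF f])
    show "(\<lambda>_. 0) \<in> ?J" by (intro CollectI exI[of _ "\<lambda>_ _. 0"]) (auto intro: poly_fun.const)
    fix g assume "g \<in> ?J"
    then obtain u where u: "\<forall>j<N. poly_fun I (u j)" "g = (\<lambda>x. \<Sum>j<N. u j x * f j x)" by auto
    {
      fix g' assume "g' \<in> ?J"
      then obtain u' where u': "\<forall>j<N. poly_fun I (u' j)" "g' = (\<lambda>x. \<Sum>j<N. u' j x * f j x)" by auto
      show "(\<lambda>x. g x + g' x) \<in> ?J"
        using u u' by (intro CollectI exI[of _ "\<lambda>j x. u j x + u' j x"])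
          (auto simp: distrib_right sum.distrib intro: poly_fun.add)
    next
      fix h assume "poly_fun I h"
      then show "(\<lambda>x. g x * h x) \<in> ?J"
        using u by (intro CollectI exI[of _ "\<lambda>j x. h x * u j x"])
          (auto simp: sum_distrib_left mult_ac intro: poly_fun.mult)
    }
  qed
  have "\<exists>k. (\<lambda>x. x i ^ k) \<in> ?J" if i: "i \<in> I" for i
  proof (rule ccontr)
    assume "\<not> ?thesis"
    then have "\<And>k. (\<lambda>x. x i ^ k) \<notin> ?J" by simp
    from nullstellensatz[OF fin i ideal this]
    obtain a where a: "a i \<noteq> 0 \<and> (\<forall>g\<in>?J. g a = 0)" ..
    have "f j \<in> ?J" if j: "j < N" for j
    proof (intro CollectI exI[of _ "\<lambda>k _. if k = j then 1 else 0"] conjI)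
      show "f j = (\<lambda>x. \<Sum>k<N. (if k = j then 1 else 0) * f k x)"
      proof
        fix x
        have "(\<Sum>k<N. (if k = j then 1 else 0) * f k x) = (\<Sum>k<N. if k = j then f k x else 0)"
          by (rule sum.cong) auto
        then show "f j x = (\<Sum>k<N. (if k = j then 1 else 0) * f k x)" using j by simp
      qed
    qed (auto intro: poly_fun.const)
    then have "\<forall>j<N. f j a = 0" using a by simp
    then show False using neg a i by blast
  qed
  then have "\<forall>i\<in>I. \<exists>k. (\<lambda>x. x i ^ k) \<in> ?J" by simp
  from bchoice[OF this] obtain k where k: "\<forall>i\<in>I. (\<lambda>x. x i ^ k i) \<in> ?J" ..
  define K where "K = (\<Sum>i\<in>I. k i)"
  have "(\<lambda>x. x i ^ K) \<in> ?J" if i: "i \<in> I" for i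
  proof -
    have "K = k i + (K - k i)" using member_le_sum[OF i _ fin, of k] by (simp add: K_def)
    then have "(\<lambda>x. x i ^ K) = (\<lambda>x. x i ^ k i * x i ^ (K - k i) :: complex)"
      by (simp add: power_add[symmetric])
    also have "\<dots> \<in> ?J"
      by (intro pidealD(4)[OF ideal bspec[OF k i]] poly_fun_power poly_fun.var i)
    finally show ?thesis .
  qed
  then have "\<forall>i. \<exists>u. i \<in> I \<longrightarrow> (\<forall>j<N. poly_fun I (u j)) \<and> (\<forall>x. x i ^ K = (\<Sum>j<N. u j x * f j x))"
    by (auto simp: fun_eq_iff)
  from choice[OF this] obtain u where u:
    "\<forall>i. i \<in> I \<longrightarrow> (\<forall>j<N. poly_fun I (u i j)) \<and> (\<forall>x. x i ^ K = (\<Sum>j<N. u i j x * f j x))" ..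
  have "\<forall>i. \<exists>U. i \<in> I \<longrightarrow> (\<forall>j<N. d j \<le> K * w i \<longrightarrow> wt_hom I w (K * w i - d j) (U j)) \<and>
    (\<forall>x. x i ^ K = (\<Sum>j\<in>{j. j < N \<and> d j \<le> K * w i}. U j x * f j x))"
  proof
    fix i
    show "\<exists>U. i \<in> I \<longrightarrow> (\<forall>j<N. d j \<le> K * w i \<longrightarrow> wt_hom I w (K * w i - d j) (U j)) \<and>
      (\<forall>x. x i ^ K = (\<Sum>j\<in>{j. j < N \<and> d j \<le> K * w i}. U j x * f j x))"
      using homogeneous_cofactors[where N = N and I = I and w = w and d = d and f = f and i = i and u = "u i" and K = K] f u by simp
  qed
  from choice[OF this] obtain U where U: "\<forall>i. i \<in> I \<longrightarrow> (\<forall>j<N. d j \<le> K * w i \<longrightarrow> wt_hom I w (K * w i - d j) (U i j)) \<and>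
    (\<forall>x. x i ^ K = (\<Sum>j\<in>{j. j < N \<and> d j \<le> K * w i}. U i j x * f j x))" ..
  interpret nilpotent_coordinates I w N K d f U
  proof
    fix i j assume "i \<in> I" "j < N" "d j \<le> K * w i"
    then show "wt_hom I w (K * w i - d j) (U i j)" using U by simp
  next
    fix i x assume "i \<in> I"
    then show "x i ^ K = (\<Sum>j\<in>{j. j < N \<and> d j \<le> K * w i}. U i j x * f j x)" using U by simp
  qed (use fin d in simp_all)
  show False using card_le card by simp
qed

section \<open>Polynomials whose powers combine to a constant\<close>

lemma wt_hom_coeff_mult:
  assumes "\<And>k. wt_hom I w k (\<lambda>x. coeff (p x) k)" "\<And>k. wt_hom I w k (\<lambda>x. coeff (q x) k)"
  shows "wt_hom I w k (\<lambda>x. coeff (p x * q x) k)"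
  unfolding coeff_mult
proof (rule wt_hom_sum)
  fix i assume "i \<in> {..k}"
  then show "wt_hom I w k (\<lambda>x. coeff (p x) i * coeff (q x) (k - i))"
    using wt_hom.mult[OF assms(1)[of i] assms(2)[of "k - i"]] by simp
qed

lemma wt_hom_coeff_power:
  assumes "\<And>k. wt_hom I w k (\<lambda>x. coeff (p x) k)"
  shows "wt_hom I w k (\<lambda>x. coeff (p x ^ n) k)"
proof (induction n arbitrary: k)
  case 0
  show ?case by (cases k) (auto intro: wt_hom.intros)
next
  case (Suc n)
  then show ?case using wt_hom_coeff_mult[OF assms Suc] by simp
qed

theorem sum_of_powers_constant:
  fixes m :: "'a \<Rightarrow> nat" and z :: "'a \<Rightarrow> complex"
  assumes fin: "finite J" and m: "\<And>j. j \<in> J \<Longrightarrow> m j \<ge> 1" and S: "(\<Sum>j\<in>J. 1 / real (m j)) > 1"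
  shows "\<exists>y. (\<forall>j\<in>J. poly (y j) 0 = 1) \<and> (\<exists>j\<in>J. degree (y j) > 0) \<and>
    (\<Sum>j\<in>J. smult (z j) (y j ^ m j)) = [:\<Sum>j\<in>J. z j:]"
proof -
  \<comment> \<open>A common multiple of the \<open>m j\<close>: with
    \<open>degree (y j) \<le> d div m j\<close> all powers have degree at most \<open>d\<close>, and
    the coefficients of degrees 1 to \<open>d\<close> give \<open>d\<close> equations of positive
    weight.\<close>
  define d where "d = (\<Prod>j\<in>J. m j)"
  have d0: "d > 0" unfolding d_def using m by (auto intro!: prod_pos simp: Suc_le_eq)
  have dvd: "m j dvd d" if "j \<in> J" for j unfolding d_def using fin that by (rule dvd_prodI)
  \<comment> \<open>The unknown \<open>(j, k)\<close> is the coefficient of degree \<open>k\<close>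
    of \<open>y j\<close> and has weight \<open>k\<close>, that is \<open>snd\<close>; the
    coefficient of degree \<open>k\<close> of a product then again has weight \<open>k\<close>.
    Constant coefficients are fixed to 1 and are not unknowns.\<close>
  define I where "I = Sigma J (\<lambda>j. {1..d div m j})"
  define Y where "Y = (\<lambda>x j. 1 + (\<Sum>k=1..d div m j. monom (x (j, k) :: complex) k))"
  have fI: "finite I" using fin by (simp add: I_def)
  have "real (card I) = (\<Sum>j\<in>J. real (d div m j))" using fin by (simp add: I_def)
  also have "\<dots> = (\<Sum>j\<in>J. real d * (1 / real (m j)))"
    using dvd by (intro sum.cong) (auto simp: real_of_nat_div)
  also have "\<dots> = real d * (\<Sum>j\<in>J. 1 / real (m j))" by (simp add: sum_distrib_left)
  also have "\<dots> > real d * 1" using S d0 by (intro mult_strict_left_mono) auto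
  finally have card: "d < card I" by simp
  have coeff_Y: "coeff (Y x j) k = (if k = 0 then 1 else if k \<le> d div m j then x (j, k) else 0)" for x j k
  proof -
    have "coeff (Y x j) k = (if k = 0 then 1 else 0) + (\<Sum>i=1..d div m j. if i = k then x (j, k) else 0)"
      unfolding Y_def by (simp add: coeff_sum cong: if_cong)
    then show ?thesis by auto
  qed
  have wt_hom_Y: "wt_hom I snd k (\<lambda>x. coeff (Y x j) k)" if "j \<in> J" for j k
  proof (cases "k = 0 \<or> d div m j < k")
    case True
    then show ?thesis by (auto simp: coeff_Y intro: wt_hom.intros)
  next
    case False
    then have "(j, k) \<in> I" using that by (auto simp: I_def)
    from wt_hom.var[OF this, of snd] False show ?thesis by (simp add: coeff_Y)
  qed
  define f where "f = (\<lambda>k x. coeff (\<Sum>j\<in>J. smult (z j) (Y x j ^ m j)) (Suc k))"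
  have f: "wt_hom I snd (Suc k) (f k)" for k
    unfolding f_def coeff_sum coeff_smult
    by (intro wt_hom_sum wt_hom_scale wt_hom_coeff_power wt_hom_Y)
  have "\<exists>x. (\<exists>i\<in>I. x i \<noteq> 0) \<and> (\<forall>k<d. f k x = 0)"
    by (rule nontrivial_common_zero[where d = Suc, OF fI f _ card]) auto
  then obtain x where x: "\<exists>i\<in>I. x i \<noteq> 0" "\<forall>k<d. f k x = 0" by blast
  have "degree (Y x j) \<le> d div m j" for j
    by (rule degree_le) (auto simp: coeff_Y)
  then have "degree (Y x j ^ m j) \<le> d div m j * m j" for j
    by (rule order_trans[OF degree_power_le mult_right_mono]) simp
  then have deg: "degree (Y x j ^ m j) \<le> d" for j
    by (meson div_times_less_eq_dividend order_trans)
  have "(\<Sum>j\<in>J. smult (z j) (Y x j ^ m j)) = [:\<Sum>j\<in>J. z j:]"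
  proof (rule poly_eqI)
    fix k
    show "coeff (\<Sum>j\<in>J. smult (z j) (Y x j ^ m j)) k = coeff [:\<Sum>j\<in>J. z j:] k"
    proof (cases k)
      case 0
      have "coeff (Y x j ^ m j) 0 = 1" for j
        by (simp add: coeff_0_power coeff_Y)
      then show ?thesis using 0 by (simp add: coeff_sum)
    next
      case (Suc l)
      show ?thesis
      proof (cases "l < d")
        case True
        then have "f l x = 0" using x(2) by simp
        then show ?thesis using Suc by (simp add: f_def)
      next
        case False
        then have "coeff (Y x j ^ m j) k = 0" for j using deg[of j] Suc by (intro coeff_eq_0) linarith
        then show ?thesis using Suc by (simp add: coeff_sum)
      qed
    qed
  qed
  moreover have "poly (Y x j) 0 = 1" for j by (simp add: poly_0_coeff_0 coeff_Y)
  \<comment> \<open>All unknowns are coefficients of positive degree, so a nontrivial solution is a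
    nonconstant one.\<close>
  moreover have "\<exists>j\<in>J. degree (Y x j) > 0"
  proof -
    from x(1) obtain j k where "(j, k) \<in> I" "x (j, k) \<noteq> 0" by auto
    then have "j \<in> J" "k > 0" "coeff (Y x j) k \<noteq> 0" by (auto simp: I_def coeff_Y)
    then show ?thesis using le_degree[of "Y x j" k] by (intro bexI[of _ j]) auto
  qed
  ultimately show ?thesis by (intro exI[of _ "Y x"]) auto
qed

section \<open>Polynomial subalgebras in one variable\<close>

lemma degree_sum_distinct:
  fixes u :: "'a \<Rightarrow> 'b::comm_ring_1 poly"
  assumes "finite A" "\<exists>i\<in>A. u i \<noteq> 0"
    and dist: "\<And>i j. i \<in> A \<Longrightarrow> j \<in> A \<Longrightarrow> u i \<noteq> 0 \<Longrightarrow> u j \<noteq> 0 \<Longrightarrow> degree (u i) = degree (u j) \<Longrightarrow> i = j"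
  shows "(\<Sum>i\<in>A. u i) \<noteq> 0 \<and> (\<forall>i\<in>A. degree (u i) \<le> degree (\<Sum>i\<in>A. u i))"
proof -
  let ?A = "{i \<in> A. u i \<noteq> 0}"
  have "finite ?A" "?A \<noteq> {}" using assms by auto
  then have "Max ((\<lambda>i. degree (u i)) ` ?A) \<in> (\<lambda>i. degree (u i)) ` ?A" by (intro Max_in) auto
  then obtain m where m: "m \<in> ?A" "degree (u m) = Max ((\<lambda>i. degree (u i)) ` ?A)" by force
  have max: "degree (u i) \<le> degree (u m)" if "i \<in> ?A" for i
    unfolding m(2) using that \<open>finite ?A\<close> by (intro Max_ge) auto
  have "coeff (\<Sum>i\<in>A. u i) (degree (u m)) = (\<Sum>i\<in>A. if i = m then lead_coeff (u m) else 0)"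
    unfolding coeff_sum
  proof (rule sum.cong)
    fix i assume i: "i \<in> A"
    show "coeff (u i) (degree (u m)) = (if i = m then lead_coeff (u m) else 0)"
    proof (cases "i = m \<or> u i = 0")
      case False
      then have "degree (u i) < degree (u m)"
        using m(1) max[of i] i dist[of i m] by (auto simp: le_less)
      then show ?thesis using False by (auto intro: coeff_eq_0)
    qed (use m in auto)
  qed simp
  also have "\<dots> = lead_coeff (u m)" using m assms(1) by simp
  finally have c: "coeff (\<Sum>i\<in>A. u i) (degree (u m)) \<noteq> 0" using m(1) by simp
  then have "degree (u m) \<le> degree (\<Sum>i\<in>A. u i)" by (rule le_degree)
  moreover have "degree (u i) \<le> degree (u m)" if "i \<in> A" for i
    using max[of i] that by (cases "u i = 0") auto
  ultimately show ?thesis using c by (auto intro: order_trans)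
qed

lemma degree_diff_cancel_lead:
  fixes p q :: "'a::ab_group_add poly"
  assumes "degree q = degree p" "lead_coeff q = lead_coeff p" "degree p > 0"
  shows "degree (p - q) < degree p"
proof (rule degree_lessI)
  show "\<forall>k\<ge>degree p. coeff (p - q) k = 0"
  proof (intro allI impI)
    fix k assume "degree p \<le> k"
    then show "coeff (p - q) k = 0"
      using assms by (cases "k = degree p") (auto simp: coeff_eq_0)
  qed
qed (use assms in auto)

lemma smult_sum_right: "smult c (\<Sum>i\<in>A. f i) = (\<Sum>i\<in>A. smult c (f i))"
  by (induction A rule: infinite_finite_induct) (simp_all add: smult_add_right)

text \<open>Polynomial setting for Lueroth's theorem: the aim is a polynomial generating the field
  of fractions of \<open>S\<close>. Degrees take the place of field theory.\<close>

locale poly_subalgebra =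
  fixes S :: "complex poly set"
  assumes const: "[:c:] \<in> S" and add: "p \<in> S \<Longrightarrow> q \<in> S \<Longrightarrow> p + q \<in> S"
    and mult: "p \<in> S \<Longrightarrow> q \<in> S \<Longrightarrow> p * q \<in> S" and nonconst: "\<exists>p\<in>S. degree p > 0"
begin

lemma zero: "0 \<in> S" and one: "1 \<in> S"
  using const[of 0] const[of 1] by (simp_all add: one_pCons)

lemma smult: "p \<in> S \<Longrightarrow> smult c p \<in> S"
  using mult[OF const[of c]] by simp

lemma diff: "p \<in> S \<Longrightarrow> q \<in> S \<Longrightarrow> p - q \<in> S"
  using add[of p "- q"] smult[of q "- 1"] by simp

lemma power: "p \<in> S \<Longrightarrow> p ^ k \<in> S"
  by (induction k) (auto intro: mult one)

lemma sum: "(\<And>i. i \<in> A \<Longrightarrow> f i \<in> S) \<Longrightarrow> (\<Sum>i\<in>A. f i) \<in> S"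
  by (induction A rule: infinite_finite_induct) (auto intro: add zero)

text \<open>By \<open>gap_dvd\<close> this is the greatest common divisor of the degrees in
  \<open>S\<close>. It is also the degree of the variable over the field of fractions of
  \<open>S\<close>, and becomes the degree of the generator.\<close>

definition gap :: nat where
  "gap = (LEAST r. r > 0 \<and> (\<exists>a\<in>S. \<exists>b\<in>S. a \<noteq> 0 \<and> b \<noteq> 0 \<and> degree a = degree b + r))"

lemma gap: "gap > 0" "\<exists>a\<in>S. \<exists>b\<in>S. a \<noteq> 0 \<and> b \<noteq> 0 \<and> degree a = degree b + gap"
proof -
  obtain p where "p \<in> S" "degree p > 0" using nonconst by blast
  then have "degree p > 0 \<and> (\<exists>a\<in>S. \<exists>b\<in>S. a \<noteq> 0 \<and> b \<noteq> 0 \<and> degree a = degree b + degree p)"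
    using one by (intro conjI bexI[of _ p] bexI[of _ 1]) auto
  from LeastI[of "\<lambda>r. r > 0 \<and> (\<exists>a\<in>S. \<exists>b\<in>S. a \<noteq> 0 \<and> b \<noteq> 0 \<and> degree a = degree b + r)", OF this]
  show "gap > 0" "\<exists>a\<in>S. \<exists>b\<in>S. a \<noteq> 0 \<and> b \<noteq> 0 \<and> degree a = degree b + gap"
    by (simp_all add: gap_def)
qed

lemma gap_le:
  "a \<in> S \<Longrightarrow> b \<in> S \<Longrightarrow> a \<noteq> 0 \<Longrightarrow> b \<noteq> 0 \<Longrightarrow> degree a = degree b + r \<Longrightarrow> r > 0 \<Longrightarrow> gap \<le> r"
  unfolding gap_def by (intro Least_le) blast

text \<open>For \<open>q\<close> the quotient, the degrees of \<open>f * b ^ q\<close> and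
  \<open>a ^ q\<close> differ by the remainder of \<open>degree f\<close> modulo \<open>gap\<close>;
  a positive remainder would be a smaller difference.\<close>

lemma gap_dvd:
  assumes f: "f \<in> S"
  shows "gap dvd degree f"
proof (cases "f = 0")
  case False
  obtain a b where ab: "a \<in> S" "b \<in> S" "a \<noteq> 0" "b \<noteq> 0" "degree a = degree b + gap" using gap by blast
  let ?q = "degree f div gap" and ?r = "degree f mod gap"
  have "degree (f * b ^ ?q) = degree (a ^ ?q) + ?r"
  proof -
    have "degree (f * b ^ ?q) = (?q * gap + ?r) + ?q * degree b"
      using False ab by (simp add: degree_mult_eq degree_power_eq)
    also have "\<dots> = degree (a ^ ?q) + ?r"
      using ab by (simp add: degree_power_eq algebra_simps)
    finally show ?thesis .
  qed
  then have "\<not> ?r > 0"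
    using gap_le[of "f * b ^ ?q" "a ^ ?q" ?r] mod_less_divisor[OF gap(1), of "degree f"] ab f False
    by (auto simp: mult power)
  then show ?thesis by (simp add: dvd_eq_mod_eq_0)
qed simp

text \<open>In units of \<open>gap\<close>, the elements \<open>b\<close> and \<open>a\<close> have
  consecutive degrees \<open>c\<close> and \<open>c + 1\<close>. The semigroup they generate
  contains all \<open>k \<ge> c * c\<close>: write \<open>k = q * c + i\<close> with
  \<open>i \<le> q\<close>.\<close>

lemma large_degrees: "\<exists>n0. \<forall>k\<ge>n0. \<exists>f\<in>S. f \<noteq> 0 \<and> degree f = k * gap"
proof -
  obtain a b where ab: "a \<in> S" "b \<in> S" "a \<noteq> 0" "b \<noteq> 0" "degree a = degree b + gap" using gap by blast
  obtain c where c: "degree b = c * gap" using gap_dvd[OF ab(2)] by (metis dvd_def mult.commute)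
  have "\<exists>f\<in>S. f \<noteq> 0 \<and> degree f = k * gap" if k: "k \<ge> c * c" for k
  proof (cases "c = 0")
    case True
    then have "degree (a ^ k) = k * gap" using ab c by (simp add: degree_power_eq)
    then show ?thesis using ab by (intro bexI[of _ "a ^ k"]) (auto intro: power)
  next
    case False
    let ?q = "k div c" and ?i = "k mod c"
    have i: "?i \<le> ?q"
    proof -
      have "c \<le> ?q" using k False by (metis div_le_mono nonzero_mult_div_cancel_right)
      then show ?thesis using mod_less_divisor[of c k] False by linarith
    qed
    have "degree (a ^ ?i * b ^ (?q - ?i)) = ?i * (c * gap + gap) + (?q - ?i) * (c * gap)"
      using ab c by (simp add: degree_mult_eq degree_power_eq)
    also have "\<dots> = (?i + (?q - ?i)) * (c * gap) + ?i * gap" by (simp only: ring_distribs add_ac)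
    also have "\<dots> = (?q * c + ?i) * gap"
      unfolding le_add_diff_inverse[OF i] by (simp only: ring_distribs mult.assoc)
    also have "\<dots> = k * gap" by (simp only: div_mult_mod_eq)
    finally show ?thesis using ab
      by (intro bexI[of _ "a ^ ?i * b ^ (?q - ?i)"]) (auto intro: power mult)
  qed
  then show ?thesis by blast
qed

text \<open>The powers \<open>X\<^sup>i\<close> with \<open>i < gap\<close> form a basis over \<open>S\<close> of a subspace of finite codimension: the
  residues modulo \<open>gap\<close> of the degrees keep them apart.\<close>

lemma degree_residue_sum:
  assumes s: "\<And>i. i < gap \<Longrightarrow> s i \<in> S" and ne: "\<exists>i<gap. s i \<noteq> 0"
  shows "(\<Sum>i<gap. monom 1 i * s i) \<noteq> 0 \<and>
    (\<forall>i<gap. s i \<noteq> 0 \<longrightarrow> i + degree (s i) \<le> degree (\<Sum>i<gap. monom 1 i * s i))"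
proof -
  have deg: "degree (monom 1 i * s i) = i + degree (s i)" if "s i \<noteq> 0" for i
    using that by (simp add: degree_mult_eq degree_monom_eq)
  have "(\<Sum>i<gap. monom 1 i * s i) \<noteq> 0 \<and>
    (\<forall>i\<in>{..<gap}. degree (monom 1 i * s i) \<le> degree (\<Sum>i<gap. monom 1 i * s i))"
  proof (rule degree_sum_distinct)
    fix i j assume ij: "i \<in> {..<gap}" "j \<in> {..<gap}" "monom 1 i * s i \<noteq> 0" "monom 1 j * s j \<noteq> 0"
      "degree (monom 1 i * s i) = degree (monom 1 j * s j)"
    then have "i + degree (s i) = j + degree (s j)" using deg by auto
    moreover have "gap dvd degree (s i)" "gap dvd degree (s j)" using s gap_dvd ij by auto
    ultimately have "i mod gap = j mod gap" by (metis dvd_def mod_mult_self2)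
    then show "i = j" using ij by simp
  qed (use ne in auto)
  then show ?thesis using deg by force
qed

lemma independent:
  assumes "\<And>i. i < gap \<Longrightarrow> s i \<in> S" "(\<Sum>i<gap. monom 1 i * s i) = 0" "i < gap"
  shows "s i = 0"
  using degree_residue_sum[of s] assms by blast

text \<open>As long as the degree of \<open>q\<close> is large, it is attained by some
  \<open>X ^ i * f\<close> with \<open>f\<close> in \<open>S\<close>, where \<open>i\<close> is its
  residue modulo \<open>gap\<close>, and the leading term cancels. The remainders live in a space of
  fixed finite dimension.\<close>

lemma reduce_degree:
  assumes n0: "\<And>k. k \<ge> n0 \<Longrightarrow> \<exists>f\<in>S. f \<noteq> 0 \<and> degree f = k * gap"
  shows "\<exists>s r. (\<forall>i<gap. s i \<in> S) \<and> q = (\<Sum>i<gap. monom 1 i * s i) + r \<and> (\<forall>k\<ge>n0 * gap + gap. coeff r k = 0)"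
proof (induction "degree q" arbitrary: q rule: less_induct)
  case less
  show ?case
  proof (cases "degree q < n0 * gap + gap")
    case True
    then show ?thesis
      by (intro exI[of _ "\<lambda>_. 0"] exI[of _ q]) (auto intro: zero coeff_eq_0)
  next
    case False
    let ?i = "degree q mod gap" and ?k = "degree q div gap"
    have "n0 \<le> ?k" using False gap(1) by (simp add: less_eq_div_iff_mult_less_eq)
    from n0[OF this] obtain f where f: "f \<in> S" "f \<noteq> 0" "degree f = ?k * gap" by blast
    have i: "?i < gap" using gap(1) by simp
    have dq: "degree q > 0" using False gap(1) by simp
    define g where "g = monom 1 ?i * smult (lead_coeff q / lead_coeff f) f"
    have q0: "q \<noteq> 0" using dq by auto
    have "degree g = ?i + degree f"
      using f(2) q0 unfolding g_def by (subst degree_mult_eq) (auto simp: degree_monom_eq)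
    then have g: "degree g = degree q" using f(3) by simp
    have "lead_coeff g = lead_coeff q"
      using f(2) unfolding g_def by (simp add: lead_coeff_mult degree_monom_eq)
    then have "degree (q - g) < degree q"
      using g dq by (intro degree_diff_cancel_lead)
    from less[OF this] obtain s r where sr: "\<forall>i<gap. s i \<in> S"
      "q - g = (\<Sum>i<gap. monom 1 i * s i) + r" "\<forall>k\<ge>n0 * gap + gap. coeff r k = 0" by blast
    let ?s = "s(?i := s ?i + smult (lead_coeff q / lead_coeff f) f)"
    have "(\<Sum>i<gap. monom 1 i * ?s i) = (\<Sum>i<gap. monom 1 i * s i + (if i = ?i then g else 0))"
      by (rule sum.cong) (auto simp: g_def algebra_simps)
    also have "\<dots> = (\<Sum>i<gap. monom 1 i * s i) + g" using i by (simp add: sum.distrib)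
    finally have sum: "(\<Sum>i<gap. monom 1 i * ?s i) = (\<Sum>i<gap. monom 1 i * s i) + g" .
    have "q = (q - g) + g" by simp
    then have "q = (\<Sum>i<gap. monom 1 i * ?s i) + r" unfolding sr(2) sum by (simp only: add_ac)
    then show ?thesis using sr f by (intro exI[of _ ?s] exI[of _ r]) (auto intro: add smult)
  qed
qed

text \<open>Reduce \<open>X ^ gap * p l\<close> for one more \<open>p l\<close> than the dimension
  of the space of remainders; some combination of the remainders vanishes. The same combination of
  the \<open>p l\<close> survives because their degrees are distinct.\<close>

lemma minimal_relation:
  "\<exists>p s. p \<in> S \<and> p \<noteq> 0 \<and> (\<forall>i<gap. s i \<in> S) \<and> monom 1 gap * p = (\<Sum>i<gap. monom 1 i * s i)"
proof -
  obtain n0 where n0: "\<And>k. k \<ge> n0 \<Longrightarrow> \<exists>f\<in>S. f \<noteq> 0 \<and> degree f = k * gap" using large_degrees by blast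
  define M where "M = n0 * gap + gap"
  have "\<forall>l. \<exists>p. p \<in> S \<and> p \<noteq> 0 \<and> degree p = (n0 + l) * gap" using n0 by (metis le_add1)
  then obtain p where p: "\<And>l. p l \<in> S" "\<And>l. p l \<noteq> 0" "\<And>l. degree (p l) = (n0 + l) * gap" by metis
  have "\<forall>l. \<exists>s r. (\<forall>i<gap. s i \<in> S) \<and> monom 1 gap * p l = (\<Sum>i<gap. monom 1 i * s i) + r \<and>
      (\<forall>k\<ge>M. coeff r k = 0)"
    unfolding M_def using reduce_degree[OF n0] by blast
  then obtain s r where s: "\<And>l i. i < gap \<Longrightarrow> s l i \<in> S" and
    sr: "\<And>l. monom 1 gap * p l = (\<Sum>i<gap. monom 1 i * s l i) + r l" and
    r: "\<And>l k. k \<ge> M \<Longrightarrow> coeff (r l) k = 0" by metis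
  obtain c where c: "\<exists>l\<in>{..M}. c l \<noteq> 0" "\<And>k. k < M \<Longrightarrow> (\<Sum>l\<le>M. c l * coeff (r l) k) = 0"
    using underdetermined_system[of "{..<M}" "{..M}" "\<lambda>l k. coeff (r l) k"] by auto
  have r0: "(\<Sum>l\<le>M. smult (c l) (r l)) = 0"
  proof (rule poly_eqI)
    fix k
    show "coeff (\<Sum>l\<le>M. smult (c l) (r l)) k = coeff 0 k"
      using c(2)[of k] r[of k] by (cases "k < M") (auto simp: coeff_sum)
  qed
  let ?p = "\<Sum>l\<le>M. smult (c l) (p l)" and ?s = "\<lambda>i. \<Sum>l\<le>M. smult (c l) (s l i)"
  have "?p \<noteq> 0"
  proof (rule degree_sum_distinct[THEN conjunct1])
    fix i j assume "smult (c i) (p i) \<noteq> 0" "smult (c j) (p j) \<noteq> 0"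
      "degree (smult (c i) (p i)) = degree (smult (c j) (p j))"
    then show "i = j" using p(3) gap(1) by auto
  qed (use c(1) p(2) in auto)
  moreover have "monom 1 gap * ?p = (\<Sum>i<gap. monom 1 i * ?s i)"
  proof -
    have "monom 1 gap * ?p = (\<Sum>l\<le>M. smult (c l) (monom 1 gap * p l))"
      by (simp add: sum_distrib_left)
    also have "\<dots> = (\<Sum>l\<le>M. smult (c l) (\<Sum>i<gap. monom 1 i * s l i)) + (\<Sum>l\<le>M. smult (c l) (r l))"
      unfolding sr smult_add_right sum.distrib ..
    also have "(\<Sum>l\<le>M. smult (c l) (\<Sum>i<gap. monom 1 i * s l i)) = (\<Sum>l\<le>M. \<Sum>i<gap. monom 1 i * smult (c l) (s l i))"
      by (simp add: smult_sum_right)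
    also have "\<dots> = (\<Sum>i<gap. monom 1 i * ?s i)"
      by (subst sum.swap) (simp add: sum_distrib_left)
    finally show ?thesis using r0 by simp
  qed
  moreover have "?p \<in> S" "\<forall>i<gap. ?s i \<in> S" using p s by (auto intro!: sum smult)
  ultimately show ?thesis by (intro exI[of _ ?p] exI[of _ ?s] conjI)
qed

end

section \<open>The generator, by Gauss's lemma\<close>

context poly_subalgebra
begin

text \<open>\<open>B\<close> and \<open>G\<close> are polynomials in a second variable
  \<open>Y\<close> with coefficients in \<open>S\<close>. Multiplying by the leading coefficient
  \<open>p\<close> instead of dividing by it keeps the remainder in \<open>S[Y]\<close>.\<close>

lemma pseudo_division:
  assumes B: "degree B = gap" "lead_coeff B = p" "p \<noteq> 0" "\<And>i. coeff B i \<in> S"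
    and G: "\<And>i. coeff G i \<in> S"
  shows "\<exists>k Q r. smult (p ^ k) G = B * Q + r \<and> degree r < gap \<and> (\<forall>i. coeff r i \<in> S)"
  using G
proof (induction "degree G" arbitrary: G rule: less_induct)
  case less
  show ?case
  proof (cases "degree G < gap")
    case True
    then show ?thesis using less.prems by (intro exI[of _ 0] exI[of _ 0] exI[of _ G]) auto
  next
    case False
    let ?n = "degree G - gap"
    let ?M = "monom (lead_coeff G) ?n"
    define G' where "G' = smult p G - ?M * B"
    have p: "p \<in> S" using B by metis
    have coeffs: "coeff G' i \<in> S" for i
      unfolding G'_def coeff_diff coeff_smult coeff_monom_mult
      using less.prems B(4) p zero by (auto intro: diff mult)
    have "coeff G' i = 0" if "i \<ge> degree G" for i
    proof (cases "i = degree G")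
      case True
      have "i - ?n = degree B" using True False B(1) by simp
      then show ?thesis
        using True B(2) unfolding G'_def coeff_diff coeff_smult coeff_monom_mult
        by (simp add: mult.commute)
    next
      case i: False
      then have "coeff G i = 0" "coeff B (i - ?n) = 0"
        using that B(1) False by (auto intro!: coeff_eq_0)
      then show ?thesis by (simp add: G'_def coeff_monom_mult)
    qed
    then have "degree G' < degree G" using False gap(1) by (intro degree_lessI) auto
    from less.hyps[OF this coeffs] obtain k Q r where
      *: "smult (p ^ k) G' = B * Q + r" "degree r < gap" "\<forall>i. coeff r i \<in> S" by blast
    have "smult (p ^ Suc k) G = smult (p ^ k) G' + smult (p ^ k) (?M * B)"
      by (simp add: G'_def smult_diff_right mult.commute)
    also have "\<dots> = B * (Q + smult (p ^ k) ?M) + r"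
      unfolding *(1) by (simp add: algebra_simps)
    finally show ?thesis using *(2,3) by blast
  qed
qed

text \<open>\<open>B\<close> is a minimal polynomial of \<open>X\<close> over the field of fractions
  of \<open>S\<close>, and \<open>f(Y) - f(X)\<close> has the root \<open>Y = X\<close> and a
  constant leading coefficient. By Gauss's lemma \<open>B\<close> is then \<open>p\<close> times a
  monic polynomial, so its relation can be divided by \<open>p\<close>.\<close>

lemma integral_relation:
  "\<exists>p c. p \<in> S \<and> p \<noteq> 0 \<and> (\<forall>i<gap. p * c i \<in> S) \<and> monom 1 gap = (\<Sum>i<gap. monom 1 i * c i)"
proof -
  obtain p s where ps: "p \<in> S" "p \<noteq> 0" "\<And>i. i < gap \<Longrightarrow> s i \<in> S"
    "monom 1 gap * p = (\<Sum>i<gap. monom 1 i * s i)" using minimal_relation by blast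
  define B where "B = monom p gap - (\<Sum>i<gap. monom (s i) i)"
  have coeff_B: "coeff B i = (if i = gap then p else if i < gap then - s i else 0)" for i
    by (auto simp: B_def coeff_sum)
  have deg_B: "degree B = gap"
    by (rule antisym, rule degree_le) (auto simp: coeff_B ps(2) intro: le_degree)
  have lead_B: "lead_coeff B = p" by (simp add: deg_B coeff_B)
  have B_in: "coeff B i \<in> S" for i
    using ps diff[OF zero] by (auto simp: coeff_B zero)
  have mX: "monom c i = smult c ([:0, 1:] ^ i)" for c :: complex and i by (rule monom_altdef)
  have pB: "poly B [:0, 1:] = 0"
  proof -
    have "poly B [:0, 1:] = p * [:0, 1:] ^ gap - (\<Sum>i<gap. s i * [:0, 1:] ^ i)"
      by (simp add: B_def poly_monom poly_sum)
    also have "\<dots> = 0" using ps(4) by (simp add: mX mult.commute)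
    finally show ?thesis .
  qed
  obtain f where f: "f \<in> S" "degree f > 0" using nonconst by blast
  \<comment> \<open>This is \<open>f(Y) - f(X)\<close>. Its coefficients lie in \<open>S\<close>:
    those of \<open>f\<close> are constants, and \<open>f(X)\<close> itself is an element of
    \<open>S\<close>.\<close>
  define G where "G = map_poly (\<lambda>c. [:c:]) f - [:f:]"
  have coeff_G: "coeff G i = [:coeff f i:] - (if i = 0 then f else 0)" for i
    by (cases i) (simp_all add: G_def coeff_map_poly)
  have G_in: "coeff G i \<in> S" for i
    unfolding coeff_G by (auto intro: diff const f zero)
  have deg_G: "degree G = degree f"
  proof (rule antisym)
    show "degree G \<le> degree f" using f(2) by (intro degree_le) (auto simp: coeff_G coeff_eq_0)
    show "degree f \<le> degree G" using f(2) by (intro le_degree) (auto simp: coeff_G)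
  qed
  have lead_G: "lead_coeff G = [:lead_coeff f:]" using f(2) by (simp add: deg_G coeff_G)
  have "poly (map_poly (\<lambda>c. [:c:]) q) [:0, 1:] = q" for q :: "complex poly"
    by (induction q) (simp_all add: map_poly_pCons)
  then have pG: "poly G [:0, 1:] = 0" by (simp add: G_def)
  obtain k Q r where div: "smult (p ^ k) G = B * Q + r" "degree r < gap" "\<And>i. coeff r i \<in> S"
    using pseudo_division[OF deg_B lead_B ps(2) B_in G_in] by blast
  \<comment> \<open>The remainder vanishes at \<open>Y = X\<close> and has degree below
    \<open>gap\<close>, so it is zero by the independence of the powers of \<open>X\<close> over
    \<open>S\<close>.\<close>
  have "r = 0"
  proof -
    have "poly r [:0, 1:] = 0"
      using arg_cong[OF div(1), of "\<lambda>P. poly P [:0, 1:]"] pG pB by simp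
    also have "poly r [:0, 1:] = (\<Sum>i<gap. coeff r i * [:0, 1:] ^ i)"
      unfolding poly_altdef using div(2) by (intro sum.mono_neutral_left) (auto intro: coeff_eq_0)
    finally have "(\<Sum>i<gap. monom 1 i * coeff r i) = 0" by (simp add: mX mult.commute)
    from independent[OF div(3) this] have "coeff r i = 0" for i
      using div(2) by (cases "i < gap") (auto intro: coeff_eq_0)
    then show "r = 0" by (intro poly_eqI) simp
  qed
  with div(1) have eq: "smult (p ^ k) G = B * Q" by simp
  have G0: "G \<noteq> 0" using f(2) deg_G by auto
  then have Q0: "Q \<noteq> 0" using eq ps(2) by auto
  have unit: "is_unit [:lead_coeff f:]" using f(2) by (auto simp: is_unit_const_poly_iff dvd_field_iff)
  have "content G dvd [:lead_coeff f:]" using content_dvd_coeff[of G "degree G"] lead_G by simp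
  then have "is_unit (content G)" using unit dvd_trans by blast
  then have "content G = 1" using is_unit_normalize[of "content G"] by simp
  then have cont: "normalize (p ^ k) = content B * content Q"
    using arg_cong[OF eq, of content] by (simp add: content_mult)
  have lead: "p ^ k * [:lead_coeff f:] = p * lead_coeff Q"
    using arg_cong[OF eq, of lead_coeff] unfolding lead_coeff_smult lead_coeff_mult lead_G lead_B .
  \<comment> \<open>Comparing leading coefficients gives the first link, comparing contents the
    second. Cancelling \<open>lead_coeff Q\<close> from the ends of the chain leaves
    \<open>p dvd content B\<close>.\<close>
  have "p * lead_coeff Q dvd p ^ k"
    unfolding lead[symmetric] using mult_unit_dvd_iff[OF unit, of "p ^ k"] by (metis dvd_refl)
  also have "p ^ k dvd content B * content Q" unfolding cont[symmetric] by simp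
  also have "\<dots> dvd content B * lead_coeff Q" by (intro mult_dvd_mono content_dvd_coeff) simp
  finally have "p dvd content B" using Q0 by (simp add: dvd_mult_cancel_right)
  then have "p dvd coeff B i" for i using content_dvd_coeff dvd_trans by blast
  then have "p dvd s i" if "i < gap" for i using that coeff_B[of i] by (metis dvd_minus_iff less_irrefl)
  then have "\<forall>i. \<exists>c. i < gap \<longrightarrow> s i = p * c" by (metis dvd_def)
  then obtain c where c: "\<And>i. i < gap \<Longrightarrow> s i = p * c i" by metis
  have "p * monom 1 gap = p * (\<Sum>i<gap. monom 1 i * c i)"
  proof -
    have "p * monom 1 gap = (\<Sum>i<gap. monom 1 i * s i)" using ps(4) by (simp add: mult.commute)
    also have "\<dots> = (\<Sum>i<gap. p * (monom 1 i * c i))"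
      using c by (intro sum.cong) (auto simp: mult_ac)
    finally show ?thesis by (simp add: sum_distrib_left)
  qed
  then have "monom 1 gap = (\<Sum>i<gap. monom 1 i * c i)" using ps(2) by simp
  moreover have "\<forall>i<gap. p * c i \<in> S" using ps(3) c by (metis)
  ultimately show ?thesis using ps(1,2) by blast
qed

text \<open>The nonzero \<open>c i\<close> of the monic relation have degrees divisible by
  \<open>gap\<close> with \<open>i + degree (c i) \<le> gap\<close>. So \<open>c i\<close> is
  constant for \<open>i > 0\<close>, and \<open>h = c 0\<close> has degree \<open>gap\<close>;
  powers of \<open>h\<close> can then cancel leading terms. The element \<open>p\<close> exhibits
  \<open>h\<close> as a quotient of elements of \<open>S\<close>, from which the rational inverse of
  a curve is obtained later.\<close>

theorem generator:
  "\<exists>h p. degree h > 0 \<and> p \<in> S \<and> p \<noteq> 0 \<and> p * h \<in> S \<and> (\<forall>f\<in>S. \<exists>F. f = pcompose F h)"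
proof -
  obtain p c where pc: "p \<in> S" "p \<noteq> 0" "\<And>i. i < gap \<Longrightarrow> p * c i \<in> S"
    "monom 1 gap = (\<Sum>i<gap. monom 1 i * c i)" using integral_relation by blast
  define h where "h = c 0"
  have ph: "p * h \<in> S" using pc(3)[of 0] gap(1) by (simp add: h_def)
  have eq: "monom 1 gap * p = (\<Sum>i<gap. monom 1 i * (p * c i))"
    unfolding pc(4) sum_distrib_right by (intro sum.cong) (auto simp: mult_ac)
  have deg_c: "i + degree (c i) \<le> gap" if "i < gap" "c i \<noteq> 0" for i
  proof -
    have "monom 1 gap * p \<noteq> 0" using pc(2) by simp
    then have "\<exists>i<gap. p * c i \<noteq> 0"
      unfolding eq using sum.neutral[of "{..<gap}" "\<lambda>i. monom 1 i * (p * c i)"] by auto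
    then have "i + degree (p * c i) \<le> degree (monom 1 gap * p)"
      unfolding eq using degree_residue_sum[of "\<lambda>i. p * c i"] pc(2,3) that by auto
    then show ?thesis using pc(2) that by (simp add: degree_mult_eq degree_monom_eq)
  qed
  have gap_c: "gap dvd degree (c i)" if "i < gap" for i
  proof (cases "c i = 0")
    case False
    then have "degree (p * c i) = degree p + degree (c i)" using pc(2) by (simp add: degree_mult_eq)
    then show ?thesis using gap_dvd[OF pc(3)[OF that]] gap_dvd[OF pc(1)] by (metis dvd_add_right_iff)
  qed simp
  have low: "coeff (monom 1 i * c i) gap = 0" if "i < gap" "i \<noteq> 0" for i
  proof (cases "c i = 0")
    case False
    then have "degree (c i) < gap" using deg_c[OF that(1)] that(2) by linarith
    then have "degree (c i) = 0" using gap_c[OF that(1)] by (auto dest: dvd_imp_le)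
    then show ?thesis using that by (simp add: coeff_monom_mult coeff_eq_0)
  qed simp
  have "coeff h gap = 1"
  proof -
    have "1 = coeff (\<Sum>i<gap. monom 1 i * c i) gap" using pc(4) by (metis coeff_monom)
    also have "\<dots> = (\<Sum>i<gap. if i = 0 then coeff h gap else 0)"
      unfolding coeff_sum using low by (intro sum.cong) (auto simp: h_def coeff_monom_mult)
    also have "\<dots> = coeff h gap" using gap(1) by simp
    finally show ?thesis by simp
  qed
  moreover have "degree h \<le> gap" using deg_c[of 0] gap(1) by (cases "h = 0") (auto simp: h_def)
  ultimately have deg_h: "degree h = gap" using le_degree[of h gap] by fastforce
  \<comment> \<open>Since \<open>h\<close> is only known as a quotient of elements of
    \<open>S\<close>, the induction runs over polynomials \<open>q\<close> with a denominator
    \<open>a\<close> in \<open>S\<close>; each step multiplies the denominator by a power of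
    \<open>p\<close>.\<close>
  have comp: "\<exists>F. q = pcompose F h" if "a \<in> S" "a \<noteq> 0" "a * q \<in> S" for a q
    using that
  proof (induction "degree q" arbitrary: a q rule: less_induct)
    case less
    have "gap dvd degree q"
    proof (cases "q = 0")
      case False
      then have "degree (a * q) = degree a + degree q" using less.prems by (simp add: degree_mult_eq)
      then show ?thesis using gap_dvd[OF less.prems(3)] gap_dvd[OF less.prems(1)]
        by (metis dvd_add_right_iff)
    qed simp
    then obtain k where k: "degree q = k * gap" by (metis dvd_def mult.commute)
    show ?case
    proof (cases "degree q = 0")
      case True
      then show ?thesis by (metis degree_eq_zeroE pcompose_const)
    next
      case False
      have h0: "h \<noteq> 0" using deg_h gap(1) by auto
      define c where "c = lead_coeff q / lead_coeff (h ^ k)"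
      have "lead_coeff (h ^ k) \<noteq> 0" using h0 by simp
      moreover have "lead_coeff q \<noteq> 0" using False by auto
      ultimately have c: "c \<noteq> 0" "c * lead_coeff (h ^ k) = lead_coeff q" by (auto simp: c_def)
      define q1 where "q1 = q - smult c (h ^ k)"
      have "degree (smult c (h ^ k)) = degree q"
        using c(1) h0 by (simp add: degree_power_eq deg_h k)
      moreover have "lead_coeff (smult c (h ^ k)) = lead_coeff q"
        unfolding lead_coeff_smult by (rule c(2))
      ultimately have "degree q1 < degree q"
        unfolding q1_def using False by (intro degree_diff_cancel_lead) auto
      moreover have "a * p ^ k * q1 \<in> S"
      proof -
        have "a * p ^ k * q1 = (a * q) * p ^ k - smult c (a * (p * h) ^ k)"
          by (simp add: q1_def algebra_simps power_mult_distrib)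
        then show ?thesis using less.prems pc(1) ph by (auto intro: diff smult mult power)
      qed
      ultimately obtain F where F: "q1 = pcompose F h"
        using less.hyps[of q1 "a * p ^ k"] less.prems pc(1,2) by (auto intro: mult power)
      have "q = pcompose (F + monom c k) h"
      proof (intro poly_ext)
        fix t
        have "poly q t = poly q1 t + c * poly h t ^ k" by (simp add: q1_def)
        then show "poly q t = poly (pcompose (F + monom c k) h) t"
          by (simp add: F poly_pcompose poly_monom)
      qed
      then show ?thesis by blast
    qed
  qed
  have "\<exists>F. f = pcompose F h" if "f \<in> S" for f
    using comp[of 1 f] one that by simp
  then show ?thesis
    using deg_h gap(1) pc(1,2) ph by (intro exI[of _ h] exI[of _ p]) simp
qed

end

section \<open>The projective line\<close>

lemma mem_proj_pt: "x \<in> proj_pt x"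
  unfolding proj_pt_def by (rule CollectI, rule exI[of _ 1]) simp

lemma proj_pt_smult:
  assumes "c \<noteq> 0"
  shows "proj_pt (c \<cdot>\<^sub>v x) = proj_pt x"
proof (rule Set.set_eqI)
  fix y
  have "(\<exists>d. y = d \<cdot>\<^sub>v (c \<cdot>\<^sub>v x) \<and> d \<noteq> 0) \<longleftrightarrow> (\<exists>d. y = d \<cdot>\<^sub>v x \<and> d \<noteq> 0)"
  proof
    assume "\<exists>d. y = d \<cdot>\<^sub>v (c \<cdot>\<^sub>v x) \<and> d \<noteq> 0"
    then obtain d where "y = d \<cdot>\<^sub>v (c \<cdot>\<^sub>v x)" "d \<noteq> 0" by blast
    then show "\<exists>d. y = d \<cdot>\<^sub>v x \<and> d \<noteq> 0"
      using assms by (intro exI[of _ "d * c"]) (simp add: smult_smult_assoc)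
  next
    assume "\<exists>d. y = d \<cdot>\<^sub>v x \<and> d \<noteq> 0"
    then obtain d where "y = d \<cdot>\<^sub>v x" "d \<noteq> 0" by blast
    then show "\<exists>d. y = d \<cdot>\<^sub>v (c \<cdot>\<^sub>v x) \<and> d \<noteq> 0"
      using assms by (intro exI[of _ "d / c"]) (simp add: smult_smult_assoc)
  qed
  then show "y \<in> proj_pt (c \<cdot>\<^sub>v x) \<longleftrightarrow> y \<in> proj_pt x" by (simp add: proj_pt_def)
qed

lemma mem_proj_ptE:
  assumes "x \<in> proj_pt y"
  obtains c where "c \<noteq> 0" "x = c \<cdot>\<^sub>v y" "proj_pt x = proj_pt y"
  using assms proj_pt_smult by (auto simp: proj_pt_def)

lemma proj_spaceI: "x \<in> carrier_vec (Suc n) \<Longrightarrow> x \<noteq> 0\<^sub>v (Suc n) \<Longrightarrow> proj_pt x \<in> proj_space n"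
  unfolding proj_space_def by blast

lemma mem_proj_spaceD:
  assumes "p \<in> proj_space n" "x \<in> p"
  shows "p = proj_pt x" "x \<in> carrier_vec (Suc n)" "x \<noteq> 0\<^sub>v (Suc n)"
proof -
  obtain y where y: "y \<in> carrier_vec (Suc n)" "y \<noteq> 0\<^sub>v (Suc n)" "p = proj_pt y"
    using assms(1) by (auto simp: proj_space_def)
  obtain c where c: "c \<noteq> 0" "x = c \<cdot>\<^sub>v y" "proj_pt x = proj_pt y"
    using assms(2) y(3) by (auto elim: mem_proj_ptE)
  show "p = proj_pt x" "x \<in> carrier_vec (Suc n)" using c y by auto
  show "x \<noteq> 0\<^sub>v (Suc n)"
  proof
    assume "x = 0\<^sub>v (Suc n)"
    then have "(1 / c) \<cdot>\<^sub>v (c \<cdot>\<^sub>v y) = (1 / c) \<cdot>\<^sub>v 0\<^sub>v (Suc n)" using c by simp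
    also have "\<dots> = 0\<^sub>v (Suc n)" by (intro eq_vecI) auto
    finally show False using c y by (simp add: smult_smult_assoc)
  qed
qed

lemma proj_space_nonempty: "p \<in> proj_space n \<Longrightarrow> \<exists>x. x \<in> p"
  by (auto simp: proj_space_def intro: mem_proj_pt)

lemma hom_poly_smult:
  assumes "hom_poly n d f" "x \<in> carrier_vec (Suc n)"
  shows "f (c \<cdot>\<^sub>v x) = c ^ d * f x"
  using assms by (induction rule: hom_poly.induct) (auto simp: power_add algebra_simps)

lemma hom_poly_scale: "hom_poly n d f \<Longrightarrow> hom_poly n d (\<lambda>x. c * f x)"
  using hom_poly.mult[OF hom_poly.const] by (metis add_0)

lemma hom_poly_power: "hom_poly n d f \<Longrightarrow> hom_poly n (k * d) (\<lambda>x. f x ^ k)"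
  by (induction k) (auto intro: hom_poly.const hom_poly.mult)

lemma hom_poly_0: "hom_poly n d (\<lambda>x. 0)"
proof -
  have "hom_poly n (d * 1) (\<lambda>x. 0 * x $ 0 ^ d)"
    by (intro hom_poly_scale hom_poly_power hom_poly.var) simp
  then show ?thesis by simp
qed

lemma hom_poly_sum:
  "(\<And>i. i \<in> A \<Longrightarrow> hom_poly n d (f i)) \<Longrightarrow> hom_poly n d (\<lambda>x. \<Sum>i\<in>A. f i x)"
  by (induction A rule: infinite_finite_induct) (auto intro: hom_poly_0 hom_poly.add)

lemma hom_poly_line:
  assumes "hom_poly n d f" "u \<in> carrier_vec (Suc n)" "v \<in> carrier_vec (Suc n)"
  shows "\<exists>q. \<forall>s. f (u + s \<cdot>\<^sub>v v) = poly q s"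
  using assms
proof (induction rule: hom_poly.induct)
  case (const c)
  show ?case by (intro exI[of _ "[:c:]"]) simp
next
  case (var i)
  then show ?case by (intro exI[of _ "[:u $ i, v $ i:]"]) auto
next
  case (add d f g)
  then show ?case by (metis poly_add)
next
  case (mult d f e g)
  then show ?case by (metis poly_mult)
qed

section \<open>The Zariski topology of the line\<close>

lemma openin_zariski_basic: "hom_poly n d f \<Longrightarrow> openin (zariski n) {p \<in> proj_space n. \<forall>x\<in>p. f x \<noteq> 0}"
  unfolding zariski_def by (rule topology_generated_by_Basis) blast

lemma topspace_zariski: "topspace (zariski n) = proj_space n"
proof -
  have "proj_space n = {p \<in> proj_space n. \<forall>x\<in>p. (1::complex) \<noteq> 0}" by simp
  then show ?thesis
    unfolding zariski_def topology_generated_by_topspace using hom_poly.const[of n 1] by blast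
qed

text \<open>The determinant of two vectors of the plane. With one nonzero argument fixed it is a
  linear form vanishing at exactly one point of the line; two such forms serve as homogeneous
  coordinates.\<close>

definition bracket :: "complex vec \<Rightarrow> complex vec \<Rightarrow> complex" where
  "bracket x y = x $ 0 * y $ 1 - x $ 1 * y $ 0"

lemma hom_poly_bracket: "hom_poly 1 1 (bracket u)" "hom_poly 1 1 (\<lambda>x. bracket x v)"
proof -
  have "hom_poly 1 1 (\<lambda>x. u $ 0 * x $ 1 + (- u $ 1) * x $ 0)"
    by (intro hom_poly.add hom_poly_scale hom_poly.var) auto
  then show "hom_poly 1 1 (bracket u)" by (simp add: bracket_def[abs_def])
  have "hom_poly 1 1 (\<lambda>x. v $ 1 * x $ 0 + (- v $ 0) * x $ 1)"
    by (intro hom_poly.add hom_poly_scale hom_poly.var) auto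
  then show "hom_poly 1 1 (\<lambda>x. bracket x v)" by (simp add: bracket_def[abs_def] mult.commute)
qed

lemma bracket_simps:
  assumes "x \<in> carrier_vec 2" "y \<in> carrier_vec 2" "z \<in> carrier_vec 2"
  shows "bracket (x + y) z = bracket x z + bracket y z" "bracket x (y + z) = bracket x y + bracket x z"
    "bracket (c \<cdot>\<^sub>v x) y = c * bracket x y" "bracket x (c \<cdot>\<^sub>v y) = c * bracket x y" "bracket x x = 0"
    "bracket (0\<^sub>v 2) x = 0"
  using assms by (auto simp: bracket_def algebra_simps)

lemma bracket_eq_0_iff:
  assumes "x \<in> carrier_vec 2" "y \<in> carrier_vec 2" "x \<noteq> 0\<^sub>v 2" "y \<noteq> 0\<^sub>v 2"
  shows "bracket x y = 0 \<longleftrightarrow> proj_pt x = proj_pt y"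
proof
  assume 0: "bracket x y = 0"
  have "\<exists>i<2. x $ i \<noteq> 0"
  proof (rule ccontr)
    assume "\<not> ?thesis"
    then have "x = 0\<^sub>v 2" using assms(1) by (intro eq_vecI) auto
    then show False using assms by simp
  qed
  then obtain i where i: "i < 2" "x $ i \<noteq> 0" by blast
  define c where "c = y $ i / x $ i"
  have y: "y = c \<cdot>\<^sub>v x"
  proof (rule eq_vecI)
    fix j assume "j < dim_vec (c \<cdot>\<^sub>v x)"
    then have "j < 2" using assms(1) by simp
    then have "j = 0 \<or> j = 1" "i = 0 \<or> i = 1" using i by auto
    then show "y $ j = (c \<cdot>\<^sub>v x) $ j"
      using i 0 assms(1) \<open>j < 2\<close> by (auto simp: c_def bracket_def field_simps)
  qed (use assms in auto)
  then have "c \<noteq> 0" using assms by auto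
  then show "proj_pt x = proj_pt y" using y proj_pt_smult by simp
next
  assume "proj_pt x = proj_pt y"
  then have "x \<in> proj_pt y" using mem_proj_pt by blast
  then obtain c where "x = c \<cdot>\<^sub>v y" by (auto elim: mem_proj_ptE)
  then show "bracket x y = 0" using assms by (auto simp: bracket_def)
qed

lemma cofinite_openin_line:
  assumes "finite F"
  shows "openin (zariski 1) (proj_space 1 - F)"
  using assms
proof (induction F rule: finite_induct)
  case empty
  then show ?case by (metis Diff_empty openin_topspace topspace_zariski)
next
  case (insert b F)
  show ?case
  proof (cases "b \<in> proj_space 1")
    case True
    then obtain y where y: "y \<in> b" using proj_space_nonempty by blast
    note y' = mem_proj_spaceD[OF True y]
    have "proj_space 1 - insert b F =
        (proj_space 1 - F) \<inter> {p \<in> proj_space 1. \<forall>x\<in>p. bracket y x \<noteq> 0}"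
    proof -
      have "(\<forall>x\<in>p. bracket y x \<noteq> 0) \<longleftrightarrow> p \<noteq> b" if p: "p \<in> proj_space 1" for p
      proof -
        have "bracket y x = 0 \<longleftrightarrow> b = p" if "x \<in> p" for x
          using bracket_eq_0_iff[of y x] y' mem_proj_spaceD[OF p that] by (simp add: numeral_2_eq_2)
        then show ?thesis using proj_space_nonempty[OF p] by blast
      qed
      then show ?thesis by blast
    qed
    then show ?thesis
      using openin_Int[OF insert.IH openin_zariski_basic[OF hom_poly_bracket(1)]] by simp
  next
    case False
    then have "proj_space 1 - insert b F = proj_space 1 - F" by auto
    then show ?thesis using insert.IH by simp
  qed
qed

text \<open>The counterpart of \<open>near\<close> in an affine coordinate centred at the point:
  Zariski neighbourhoods on the line are cofinite.\<close>

definition near0 :: "(complex \<Rightarrow> bool) \<Rightarrow> bool" where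
  "near0 P \<longleftrightarrow> P 0 \<and> finite {s. \<not> P s}"

lemma near0_conj:
  assumes "near0 P" "near0 Q"
  shows "near0 (\<lambda>s. P s \<and> Q s)"
proof -
  have "{s. \<not> (P s \<and> Q s)} = {s. \<not> P s} \<union> {s. \<not> Q s}" by auto
  then show ?thesis using assms unfolding near0_def by simp
qed

lemma near0_mono: "near0 P \<Longrightarrow> (\<And>s. P s \<Longrightarrow> Q s) \<Longrightarrow> near0 Q"
  unfolding near0_def by (auto elim: rev_finite_subset)

lemma near0_poly: "poly q 0 \<noteq> 0 \<Longrightarrow> near0 (\<lambda>s. poly q s \<noteq> 0)"
  unfolding near0_def using poly_roots_finite[of q] by (cases "q = 0") auto

lemma near0_poly_eq:
  assumes "near0 (\<lambda>s. poly p s = poly q s)"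
  shows "p = q"
proof (rule ccontr)
  assume "p \<noteq> q"
  then have "finite {s. poly (p - q) s = 0}" by (intro poly_roots_finite) simp
  moreover have "finite {s. poly p s \<noteq> poly q s}" using assms by (simp add: near0_def)
  moreover have "UNIV = {s. poly (p - q) s = 0} \<union> {s. poly p s \<noteq> poly q s}" by auto
  ultimately have "finite (UNIV :: complex set)" by (metis finite_UnI)
  then show False using infinite_UNIV_char_0 by blast
qed

text \<open>The affine chart sending \<open>s\<close> to the point of \<open>u + s v\<close>; it
  omits only the point of \<open>v\<close>. All local computations take place at
  \<open>s = 0\<close>, so other points are treated by moving \<open>u\<close>.\<close>

locale chart =
  fixes u v :: "complex vec"
  assumes u: "u \<in> carrier_vec 2" and v: "v \<in> carrier_vec 2" and indep: "bracket u v \<noteq> 0"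
begin

definition pnt :: "complex \<Rightarrow> point" where
  "pnt s = proj_pt (u + s \<cdot>\<^sub>v v)"

lemma brackets: "bracket u (u + s \<cdot>\<^sub>v v) = s * bracket u v" "bracket (u + s \<cdot>\<^sub>v v) v = bracket u v"
  "bracket v v = 0" "bracket v u = - bracket u v"
  using u v by (auto simp: bracket_def algebra_simps)

lemma vec_nonzero: "u + s \<cdot>\<^sub>v v \<noteq> 0\<^sub>v 2" "v \<noteq> 0\<^sub>v 2" "u \<noteq> 0\<^sub>v 2"
proof -
  show "u + s \<cdot>\<^sub>v v \<noteq> 0\<^sub>v 2" using brackets(2)[of s] indep bracket_simps(6)[OF v v v] by auto
  show "v \<noteq> 0\<^sub>v 2" using indep u by (auto simp: bracket_def)
  show "u \<noteq> 0\<^sub>v 2" using indep v by (auto simp: bracket_def)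
qed

lemma pnt_in: "pnt s \<in> proj_space 1" "proj_pt v \<in> proj_space 1"
  unfolding pnt_def using u v vec_nonzero by (auto intro!: proj_spaceI simp: numeral_2_eq_2)

lemma mem_pnt:
  assumes "x \<in> pnt s"
  shows "bracket u x = s * bracket x v" "bracket x v \<noteq> 0" "x \<in> carrier_vec 2"
    "\<exists>c. c \<noteq> 0 \<and> x = c \<cdot>\<^sub>v (u + s \<cdot>\<^sub>v v)"
proof -
  obtain c where c: "c \<noteq> 0" "x = c \<cdot>\<^sub>v (u + s \<cdot>\<^sub>v v)"
    using assms unfolding pnt_def by (auto elim: mem_proj_ptE)
  have us: "u + s \<cdot>\<^sub>v v \<in> carrier_vec 2" using u v by simp
  show "x \<in> carrier_vec 2" using c us by simp
  show "bracket u x = s * bracket x v" "bracket x v \<noteq> 0"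
    unfolding c(2) using bracket_simps(3,4)[OF us v v] bracket_simps(4)[OF u us us] brackets indep c(1)
    by auto
  show "\<exists>c. c \<noteq> 0 \<and> x = c \<cdot>\<^sub>v (u + s \<cdot>\<^sub>v v)" using c by blast
qed

text \<open>Numerator and denominator are linear, so the choice of homogeneous coordinates is
  immaterial. At the omitted point the denominator vanishes and the value is 0 by
  convention.\<close>

definition coord :: "point \<Rightarrow> complex" where
  "coord p = (let x = SOME x. x \<in> p in bracket u x / bracket x v)"

lemma coord_pnt [simp]: "coord (pnt s) = s"
proof -
  have "(SOME x. x \<in> pnt s) \<in> pnt s" using mem_proj_pt unfolding pnt_def by (rule someI)
  from mem_pnt(1,2)[OF this] show ?thesis by (simp add: coord_def Let_def)
qed

lemma pnt_inj [simp]: "pnt s = pnt s' \<longleftrightarrow> s = s'"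
  using coord_pnt by metis

lemma pnt_neq: "pnt s \<noteq> proj_pt v"
proof
  assume "pnt s = proj_pt v"
  then have "v \<in> pnt s" using mem_proj_pt by simp
  from mem_pnt(2)[OF this] show False using brackets by simp
qed

lemma cover:
  assumes "p \<in> proj_space 1"
  shows "p = proj_pt v \<or> (\<exists>s. p = pnt s)"
proof -
  obtain x where x: "x \<in> p" using proj_space_nonempty[OF assms] by blast
  note x' = mem_proj_spaceD[OF assms x]
  have xc: "x \<in> carrier_vec 2" "x \<noteq> 0\<^sub>v 2" using x' by (simp_all add: numeral_2_eq_2)
  show ?thesis
  proof (cases "bracket x v = 0")
    case True
    then show ?thesis using bracket_eq_0_iff[OF xc(1) v xc(2) vec_nonzero(2)] x' by simp
  next
    case False
    let ?s = "bracket u x / bracket x v"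
    have us: "u + ?s \<cdot>\<^sub>v v \<in> carrier_vec 2" using u v by simp
    have "bracket x (u + ?s \<cdot>\<^sub>v v) = bracket x u + ?s * bracket x v"
      using xc u v by (simp add: bracket_simps(2,4))
    also have "\<dots> = 0" using False by (simp add: bracket_def)
    finally have "p = pnt ?s"
      using bracket_eq_0_iff[OF xc(1) us xc(2) vec_nonzero(1)] x' by (simp add: pnt_def)
    then show ?thesis by blast
  qed
qed

lemma proj_space_1_eq: "proj_space 1 = insert (proj_pt v) (range pnt)"
  using cover pnt_in by auto

lemma finite_points_iff: "finite {p \<in> proj_space 1. \<not> P p} \<longleftrightarrow> finite {s. \<not> P (pnt s)}"
proof
  assume "finite {p \<in> proj_space 1. \<not> P p}"
  then have "finite (pnt ` {s. \<not> P (pnt s)})" using pnt_in by (auto elim: rev_finite_subset)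
  then show "finite {s. \<not> P (pnt s)}" by (rule finite_imageD) (auto simp: inj_on_def)
next
  assume "finite {s. \<not> P (pnt s)}"
  then have "finite (insert (proj_pt v) (pnt ` {s. \<not> P (pnt s)}))" by simp
  then show "finite {p \<in> proj_space 1. \<not> P p}"
  proof (rule rev_finite_subset, intro subsetI)
    fix p assume "p \<in> {p \<in> proj_space 1. \<not> P p}"
    then show "p \<in> insert (proj_pt v) (pnt ` {s. \<not> P (pnt s)})" using cover[of p] by auto
  qed
qed

lemma openin_line_cofinite:
  assumes "openin (zariski 1) U"
  shows "U = {} \<or> finite (proj_space 1 - U)"
  using openin_topology_generated_by[OF assms[unfolded zariski_def]]
proof (induction rule: generate_topology_on.induct)
  case (Int a b)
  then show ?case by (auto simp: Diff_Int)
next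
  case (UN K)
  show ?case
  proof (cases "\<forall>k\<in>K. k = {}")
    case False
    then obtain k where "k \<in> K" "finite (proj_space 1 - k)" using UN.IH by blast
    then have "finite (proj_space 1 - \<Union>K)" by (auto elim: rev_finite_subset)
    then show ?thesis by simp
  qed auto
next
  case (Basis B)
  then obtain d f where f: "hom_poly 1 d f" "B = {p \<in> proj_space 1. \<forall>x\<in>p. f x \<noteq> 0}" by blast
  have uv: "u \<in> carrier_vec (Suc 1)" "v \<in> carrier_vec (Suc 1)" using u v by (simp_all add: numeral_2_eq_2)
  obtain q where q: "\<And>s. f (u + s \<cdot>\<^sub>v v) = poly q s" using hom_poly_line[OF f(1) uv] by blast
  have pnt: "f x \<noteq> 0 \<longleftrightarrow> poly q s \<noteq> 0" if x: "x \<in> pnt s" for x s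
  proof -
    obtain c where "c \<noteq> 0" "x = c \<cdot>\<^sub>v (u + s \<cdot>\<^sub>v v)" using mem_pnt(4)[OF x] by blast
    then show ?thesis using hom_poly_smult[OF f(1), of "u + s \<cdot>\<^sub>v v" c] uv q by simp
  qed
  show ?case
  proof (cases "q = 0")
    case False
    have "finite {s. \<not> pnt s \<in> B}"
    proof (rule finite_subset)
      show "{s. \<not> pnt s \<in> B} \<subseteq> {s. poly q s = 0}" using pnt pnt_in f(2) by auto
      show "finite {s. poly q s = 0}" using False by (rule poly_roots_finite)
    qed
    then have "finite {p \<in> proj_space 1. \<not> p \<in> B}" by (simp only: finite_points_iff)
    then show ?thesis by (simp add: set_diff_eq)
  next
    \<comment> \<open>A form vanishing on the whole chart vanishes at the omitted point too: along
      the line from \<open>v\<close> in direction \<open>u\<close> it is a polynomial with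
      infinitely many zeros. The basic open set is then empty.\<close>
    case True
    obtain r where r: "\<And>s. f (v + s \<cdot>\<^sub>v u) = poly r s" using hom_poly_line[OF f(1) uv(2,1)] by blast
    have "poly r s = 0" if "s \<noteq> 0" for s
    proof -
      have "v + s \<cdot>\<^sub>v u = s \<cdot>\<^sub>v (u + (1 / s) \<cdot>\<^sub>v v)"
        using that u v by (intro eq_vecI) (auto simp: algebra_simps)
      then show ?thesis using hom_poly_smult[OF f(1), of "u + (1 / s) \<cdot>\<^sub>v v" s] uv q r[of s] True by simp
    qed
    then have sub: "UNIV - {0} \<subseteq> {s. poly r s = 0}" by auto
    have "infinite (UNIV - {0} :: complex set)" by (intro infinite_remove infinite_UNIV_char_0)
    then have "infinite {s. poly r s = 0}" using sub finite_subset by metis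
    then have "r = 0" using poly_roots_finite[of r] by metis
    moreover have "v + 0 \<cdot>\<^sub>v u = v" using u v by (intro eq_vecI) auto
    ultimately have "f v = 0" using r[of 0] by simp
    have "p \<notin> B" for p
    proof
      assume p: "p \<in> B"
      then consider "p = proj_pt v" | s where "p = pnt s" using f(2) cover by blast
      then show False
      proof cases
        case 1
        then show False using p f(2) \<open>f v = 0\<close> mem_proj_pt by auto
      next
        case 2
        then obtain x where "x \<in> pnt s" using mem_proj_pt by (auto simp: pnt_def)
        then show False using 2 p f(2) pnt True by auto
      qed
    qed
    then show ?thesis by blast
  qed
qed auto

lemma near_iff_cofinite:
  assumes "a \<in> proj_space 1"
  shows "near 1 (proj_space 1) a P \<longleftrightarrow> P a \<and> finite {p \<in> proj_space 1. \<not> P p}"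
proof
  assume "near 1 (proj_space 1) a P"
  then obtain U where U: "openin (zariski 1) U" "a \<in> U" "\<forall>p\<in>U \<inter> proj_space 1. P p"
    by (auto simp: near_def)
  then have "finite (proj_space 1 - U)" using openin_line_cofinite[OF U(1)] by blast
  then have "finite {p \<in> proj_space 1. \<not> P p}" by (rule rev_finite_subset) (use U in auto)
  then show "P a \<and> finite {p \<in> proj_space 1. \<not> P p}" using U assms by blast
next
  assume *: "P a \<and> finite {p \<in> proj_space 1. \<not> P p}"
  then have "openin (zariski 1) (proj_space 1 - {p \<in> proj_space 1. \<not> P p})"
    by (intro cofinite_openin_line) simp
  then show "near 1 (proj_space 1) a P"
    unfolding near_def using * assms by (intro exI[of _ "proj_space 1 - {p \<in> proj_space 1. \<not> P p}"]) auto
qed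

lemma near_iff: "near 1 (proj_space 1) (pnt 0) P \<longleftrightarrow> near0 (\<lambda>s. P (pnt s))"
  unfolding near_iff_cofinite[OF pnt_in(1)] near0_def finite_points_iff ..

end

text \<open>Keep the simplifier from rewriting the dimension \<open>1\<close> of the line to \<open>Suc 0\<close>.\<close>

declare One_nat_def [simp del]

section \<open>Germs, orders and pullback multiplicities at the centre of a chart\<close>

context chart
begin

text \<open>Presents an element of the local ring as a fraction in the affine coordinate. The
  fraction need not be reduced, so germs are compared by cross multiplication.\<close>

definition has_germ :: "(point \<Rightarrow> complex) \<Rightarrow> complex poly \<Rightarrow> complex poly \<Rightarrow> bool" where
  "has_germ f p q \<longleftrightarrow> near0 (\<lambda>s. poly q s \<noteq> 0 \<and> f (pnt s) = poly p s / poly q s)"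

lemma has_germ_denom: "has_germ f p q \<Longrightarrow> poly q 0 \<noteq> 0"
  and has_germ_value: "has_germ f p q \<Longrightarrow> f (pnt 0) = poly p 0 / poly q 0"
  by (auto simp: has_germ_def near0_def)

lemma has_germI:
  assumes "poly q 0 \<noteq> 0" "near0 (\<lambda>s. poly q s \<noteq> 0 \<longrightarrow> f (pnt s) = poly p s / poly q s)"
  shows "has_germ f p q"
  unfolding has_germ_def using near0_conj[OF near0_poly[OF assms(1)] assms(2)] by (rule near0_mono) auto

lemma has_germ_poly: "near0 (\<lambda>s. f (pnt s) = poly p s) \<Longrightarrow> has_germ f p 1"
  by (rule has_germI) (auto elim: near0_mono)

lemma has_germ_unique:
  assumes "has_germ f p q" "has_germ f p' q'"
  shows "p * q' = p' * q"
proof (rule near0_poly_eq)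
  show "near0 (\<lambda>s. poly (p * q') s = poly (p' * q) s)"
    using near0_conj[OF assms[unfolded has_germ_def]]
    by (rule near0_mono) (auto simp: field_simps)
qed

lemma has_germ_mult:
  assumes "has_germ f p q" "has_germ g p' q'" "near0 (\<lambda>s. h (pnt s) = f (pnt s) * g (pnt s))"
  shows "has_germ h (p * p') (q * q')"
  unfolding has_germ_def
  using near0_conj[OF near0_conj[OF assms(1,2)[unfolded has_germ_def]] assms(3)]
  by (rule near0_mono) auto

lemma has_germ_power:
  assumes "has_germ f p q"
  shows "has_germ (\<lambda>x. f x ^ k) (p ^ k) (q ^ k)"
  unfolding has_germ_def using assms[unfolded has_germ_def]
  by (rule near0_mono) (auto simp: power_divide)

lemma regular_at_iff: "regular_at 1 (proj_space 1) (pnt 0) f \<longleftrightarrow> (\<exists>p q. has_germ f p q)"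
proof
  assume "regular_at 1 (proj_space 1) (pnt 0) f"
  then obtain d P Q where *: "hom_poly 1 d P" "hom_poly 1 d Q"
    "near0 (\<lambda>s. \<forall>x\<in>pnt s. Q x \<noteq> 0 \<and> f (pnt s) = P x / Q x)"
    by (auto simp: regular_at_def near_iff)
  have uv: "u \<in> carrier_vec (Suc 1)" "v \<in> carrier_vec (Suc 1)" using u v by (simp_all add: numeral_2_eq_2)
  obtain p q where pq: "\<And>s. P (u + s \<cdot>\<^sub>v v) = poly p s" "\<And>s. Q (u + s \<cdot>\<^sub>v v) = poly q s"
    using hom_poly_line[OF *(1) uv] hom_poly_line[OF *(2) uv] by metis
  have "has_germ f p q"
    unfolding has_germ_def using *(3) by (rule near0_mono) (metis pq mem_proj_pt pnt_def)
  then show "\<exists>p q. has_germ f p q" by blast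
next
  assume "\<exists>p q. has_germ f p q"
  then obtain p q where pq: "has_germ f p q" by blast
  \<comment> \<open>Regular functions are quotients of forms of equal degree, so \<open>p\<close>
    and \<open>q\<close> are homogenised in one common degree, with \<open>bracket u x\<close> and
    \<open>bracket x v\<close> as coordinates.\<close>
  define d where "d = max (degree p) (degree q)"
  define H where "H = (\<lambda>r x. \<Sum>k\<le>d. coeff r k * (bracket u x ^ k * bracket x v ^ (d - k)))"
  have hom: "hom_poly 1 d (H r)" for r
    unfolding H_def
  proof (intro hom_poly_sum hom_poly_scale)
    fix k assume "k \<in> {..d}"
    then have "k * 1 + (d - k) * 1 = d" by simp
    then show "hom_poly 1 d (\<lambda>x. bracket u x ^ k * bracket x v ^ (d - k))"
      using hom_poly.mult[OF hom_poly_power[OF hom_poly_bracket(1)[of u], of k]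
          hom_poly_power[OF hom_poly_bracket(2)[of v], of "d - k"]] by simp
  qed
  have val: "H r x = bracket x v ^ d * poly r s" if "x \<in> pnt s" "degree r \<le> d" for r x s
  proof -
    have "H r x = (\<Sum>k\<le>d. bracket x v ^ d * (coeff r k * s ^ k))"
      unfolding H_def mem_pnt(1)[OF that(1)]
    proof (rule sum.cong)
      fix k assume "k \<in> {..d}"
      then have "bracket x v ^ d = bracket x v ^ k * bracket x v ^ (d - k)"
        by (simp add: power_add[symmetric])
      then show "coeff r k * ((s * bracket x v) ^ k * bracket x v ^ (d - k)) =
          bracket x v ^ d * (coeff r k * s ^ k)" by (simp add: power_mult_distrib)
    qed simp
    also have "\<dots> = bracket x v ^ d * poly r s"
      using that(2) unfolding sum_distrib_left[symmetric] poly_altdef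
      by (intro arg_cong[where f = "(*) _"] sum.mono_neutral_right) (auto simp: coeff_eq_0)
    finally show ?thesis .
  qed
  have "near0 (\<lambda>s. \<forall>x\<in>pnt s. H q x \<noteq> 0 \<and> f (pnt s) = H p x / H q x)"
    using pq[unfolded has_germ_def]
    by (rule near0_mono) (use mem_pnt(2) in \<open>auto simp: val d_def\<close>)
  then show "regular_at 1 (proj_space 1) (pnt 0) f"
    unfolding regular_at_def near_iff using hom by blast
qed

lemma germ_divisible:
  assumes "has_germ f p q" "f (pnt 0) = 0"
  shows "\<exists>p'. p = monom 1 1 * p'"
proof -
  have "poly p 0 = 0" using assms has_germ_value has_germ_denom by fastforce
  then show ?thesis by (auto simp: poly_eq_0_iff_dvd monom_altdef elim!: dvdE)
qed

lemma coord_germ: "has_germ coord (monom 1 1) 1"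
  by (rule has_germ_poly) (auto simp: near0_def poly_monom)

lemma rational_germ:
  assumes "poly q 0 \<noteq> 0"
  shows "has_germ (\<lambda>x. poly p (coord x) / poly q (coord x)) p q"
  by (rule has_germI[OF assms]) (simp add: near0_def)

lemma uniformizer_coord: "uniformizer 1 (proj_space 1) (pnt 0) coord"
  unfolding uniformizer_def
proof (intro conjI allI impI)
  show "regular_at 1 (proj_space 1) (pnt 0) coord" using regular_at_iff coord_germ by blast
  show "coord (pnt 0) = 0" by simp
  fix f assume "regular_at 1 (proj_space 1) (pnt 0) f \<and> f (pnt 0) = 0"
  then obtain p q where pq: "has_germ f p q" "f (pnt 0) = 0" by (auto simp: regular_at_iff)
  then obtain p' where p': "p = monom 1 1 * p'" using germ_divisible by blast
  let ?u = "\<lambda>x. poly p' (coord x) / poly q (coord x)"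
  have "regular_at 1 (proj_space 1) (pnt 0) ?u"
    using rational_germ[OF has_germ_denom[OF pq(1)]] regular_at_iff by blast
  moreover have "near 1 (proj_space 1) (pnt 0) (\<lambda>x. f x = coord x * ?u x)"
    unfolding near_iff using pq(1)[unfolded has_germ_def]
    by (rule near0_mono) (auto simp: p' poly_monom)
  ultimately show "\<exists>w. regular_at 1 (proj_space 1) (pnt 0) w \<and>
      near 1 (proj_space 1) (pnt 0) (\<lambda>x. f x = coord x * w x)" by blast
qed

text \<open>Any uniformizer vanishes at the centre, so the coordinate divides its germ; conversely
  \<open>coord\<close> is itself a uniformizer.\<close>

lemma in_max_pow_iff:
  "in_max_pow 1 (proj_space 1) (pnt 0) k f \<longleftrightarrow> (\<exists>p q. has_germ f (monom 1 k * p) q)"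
proof
  assume "in_max_pow 1 (proj_space 1) (pnt 0) k f"
  then obtain t w where tw: "uniformizer 1 (proj_space 1) (pnt 0) t" "regular_at 1 (proj_space 1) (pnt 0) w"
    "near0 (\<lambda>s. f (pnt s) = t (pnt s) ^ k * w (pnt s))"
    by (auto simp: in_max_pow_def near_iff)
  then obtain p q where pq: "has_germ w p q" by (auto simp: regular_at_iff)
  obtain r r' where r: "has_germ t r r'" "t (pnt 0) = 0"
    using tw(1) by (auto simp: uniformizer_def regular_at_iff)
  then obtain r1 where r1: "r = monom 1 1 * r1" using germ_divisible by blast
  have "has_germ f (r ^ k * p) (r' ^ k * q)"
    by (rule has_germ_mult[OF has_germ_power[OF r(1)] pq tw(3)])
  also have "r ^ k * p = monom 1 k * (r1 ^ k * p)"
    by (simp add: r1 power_mult_distrib monom_power mult_ac)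
  finally show "\<exists>p q. has_germ f (monom 1 k * p) q" by blast
next
  assume "\<exists>p q. has_germ f (monom 1 k * p) q"
  then obtain p q where pq: "has_germ f (monom 1 k * p) q" by blast
  let ?u = "\<lambda>x. poly p (coord x) / poly q (coord x)"
  have "regular_at 1 (proj_space 1) (pnt 0) ?u"
    using rational_germ[OF has_germ_denom[OF pq]] regular_at_iff by blast
  moreover have "near 1 (proj_space 1) (pnt 0) (\<lambda>x. f x = coord x ^ k * ?u x)"
    unfolding near_iff using pq[unfolded has_germ_def]
    by (rule near0_mono) (auto simp: poly_monom)
  ultimately show "in_max_pow 1 (proj_space 1) (pnt 0) k f"
    unfolding in_max_pow_def using uniformizer_coord by blast
qed

lemma has_orderI:
  assumes "has_germ f (monom 1 k * p) q" "poly p 0 \<noteq> 0"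
  shows "has_order 1 (proj_space 1) (pnt 0) f k"
  unfolding has_order_def in_max_pow_iff
proof
  show "\<exists>p q. has_germ f (monom 1 k * p) q" using assms by blast
  show "\<nexists>p q. has_germ f (monom 1 (Suc k) * p) q"
  proof
    assume "\<exists>p q. has_germ f (monom 1 (Suc k) * p) q"
    then obtain p' q' where *: "has_germ f (monom 1 (Suc k) * p') q'" by blast
    have mon: "monom 1 (Suc k) = monom 1 k * (monom 1 1 :: complex poly)" by (simp add: mult_monom Suc_eq_plus1)
    have "monom 1 k * (p * q') = monom 1 k * (monom 1 1 * p' * q)"
      using has_germ_unique[OF assms(1) *] unfolding mon by (simp only: mult_ac)
    then have "p * q' = monom 1 1 * p' * q" by (simp del: mult_monom)
    from arg_cong[OF this, of "\<lambda>r. poly r 0"] show False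
      using assms(2) has_germ_denom[OF *] by (simp add: poly_monom)
  qed
qed

lemma has_orderE:
  assumes "has_order 1 (proj_space 1) (pnt 0) f k"
  obtains p q where "has_germ f (monom 1 k * p) q" "poly p 0 \<noteq> 0"
proof -
  obtain p q where pq: "has_germ f (monom 1 k * p) q"
    using assms by (auto simp: has_order_def in_max_pow_iff)
  have "poly p 0 \<noteq> 0"
  proof
    assume "poly p 0 = 0"
    then obtain p' where p': "p = monom 1 1 * p'"
      by (auto simp: poly_eq_0_iff_dvd monom_altdef elim!: dvdE)
    have "has_germ f (monom 1 (Suc k) * p') q"
    proof -
      have "monom 1 (Suc k) * p' = monom 1 k * p"
        unfolding p' by (simp add: mult.assoc[symmetric] mult_monom Suc_eq_plus1)
      then show ?thesis using pq by simp
    qed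
    then show False using assms by (auto simp: has_order_def in_max_pow_iff)
  qed
  then show ?thesis using pq that by blast
qed

text \<open>Two local lifts of the same map differ by a unit.\<close>

lemma pullback_mult_eqI:
  assumes \<phi>: "local_lift 1 (proj_space 1) n g (pnt 0) \<phi>" and h: "h \<in> carrier_vec (Suc n)"
    and germ: "has_germ (\<lambda>x. h \<bullet> \<phi> x) (monom 1 k * p) q" "poly p 0 \<noteq> 0"
  shows "pullback_mult 1 (proj_space 1) n g h (pnt 0) = k"
  unfolding pullback_mult_def
proof (rule the_equality)
  show "\<exists>\<phi>. local_lift 1 (proj_space 1) n g (pnt 0) \<phi> \<and> has_order 1 (proj_space 1) (pnt 0) (\<lambda>x. h \<bullet> \<phi> x) k"
    using \<phi> has_orderI[OF germ] by blast
next
  fix k' assume "\<exists>\<phi>. local_lift 1 (proj_space 1) n g (pnt 0) \<phi> \<and> has_order 1 (proj_space 1) (pnt 0) (\<lambda>x. h \<bullet> \<phi> x) k'"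
  then obtain \<psi> where \<psi>: "local_lift 1 (proj_space 1) n g (pnt 0) \<psi>"
    and ord: "has_order 1 (proj_space 1) (pnt 0) (\<lambda>x. h \<bullet> \<psi> x) k'" by blast
  obtain p' q' where pq': "has_germ (\<lambda>x. h \<bullet> \<psi> x) (monom 1 k' * p') q'" "poly p' 0 \<noteq> 0"
    using ord by (rule has_orderE)
  let ?V = "carrier_vec (Suc n) - {0\<^sub>v (Suc n)} :: complex vec set"
  have lift: "near0 (\<lambda>s. \<phi> (pnt s) \<in> ?V \<and> g (pnt s) = proj_pt (\<phi> (pnt s)))"
    "near0 (\<lambda>s. \<psi> (pnt s) \<in> ?V \<and> g (pnt s) = proj_pt (\<psi> (pnt s)))"
    using \<phi> \<psi> unfolding local_lift_def near_iff by blast+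
  have near: "near0 (\<lambda>s. \<phi> (pnt s) \<in> ?V \<and> (\<exists>c. c \<noteq> 0 \<and> \<psi> (pnt s) = c \<cdot>\<^sub>v \<phi> (pnt s)))"
    using near0_conj[OF lift]
  proof (rule near0_mono)
    fix s assume *: "(\<phi> (pnt s) \<in> ?V \<and> g (pnt s) = proj_pt (\<phi> (pnt s))) \<and>
      (\<psi> (pnt s) \<in> ?V \<and> g (pnt s) = proj_pt (\<psi> (pnt s)))"
    then have "\<psi> (pnt s) \<in> proj_pt (\<phi> (pnt s))" using mem_proj_pt by metis
    then show "\<phi> (pnt s) \<in> ?V \<and> (\<exists>c. c \<noteq> 0 \<and> \<psi> (pnt s) = c \<cdot>\<^sub>v \<phi> (pnt s))"
      using * by (auto elim: mem_proj_ptE)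
  qed
  have \<phi>0: "\<phi> (pnt 0) \<in> ?V" "\<exists>c. c \<noteq> 0 \<and> \<psi> (pnt 0) = c \<cdot>\<^sub>v \<phi> (pnt 0)"
    using near unfolding near0_def by blast+
  have "\<exists>i\<le>n. \<phi> (pnt 0) $ i \<noteq> 0"
  proof (rule ccontr)
    assume "\<not> ?thesis"
    then have "\<phi> (pnt 0) = 0\<^sub>v (Suc n)" using \<phi>0(1) by (intro eq_vecI) auto
    then show False using \<phi>0(1) by simp
  qed
  then obtain i where i: "i \<le> n" "\<phi> (pnt 0) $ i \<noteq> 0" by blast
  have "\<psi> (pnt 0) $ i \<noteq> 0" using \<phi>0 i by auto
  obtain a b where ab: "has_germ (\<lambda>x. \<phi> x $ i) a b" using \<phi> i(1) by (auto simp: local_lift_def regular_at_iff)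
  obtain a' b' where ab': "has_germ (\<lambda>x. \<psi> x $ i) a' b'" using \<psi> i(1) by (auto simp: local_lift_def regular_at_iff)
  have nz: "poly a 0 \<noteq> 0" "poly a' 0 \<noteq> 0"
    using has_germ_value[OF ab] has_germ_value[OF ab'] i(2) \<open>\<psi> (pnt 0) $ i \<noteq> 0\<close> by auto
  \<comment> \<open>Multiplying crosswise by the coordinate \<open>i\<close>, nonzero for both lifts
    at the centre, avoids naming the unit: one function gets order \<open>k'\<close> from one side
    and \<open>k\<close> from the other.\<close>
  have cross: "near0 (\<lambda>s. (h \<bullet> \<psi> (pnt s)) * \<phi> (pnt s) $ i = (h \<bullet> \<phi> (pnt s)) * \<psi> (pnt s) $ i)"
    using near by (rule near0_mono) (use h i in auto)
  have 1: "has_germ (\<lambda>x. (h \<bullet> \<psi> x) * \<phi> x $ i) (monom 1 k' * (p' * a)) (q' * b)"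
    using has_germ_mult[OF pq'(1) ab, of "\<lambda>x. (h \<bullet> \<psi> x) * \<phi> x $ i"] by (simp add: near0_def mult.assoc)
  have 2: "has_germ (\<lambda>x. (h \<bullet> \<psi> x) * \<phi> x $ i) (monom 1 k * (p * a')) (q * b')"
    using has_germ_mult[OF germ(1) ab' cross] by (simp add: mult.assoc)
  have "poly (p' * a) 0 \<noteq> 0" "poly (p * a') 0 \<noteq> 0" using pq'(2) germ(2) nz by simp_all
  from has_orderI[OF 1 this(1)] has_orderI[OF 2 this(2)]
  have ord: "has_order 1 (proj_space 1) (pnt 0) (\<lambda>x. (h \<bullet> \<psi> x) * \<phi> x $ i) k'"
    "has_order 1 (proj_space 1) (pnt 0) (\<lambda>x. (h \<bullet> \<psi> x) * \<phi> x $ i) k" .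
  have mono: "in_max_pow 1 (proj_space 1) (pnt 0) l f" if "in_max_pow 1 (proj_space 1) (pnt 0) l' f" "l \<le> l'" for l l' f
  proof -
    have "monom 1 l' = monom 1 l * (monom 1 (l' - l) :: complex poly)" using that(2) by (simp add: mult_monom)
    then show ?thesis using that(1) unfolding in_max_pow_iff by (metis mult.assoc)
  qed
  show "k' = k"
    using ord mono[of "k'" _ "Suc k"] mono[of k _ "Suc k'"] unfolding has_order_def
    by (metis mono not_less_eq_eq le_antisym)
qed

end

section \<open>The standard charts and the canonical divisor\<close>

lemma near0I: "(\<And>s. P s) \<Longrightarrow> near0 P"
  by (simp add: near0_def)

definition vec2 :: "complex \<Rightarrow> complex \<Rightarrow> complex vec" where
  "vec2 a b = vec 2 (\<lambda>i. if i = 0 then a else b)"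

lemma vec2_simps [simp]: "vec2 a b \<in> carrier_vec 2" "vec2 a b $ 0 = a" "vec2 a b $ 1 = b"
  by (simp_all add: vec2_def)

lemma vec2_lincomb: "vec2 a b + vec2 c d = vec2 (a + c) (b + d)"
  "s \<cdot>\<^sub>v vec2 c d = vec2 (s * c) (s * d)"
  by (rule eq_vecI; auto simp: vec2_def)+

definition pt_fin :: "complex \<Rightarrow> point" where
  "pt_fin a = proj_pt (vec2 1 a)"

definition pt_inf :: point where
  "pt_inf = proj_pt (vec2 0 1)"

lemma chart_fin: "chart (vec2 1 a) (vec2 0 1)"
  by standard (simp_all add: bracket_def)

lemma chart_inf: "chart (vec2 0 1) (vec2 1 0)"
  by standard (simp_all add: bracket_def)

lemma pnt_fin: "chart.pnt (vec2 1 a) (vec2 0 1) s = pt_fin (a + s)"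
  by (simp add: chart.pnt_def[OF chart_fin] vec2_lincomb pt_fin_def)

lemma pnt_inf: "chart.pnt (vec2 0 1) (vec2 1 0) s = (if s = 0 then pt_inf else pt_fin (1 / s))"
proof (cases "s = 0")
  case False
  have "vec2 s 1 = s \<cdot>\<^sub>v vec2 1 (1 / s)" using False by (simp add: vec2_lincomb)
  then have "proj_pt (vec2 s 1) = proj_pt (vec2 1 (1 / s))" using proj_pt_smult[OF False] by simp
  then show ?thesis using False by (simp add: chart.pnt_def[OF chart_inf] vec2_lincomb pt_fin_def)
qed (simp add: chart.pnt_def[OF chart_inf] vec2_lincomb pt_inf_def)

definition affine :: "point \<Rightarrow> complex" where
  "affine = chart.coord (vec2 1 0) (vec2 0 1)"

lemma affine_fin [simp]: "affine (pt_fin a) = a"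
  unfolding affine_def using chart.coord_pnt[OF chart_fin[of 0], of a] by (simp add: pnt_fin)

lemma fin_inj [simp]: "pt_fin a = pt_fin b \<longleftrightarrow> a = b"
  using affine_fin by metis

lemma fin_neq_inf [simp]: "pt_fin a \<noteq> pt_inf" "pt_inf \<noteq> pt_fin a"
  using chart.pnt_neq[OF chart_fin[of 0], of a] by (auto simp: pnt_fin pt_inf_def)

lemma line_eq: "proj_space 1 = insert pt_inf (range pt_fin)"
  using chart.proj_space_1_eq[OF chart_fin[of 0]] by (simp add: pnt_fin[abs_def] pt_inf_def)

lemma in_line [simp]: "pt_fin a \<in> proj_space 1" "pt_inf \<in> proj_space 1"
  by (auto simp: line_eq)

lemma infinite_line: "infinite (proj_space 1)"
proof -
  have "infinite (range pt_fin)" using infinite_UNIV_char_0 by (simp add: finite_image_iff inj_def)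
  then show ?thesis by (simp add: line_eq)
qed

lemma uniformizer_line: "a \<in> proj_space 1 \<Longrightarrow> \<exists>t. uniformizer 1 (proj_space 1) a t"
  using chart.uniformizer_coord[OF chart_inf] chart.uniformizer_coord[OF chart_fin]
  by (auto simp: line_eq pnt_inf pnt_fin)

lemma smooth_line: "smooth_proj_curve 1 (proj_space 1)"
  unfolding smooth_proj_curve_def
proof (intro conjI ballI)
  show "closedin (zariski 1) (proj_space 1)" by (metis closedin_topspace topspace_zariski)
  have "connected_space (zariski 1)"
    unfolding connected_space_def
  proof (rule notI, elim exE conjE)
    fix U V assume UV: "openin (zariski 1) U" "openin (zariski 1) V" "U \<inter> V = {}" "U \<noteq> {}" "V \<noteq> {}"
    then have "finite ((proj_space 1 - U) \<union> (proj_space 1 - V))"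
      using chart.openin_line_cofinite[OF chart_inf] by blast
    moreover have "(proj_space 1 - U) \<union> (proj_space 1 - V) = proj_space 1" using UV(3) by blast
    ultimately show False using infinite_line by simp
  qed
  then show "connectedin (zariski 1) (proj_space 1)" by (metis connectedin_topspace topspace_zariski)
qed (use infinite_line uniformizer_line in simp_all)

text \<open>The form is \<open>dt\<close> for the affine coordinate \<open>t\<close>; at infinity, with \<open>s = 1 / t\<close>, it is \<open>- s\<^sup>-\<^sup>2 ds\<close>.\<close>

lemma form_order_fin: "form_order 1 (proj_space 1) (\<lambda>p q. affine q - affine p) (pt_fin a) 0"
proof -
  interpret chart "vec2 1 a" "vec2 0 1" by (rule chart_fin)
  have [simp]: "pnt 0 = pt_fin a" by (simp add: pnt_fin)
  have one: "has_order 1 (proj_space 1) (pt_fin a) (\<lambda>_. 1) 0"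
    using has_orderI[of "\<lambda>_. 1" 0 1 1] by (simp add: has_germ_poly near0_def)
  have aff: "affine (pnt s) = a + s" for s by (simp add: pnt_fin)
  have "near 1 (proj_space 1) (pt_fin a) (\<lambda>p. p \<noteq> pt_fin a \<longrightarrow>
      in_max_pow 1 (proj_space 1) p 2 (\<lambda>q. 1 * (affine q - affine p) - 1 * (coord q - coord p)))"
  proof -
    have "in_max_pow 1 (proj_space 1) (pnt s) 2 (\<lambda>q. 1 * (affine q - affine (pnt s)) - 1 * (coord q - coord (pnt s)))" for s
    proof -
      interpret B: chart "vec2 1 (a + s)" "vec2 0 1" by (rule chart_fin)
      have [simp]: "B.pnt r = pnt (s + r)" for r by (simp add: pnt_fin add.assoc)
      have "B.has_germ (\<lambda>q. 1 * (affine q - affine (pnt s)) - 1 * (coord q - coord (pnt s))) (monom 1 2 * 0) 1"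
        by (rule B.has_germ_poly) (simp add: near0_def aff)
      then have "in_max_pow 1 (proj_space 1) (B.pnt 0) 2
          (\<lambda>q. 1 * (affine q - affine (pnt s)) - 1 * (coord q - coord (pnt s)))"
        unfolding B.in_max_pow_iff by blast
      then show ?thesis by simp
    qed
    then have "near 1 (proj_space 1) (pnt 0) (\<lambda>p. p \<noteq> pt_fin a \<longrightarrow>
        in_max_pow 1 (proj_space 1) p 2 (\<lambda>q. 1 * (affine q - affine p) - 1 * (coord q - coord p)))"
      unfolding near_iff by (simp add: near0_def)
    then show ?thesis by simp
  qed
  moreover have "uniformizer 1 (proj_space 1) (pt_fin a) coord" using uniformizer_coord by simp
  ultimately show ?thesis unfolding form_order_def using one
    by (intro exI[of _ coord] exI[of _ "\<lambda>_. 1"] exI[of _ "0::nat"]) simp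
qed

lemma form_order_inf: "form_order 1 (proj_space 1) (\<lambda>p q. affine q - affine p) pt_inf (- 2)"
proof -
  interpret chart "vec2 0 1" "vec2 1 0" by (rule chart_inf)
  have [simp]: "pnt 0 = pt_inf" by (simp add: pnt_inf)
  have u: "has_order 1 (proj_space 1) pt_inf (\<lambda>_. - 1) 0"
    using has_orderI[of "\<lambda>_. - 1" 0 "- 1" 1] by (simp add: has_germ_poly near0_def)
  have v: "has_order 1 (proj_space 1) pt_inf (\<lambda>q. coord q ^ 2) 2"
    using has_orderI[of "\<lambda>q. coord q ^ 2" 2 1 1] by (simp add: has_germ_poly near0_def poly_monom)
  let ?D = "\<lambda>p q. coord p ^ 2 * (affine q - affine p) - (- 1) * (coord q - coord p)"
  have "in_max_pow 1 (proj_space 1) (pnt s) 2 (?D (pnt s))" if s: "s \<noteq> 0" for s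
  proof -
    define b where "b = 1 / s"
    have b: "b \<noteq> 0" "s = 1 / b" using s by (auto simp: b_def)
    interpret B: chart "vec2 1 b" "vec2 0 1" by (rule chart_fin)
    have B0: "B.pnt 0 = pnt s" using s by (simp add: pnt_fin pnt_inf b_def)
    have cf: "coord (pt_fin (b + r)) = 1 / (b + r)" if "b + r \<noteq> 0" for r
      using that coord_pnt[of "1 / (b + r)"] by (simp add: pnt_inf)
    \<comment> \<open>At affine coordinate \<open>b + r\<close> the difference is
      \<open>r ^ 2 / (b ^ 2 * (b + r))\<close>, the second-order Taylor remainder of
      \<open>1 / t\<close> at \<open>b\<close>.\<close>
    have "B.has_germ (?D (pnt s)) (monom 1 2 * 1) [:b ^ 3, b ^ 2:]"
    proof (rule B.has_germI)
      show "poly [:b ^ 3, b ^ 2:] 0 \<noteq> 0" using b by simp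
      have "?D (pnt s) (B.pnt r) = poly (monom 1 2 * 1) r / poly [:b ^ 3, b ^ 2:] r"
        if "poly [:b ^ 3, b ^ 2:] r \<noteq> 0" for r
      proof -
        have "poly [:b ^ 3, b ^ 2:] r = b ^ 2 * (b + r)" by (simp add: algebra_simps power2_eq_square power3_eq_cube)
        then have br: "b + r \<noteq> 0" using that by auto
        have "?D (pnt s) (B.pnt r) = (1 / b) ^ 2 * r + (1 / (b + r) - 1 / b)"
          using br b by (simp add: pnt_fin cf) (simp add: pnt_inf)
        also have "\<dots> = r ^ 2 / (b ^ 2 * (b + r))"
        proof -
          have "(1 / b) ^ 2 * (c - b) + (1 / c - 1 / b) = (c - b) ^ 2 / (b ^ 2 * c)" if "c \<noteq> 0" for c
            using that b(1) by (simp add: field_simps power2_eq_square)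
          from this[OF br] show ?thesis by simp
        qed
        finally show ?thesis using \<open>poly [:b ^ 3, b ^ 2:] r = b ^ 2 * (b + r)\<close> by (simp add: poly_monom)
      qed
      then show "near0 (\<lambda>r. poly [:b ^ 3, b ^ 2:] r \<noteq> 0 \<longrightarrow>
          ?D (pnt s) (B.pnt r) = poly (monom 1 2 * 1) r / poly [:b ^ 3, b ^ 2:] r)"
        by (intro near0I impI)
    qed
    then have "in_max_pow 1 (proj_space 1) (B.pnt 0) 2 (?D (pnt s))"
      unfolding B.in_max_pow_iff by blast
    then show ?thesis unfolding B0 .
  qed
  then have "near 1 (proj_space 1) (pnt 0) (\<lambda>p. p \<noteq> pt_inf \<longrightarrow> in_max_pow 1 (proj_space 1) p 2 (?D p))"
  proof -
    assume *: "\<And>s. s \<noteq> 0 \<Longrightarrow> in_max_pow 1 (proj_space 1) (pnt s) 2 (?D (pnt s))"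
    have "pnt s \<noteq> pt_inf \<longrightarrow> in_max_pow 1 (proj_space 1) (pnt s) 2 (?D (pnt s))" for s
      using *[of s] by (cases "s = 0") simp_all
    then show ?thesis unfolding near_iff by (simp add: near0_def)
  qed
  moreover have "uniformizer 1 (proj_space 1) pt_inf coord" using uniformizer_coord by simp
  ultimately show ?thesis unfolding form_order_def using u v
    by (intro exI[of _ coord] exI[of _ "\<lambda>_. - 1"] exI[of _ "\<lambda>q. coord q ^ 2"] exI[of _ "0::nat"] exI[of _ "2::nat"]) simp
qed

lemma canonical_line:
  "canonical_divisor 1 (proj_space 1) (\<lambda>a. if a = pt_inf then - 2 else 0)"
  "divisor_degree (proj_space 1) (\<lambda>a. if a = pt_inf then - 2 else 0) = - 2"
proof -
  show "canonical_divisor 1 (proj_space 1) (\<lambda>a. if a = pt_inf then - 2 else 0)"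
    unfolding canonical_divisor_def
    by (rule exI[of _ "\<lambda>p q. affine q - affine p"])
      (use form_order_fin form_order_inf in \<open>auto simp: line_eq\<close>)
  have "{a. a \<in> proj_space 1 \<and> (if a = pt_inf then - 2 else (0::int)) \<noteq> 0} = {pt_inf}" by auto
  then show "divisor_degree (proj_space 1) (\<lambda>a. if a = pt_inf then - 2 else 0) = - 2"
    unfolding divisor_degree_def by simp
qed

section \<open>Polynomial curves as orbifold rational curves\<close>

lemma scalar_vec: "h \<bullet> vec (Suc n) f = (\<Sum>i\<le>n. h $ i * f i)"
  unfolding scalar_prod_def by (simp add: atLeast0LessThan lessThan_Suc_atMost)

lemma hyperplane_proj_pt:
  assumes "x \<in> carrier_vec (Suc n)" "x \<noteq> 0\<^sub>v (Suc n)" "h \<in> carrier_vec (Suc n)"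
  shows "proj_pt x \<in> hyperplane n h \<longleftrightarrow> h \<bullet> x = 0"
proof
  assume "proj_pt x \<in> hyperplane n h"
  then show "h \<bullet> x = 0" using mem_proj_pt[of x] by (simp add: hyperplane_def)
next
  assume 0: "h \<bullet> x = 0"
  have "h \<bullet> y = 0" if y: "y \<in> proj_pt x" for y
  proof -
    obtain c where "y = c \<cdot>\<^sub>v x" using y by (auto elim: mem_proj_ptE)
    then show ?thesis using 0 assms by simp
  qed
  then show "proj_pt x \<in> hyperplane n h" using proj_spaceI[OF assms(1,2)] by (simp add: hyperplane_def)
qed

text \<open>The polynomial \<open>s ^ D * p (1 / s)\<close>, for \<open>degree p \<le> D\<close>. As
  \<open>D\<close> is common to all coordinates of a curve, the order at 0 is
  \<open>D - degree p\<close> for nonzero \<open>p\<close>, rather than 0 as for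
  \<open>reflect_poly\<close>.\<close>

definition reversal :: "nat \<Rightarrow> complex poly \<Rightarrow> complex poly" where
  "reversal D p = monom 1 (D - degree p) * reflect_poly p"

lemma poly_reversal:
  assumes "degree p \<le> D"
  shows "s \<noteq> 0 \<Longrightarrow> poly (reversal D p) s = s ^ D * poly p (1 / s)"
    and "poly (reversal D p) 0 = coeff p D"
proof -
  assume s: "s \<noteq> 0"
  have "s ^ D = s ^ (D - degree p) * s ^ degree p" using assms by (simp add: power_add[symmetric])
  then show "poly (reversal D p) s = s ^ D * poly p (1 / s)"
    using s by (simp add: reversal_def poly_monom poly_reflect_poly_nz inverse_eq_divide)
next
  show "poly (reversal D p) 0 = coeff p D"
    using assms by (cases "degree p = D") (auto simp: reversal_def poly_monom coeff_eq_0)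
qed

text \<open>\<open>top\<close> and \<open>no_common_root\<close> exclude base points at infinity and
  at finite points; the pullback of a hyperplane then has degree \<open>D\<close>.\<close>

locale poly_curve =
  fixes n D :: nat and G :: "nat \<Rightarrow> complex poly"
  assumes deg: "\<And>i. i \<le> n \<Longrightarrow> degree (G i) \<le> D" and top: "\<exists>i\<le>n. coeff (G i) D \<noteq> 0"
    and no_common_root: "\<And>a. \<exists>i\<le>n. poly (G i) a \<noteq> 0"
begin

definition vfin :: "complex \<Rightarrow> complex vec" where
  "vfin a = vec (Suc n) (\<lambda>i. poly (G i) a)"

definition vinf :: "complex vec" where
  "vinf = vec (Suc n) (\<lambda>i. coeff (G i) D)"

definition crv :: "point \<Rightarrow> point" where
  "crv p = (if p = pt_inf then proj_pt vinf else proj_pt (vfin (affine p)))"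

definition pull :: "complex vec \<Rightarrow> complex poly" where
  "pull h = (\<Sum>i\<le>n. smult (h $ i) (G i))"

lemma crv_simps [simp]: "crv pt_inf = proj_pt vinf" "crv (pt_fin a) = proj_pt (vfin a)"
  by (simp_all add: crv_def)

lemma vec_facts: "vfin a \<in> carrier_vec (Suc n)" "vfin a \<noteq> 0\<^sub>v (Suc n)"
  "vinf \<in> carrier_vec (Suc n)" "vinf \<noteq> 0\<^sub>v (Suc n)"
proof -
  obtain i where "i \<le> n" "poly (G i) a \<noteq> 0" using no_common_root by blast
  then have "vfin a $ i \<noteq> 0\<^sub>v (Suc n) $ i" by (simp add: vfin_def)
  then show "vfin a \<noteq> 0\<^sub>v (Suc n)" by auto
  obtain i where "i \<le> n" "coeff (G i) D \<noteq> 0" using top by blast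
  then have "vinf $ i \<noteq> 0\<^sub>v (Suc n) $ i" by (simp add: vinf_def)
  then show "vinf \<noteq> 0\<^sub>v (Suc n)" by auto
qed (simp_all add: vfin_def vinf_def)

lemma pull_fin: "h \<bullet> vfin a = poly (pull h) a"
  by (simp add: vfin_def scalar_vec pull_def poly_sum)

lemma pull_inf: "h \<bullet> vinf = coeff (pull h) D"
  by (simp add: vinf_def scalar_vec pull_def coeff_sum)

lemma degree_pull: "degree (pull h) \<le> D"
  unfolding pull_def
  using deg by (intro degree_sum_le) (auto intro!: order_trans[OF degree_smult_le])

lemma crv_hyperplane:
  assumes "h \<in> carrier_vec (Suc n)"
  shows "crv (pt_fin a) \<in> hyperplane n h \<longleftrightarrow> poly (pull h) a = 0"
    "crv pt_inf \<in> hyperplane n h \<longleftrightarrow> coeff (pull h) D = 0"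
  using hyperplane_proj_pt[OF _ _ assms] vec_facts by (simp_all add: pull_fin pull_inf)

lemma lift_fin: "local_lift 1 (proj_space 1) n crv (pt_fin a) (\<lambda>p. vfin (affine p))"
proof -
  interpret chart "vec2 1 a" "vec2 0 1" by (rule chart_fin)
  have p0: "pt_fin a = pnt 0" by (simp add: pnt_fin)
  have "regular_at 1 (proj_space 1) (pnt 0) (\<lambda>p. vfin (affine p) $ i)" if "i \<le> n" for i
  proof -
    have "has_germ (\<lambda>p. vfin (affine p) $ i) (pcompose (G i) [:a, 1:]) 1"
      using that by (intro has_germ_poly near0I) (simp add: pnt_fin vfin_def poly_pcompose)
    then show ?thesis using regular_at_iff by blast
  qed
  then show ?thesis
    unfolding local_lift_def p0 near_iff by (auto intro!: near0I simp: pnt_fin vec_facts)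
qed

definition lift_at_inf :: "point \<Rightarrow> complex vec" where
  "lift_at_inf p = vec (Suc n) (\<lambda>i. poly (reversal D (G i)) (chart.coord (vec2 0 1) (vec2 1 0) p))"

lemma lift_inf: "local_lift 1 (proj_space 1) n crv pt_inf lift_at_inf"
proof -
  interpret chart "vec2 0 1" "vec2 1 0" by (rule chart_inf)
  have p0: "pt_inf = pnt 0" by (simp add: pnt_inf)
  have "regular_at 1 (proj_space 1) (pnt 0) (\<lambda>p. lift_at_inf p $ i)" if "i \<le> n" for i
  proof -
    have "has_germ (\<lambda>p. lift_at_inf p $ i) (reversal D (G i)) 1"
      using that by (intro has_germ_poly near0I) (simp add: lift_at_inf_def)
    then show ?thesis using regular_at_iff by blast
  qed
  moreover have "lift_at_inf (pnt s) \<in> carrier_vec (Suc n) - {0\<^sub>v (Suc n)} \<and>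
      crv (pnt s) = proj_pt (lift_at_inf (pnt s))" for s
  proof (cases "s = 0")
    case True
    have "lift_at_inf (pnt s) = vinf"
      unfolding lift_at_inf_def vinf_def coord_pnt using True deg
      by (intro eq_vecI) (auto simp: poly_reversal(2))
    then show ?thesis using True vec_facts by (simp add: pnt_inf)
  next
    case False
    have "lift_at_inf (pnt s) = s ^ D \<cdot>\<^sub>v vfin (1 / s)"
      unfolding lift_at_inf_def vfin_def coord_pnt using False deg
      by (intro eq_vecI) (auto simp: poly_reversal(1))
    moreover have "s ^ D \<noteq> 0" using False by simp
    moreover have "proj_pt (s ^ D \<cdot>\<^sub>v vfin (1 / s)) = crv (pnt s)"
      using False by (simp add: pnt_inf proj_pt_smult)
    moreover have "s ^ D \<cdot>\<^sub>v vfin (1 / s) \<noteq> 0\<^sub>v (Suc n)"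
    proof -
      have "proj_pt (vfin (1 / s)) \<in> proj_space n" using vec_facts by (intro proj_spaceI)
      moreover have "s ^ D \<cdot>\<^sub>v vfin (1 / s) \<in> proj_pt (vfin (1 / s))"
        using mem_proj_pt proj_pt_smult[OF \<open>s ^ D \<noteq> 0\<close>] by metis
      ultimately show ?thesis by (rule mem_proj_spaceD(3))
    qed
    ultimately show ?thesis using vec_facts(1) by simp
  qed
  ultimately show ?thesis
    unfolding local_lift_def p0 near_iff by (auto intro!: near0I)
qed

lemma curve_map_crv: "curve_map 1 (proj_space 1) n crv"
  unfolding curve_map_def using lift_fin lift_inf by (auto simp: line_eq)

lemma pullback_mult_fin:
  assumes h: "h \<in> carrier_vec (Suc n)" and nz: "pull h \<noteq> 0"
  shows "pullback_mult 1 (proj_space 1) n crv h (pt_fin a) = order a (pull h)"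
proof -
  interpret chart "vec2 1 a" "vec2 0 1" by (rule chart_fin)
  have p0: "pnt 0 = pt_fin a" by (simp add: pnt_fin)
  let ?k = "order a (pull h)"
  obtain Q where Q: "pull h = [:- a, 1:] ^ ?k * Q" "\<not> [:- a, 1:] dvd Q"
    using order_decomp[OF nz] by blast
  have "has_germ (\<lambda>p. h \<bullet> vfin (affine p)) (monom 1 ?k * pcompose Q [:a, 1:]) 1"
  proof (intro has_germ_poly near0I)
    fix s
    have "poly (pull h) (a + s) = s ^ ?k * poly Q (a + s)"
      by (subst Q(1)) simp
    then show "h \<bullet> vfin (affine (pnt s)) = poly (monom 1 ?k * pcompose Q [:a, 1:]) s"
      by (simp add: pnt_fin pull_fin poly_monom poly_pcompose)
  qed
  moreover have "poly (pcompose Q [:a, 1:]) 0 \<noteq> 0" using Q(2) by (simp add: poly_pcompose poly_eq_0_iff_dvd)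
  moreover have "local_lift 1 (proj_space 1) n crv (pnt 0) (\<lambda>p. vfin (affine p))"
    using lift_fin p0 by simp
  ultimately show ?thesis using pullback_mult_eqI[OF _ h] p0 by simp
qed

lemma pullback_mult_inf:
  assumes h: "h \<in> carrier_vec (Suc n)" and nz: "pull h \<noteq> 0"
  shows "pullback_mult 1 (proj_space 1) n crv h pt_inf = D - degree (pull h)"
proof -
  interpret chart "vec2 0 1" "vec2 1 0" by (rule chart_inf)
  have p0: "pnt 0 = pt_inf" by (simp add: pnt_inf)
  have "has_germ (\<lambda>p. h \<bullet> lift_at_inf p) (monom 1 (D - degree (pull h)) * reflect_poly (pull h)) 1"
    unfolding reversal_def[symmetric]
  proof (intro has_germ_poly near0I)
    fix s
    have "h \<bullet> lift_at_inf (pnt s) = (\<Sum>i\<le>n. h $ i * poly (reversal D (G i)) s)"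
      by (simp add: lift_at_inf_def scalar_vec)
    also have "\<dots> = poly (reversal D (pull h)) s"
    proof (cases "s = 0")
      case True
      then have "(\<Sum>i\<le>n. h $ i * poly (reversal D (G i)) s) = (\<Sum>i\<le>n. h $ i * coeff (G i) D)"
        using deg by (intro sum.cong) (auto simp: poly_reversal(2))
      then show ?thesis using True by (simp add: poly_reversal(2) degree_pull) (simp add: pull_def coeff_sum)
    next
      case False
      then have "(\<Sum>i\<le>n. h $ i * poly (reversal D (G i)) s) = (\<Sum>i\<le>n. s ^ D * (h $ i * poly (G i) (1 / s)))"
        using deg by (intro sum.cong) (auto simp: poly_reversal(1))
      then show ?thesis
        using False by (simp add: poly_reversal(1) degree_pull sum_distrib_left[symmetric])
          (simp add: pull_def poly_sum)
    qed
    finally show "h \<bullet> lift_at_inf (pnt s) = poly (reversal D (pull h)) s" .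
  qed
  moreover have "poly (reflect_poly (pull h)) 0 \<noteq> 0" using nz by simp
  moreover have "local_lift 1 (proj_space 1) n crv (pnt 0) lift_at_inf" using lift_inf p0 by simp
  ultimately show ?thesis using pullback_mult_eqI[OF _ h] p0 by simp
qed

text \<open>Along the curve \<open>R0 : R1\<close> equals \<open>1 : a\<close> wherever
  \<open>A\<close> does not vanish, which inverts the parametrisation outside finitely many points.
  The factor \<open>A\<close> allows the parameter to be recovered as a quotient.\<close>

lemma birational_crv:
  assumes R: "hom_poly n d R0" "hom_poly n d R1" and A: "A \<noteq> 0"
    and eq: "\<And>a. R0 (vfin a) = poly A a" "\<And>a. R1 (vfin a) = poly A a * a"
  shows "birational_onto_image 1 (proj_space 1) n crv"
proof -
  let ?R = "\<lambda>i::nat. if i = 0 then R0 else R1"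
  have "proj_pt (vec (Suc 1) (\<lambda>i. ?R i x)) = pt_fin a" if a: "poly A a \<noteq> 0" and x: "x \<in> crv (pt_fin a)" for a x
  proof -
    obtain c where c: "c \<noteq> 0" "x = c \<cdot>\<^sub>v vfin a" using x by (auto elim: mem_proj_ptE)
    have "vec (Suc 1) (\<lambda>i. ?R i x) = (c ^ d * poly A a) \<cdot>\<^sub>v vec2 1 a"
      unfolding c(2) using hom_poly_smult[OF R(1) vec_facts(1)] hom_poly_smult[OF R(2) vec_facts(1)] eq
      by (intro eq_vecI) (auto simp: vec2_def)
    moreover have "c ^ d * poly A a \<noteq> 0" using c a by simp
    ultimately show ?thesis using proj_pt_smult by (simp add: pt_fin_def)
  qed
  then have "{a \<in> proj_space 1. \<not> (\<forall>x\<in>crv a. proj_pt (vec (Suc 1) (\<lambda>i. ?R i x)) = a)} \<subseteq>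
      insert pt_inf (pt_fin ` {a. poly A a = 0})" unfolding line_eq by blast
  moreover have "finite (insert pt_inf (pt_fin ` {a. poly A a = 0}))" using poly_roots_finite[OF A] by simp
  ultimately have "finite {a \<in> proj_space 1. \<not> (\<forall>x\<in>crv a. proj_pt (vec (Suc 1) (\<lambda>i. ?R i x)) = a)}"
    by (rule finite_subset)
  moreover have "\<forall>i\<le>1. hom_poly n d (?R i)" using R by simp
  ultimately show ?thesis unfolding birational_onto_image_def by (intro exI[of _ d] exI[of _ ?R]) simp
qed

end

lemma curve_mult_bounds:
  assumes B: "B \<ge> 1" and le: "\<And>j. j \<le> n + 1 \<Longrightarrow> g a \<in> hyperplane n (h j) \<Longrightarrow>
    real (m j) / real (pullback_mult N C n g (h j) a) \<le> B"
  shows "1 \<le> curve_mult n h m N C g a" "curve_mult n h m N C g a \<le> B"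
proof -
  let ?J = "{j. j \<le> n + 1 \<and> g a \<in> hyperplane n (h j)}"
  let ?f = "\<lambda>j. max 1 (real (m j) / real (pullback_mult N C n g (h j) a))"
  have "1 \<le> curve_mult n h m N C g a \<and> curve_mult n h m N C g a \<le> B"
  proof (cases "g a \<in> orb_support n h")
    case True
    then obtain j where j: "j \<in> ?J" by (auto simp: orb_support_def)
    have "finite ?J" by simp
    then have "1 \<le> Max (?f ` ?J)" using j by (intro order_trans[OF _ Max_ge[of _ "?f j"]]) auto
    moreover have "Max (?f ` ?J) \<le> B" using \<open>finite ?J\<close> j B le by (subst Max_le_iff) auto
    ultimately show ?thesis using True by (simp add: curve_mult_def)
  qed (use B in \<open>simp add: curve_mult_def\<close>)
  then show "1 \<le> curve_mult n h m N C g a" "curve_mult n h m N C g a \<le> B" by simp_all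
qed

context poly_curve
begin

text \<open>\<open>B\<close> and \<open>B'\<close> only have to bound the multiplicities from above,
  since \<open>1 - 1 / x\<close> is increasing. The bound 2 is minus the degree of the canonical
  divisor of the line.\<close>

theorem orb_rational_curveI:
  fixes h :: "nat \<Rightarrow> complex vec" and m :: "nat \<Rightarrow> nat" and B :: "complex \<Rightarrow> real"
  assumes h: "\<And>j. j \<le> n + 1 \<Longrightarrow> h j \<in> carrier_vec (Suc n)"
    and nz: "\<And>j. j \<le> n + 1 \<Longrightarrow> pull (h j) \<noteq> 0"
    and R: "hom_poly n d R0" "hom_poly n d R1" "A \<noteq> 0"
      "\<And>a. R0 (vfin a) = poly A a" "\<And>a. R1 (vfin a) = poly A a * a"
    and B: "\<And>a. B a \<ge> 1" "\<And>a j. j \<le> n + 1 \<Longrightarrow> poly (pull (h j)) a = 0 \<Longrightarrow>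
      real (m j) / real (order a (pull (h j))) \<le> B a"
    and B': "B' \<ge> 1" "\<And>j. j \<le> n + 1 \<Longrightarrow> degree (pull (h j)) < D \<Longrightarrow>
      real (m j) / real (D - degree (pull (h j))) \<le> B'"
    and cost: "(\<Sum>a | \<exists>j\<le>n + 1. poly (pull (h j)) a = 0. 1 - 1 / B a) + (1 - 1 / B') < 2"
  shows "orb_rational_curve n h m 1 (proj_space 1) crv"
proof -
  let ?Z = "{a. \<exists>j\<le>n + 1. poly (pull (h j)) a = 0}"
  have Z: "?Z = (\<Union>j\<in>{..n + 1}. {a. poly (pull (h j)) a = 0})" by auto
  have finZ: "finite ?Z"
    unfolding Z using nz by (intro finite_UN_I poly_roots_finite) auto
  have supp_fin: "crv (pt_fin a) \<in> orb_support n h \<longleftrightarrow> a \<in> ?Z" for a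
    using crv_hyperplane(1)[OF h] by (auto simp: orb_support_def simp del: crv_simps)
  obtain a where "a \<notin> ?Z" using ex_new_if_finite[OF infinite_UNIV_char_0 finZ] by blast
  then have supp: "\<not> crv ` proj_space 1 \<subseteq> orb_support n h"
    using supp_fin[of a] in_line(1)[of a] by blast
  let ?c = "\<lambda>a. 1 - 1 / curve_mult n h m 1 (proj_space 1) crv a"
  have bf: "1 \<le> curve_mult n h m 1 (proj_space 1) crv (pt_fin a)"
    "curve_mult n h m 1 (proj_space 1) crv (pt_fin a) \<le> B a" for a
  proof -
    have *: "real (m j) / real (pullback_mult 1 (proj_space 1) n crv (h j) (pt_fin a)) \<le> B a"
      if "j \<le> n + 1" "crv (pt_fin a) \<in> hyperplane n (h j)" for j
      using that crv_hyperplane(1)[OF h] pullback_mult_fin[OF h nz] B(2) by simp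
    show "1 \<le> curve_mult n h m 1 (proj_space 1) crv (pt_fin a)"
      "curve_mult n h m 1 (proj_space 1) crv (pt_fin a) \<le> B a"
      by (rule curve_mult_bounds[OF B(1)[of a] *]; assumption)+
  qed
  have bi: "1 \<le> curve_mult n h m 1 (proj_space 1) crv pt_inf"
    "curve_mult n h m 1 (proj_space 1) crv pt_inf \<le> B'"
  proof -
    have *: "real (m j) / real (pullback_mult 1 (proj_space 1) n crv (h j) pt_inf) \<le> B'"
      if j: "j \<le> n + 1" "crv pt_inf \<in> hyperplane n (h j)" for j
    proof -
      have "coeff (pull (h j)) D = 0" using j crv_hyperplane(2)[OF h[OF j(1)]] by simp
      then have "degree (pull (h j)) \<noteq> D" using nz[OF j(1)] by auto
      then have "degree (pull (h j)) < D" using degree_pull[of "h j"] by simp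
      then show ?thesis using B'(2)[OF j(1)] pullback_mult_inf[OF h nz] j(1) by simp
    qed
    show "1 \<le> curve_mult n h m 1 (proj_space 1) crv pt_inf"
      "curve_mult n h m 1 (proj_space 1) crv pt_inf \<le> B'"
      by (rule curve_mult_bounds[OF B'(1) *]; assumption)+
  qed
  have cost_fin: "?c (pt_fin a) \<le> 1 - 1 / B a" "0 \<le> ?c (pt_fin a)" for a
    using bf[of a] by (auto intro!: divide_left_mono)
  have cost_inf: "?c pt_inf \<le> 1 - 1 / B'" "0 \<le> ?c pt_inf" using bi by (auto intro!: divide_left_mono)
  \<comment> \<open>Infinity is counted even when it lies outside the support; its term is
    nonnegative, so this can only enlarge the sum.\<close>
  have "{a \<in> proj_space 1. crv a \<in> orb_support n h} \<subseteq> insert pt_inf (pt_fin ` ?Z)"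
    using supp_fin by (auto simp: line_eq)
  then have "orb_degree n h m 1 (proj_space 1) crv \<le> (\<Sum>a\<in>insert pt_inf (pt_fin ` ?Z). ?c a)"
    unfolding orb_degree_def using finZ cost_fin(2) cost_inf(2)
    by (intro sum_mono2) auto
  also have "\<dots> = ?c pt_inf + (\<Sum>a\<in>?Z. ?c (pt_fin a))"
    using finZ by (subst sum.insert) (auto simp: sum.reindex inj_on_def)
  also have "\<dots> \<le> (1 - 1 / B') + (\<Sum>a\<in>?Z. 1 - 1 / B a)"
    using cost_fin(1) cost_inf(1) by (intro add_mono sum_mono) auto
  also have "\<dots> < 2" using cost by simp
  finally have "orb_degree n h m 1 (proj_space 1) crv < 2" .
  then have "\<exists>K. canonical_divisor 1 (proj_space 1) K \<and>
      real_of_int (divisor_degree (proj_space 1) K) + orb_degree n h m 1 (proj_space 1) crv < 0"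
    using canonical_line by (intro exI[of _ "\<lambda>a. if a = pt_inf then - 2 else 0"]) simp
  then show ?thesis
    unfolding orb_rational_curve_def
    using smooth_line curve_map_crv birational_crv[OF R] supp by blast
qed

end

section \<open>Hyperplanes in general position\<close>

text \<open>\<open>h \<bullet> x\<close> sums over the actual dimension of \<open>x\<close>, whereas
  homogeneous polynomials are total functions of vectors; here the number of coordinates is
  fixed.\<close>

definition lin_form :: "nat \<Rightarrow> complex vec \<Rightarrow> complex vec \<Rightarrow> complex" where
  "lin_form n h x = (\<Sum>i\<le>n. h $ i * x $ i)"

lemma hom_poly_lin_form: "hom_poly n 1 (lin_form n h)"
  unfolding lin_form_def[abs_def] by (intro hom_poly_sum hom_poly_scale hom_poly.var) simp

lemma lin_form_eq: "x \<in> carrier_vec (Suc n) \<Longrightarrow> lin_form n h x = h \<bullet> x"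
  unfolding scalar_prod_def lin_form_def by (simp add: atLeast0LessThan lessThan_Suc_atMost)

locale hyperplane_frame =
  fixes n :: nat and h :: "nat \<Rightarrow> complex vec" and e :: "nat \<Rightarrow> complex vec" and \<kappa> :: "nat \<Rightarrow> complex"
  assumes h: "\<And>j. j \<le> n + 1 \<Longrightarrow> h j \<in> carrier_vec (Suc n)"
    and e: "\<And>j. j \<le> n \<Longrightarrow> e j \<in> carrier_vec (Suc n)"
    and dual: "\<And>i j. i \<le> n \<Longrightarrow> j \<le> n \<Longrightarrow> h j \<bullet> e i = (if i = j then 1 else 0)"
    and \<kappa>: "\<And>j. j \<le> n + 1 \<Longrightarrow> \<kappa> j \<noteq> 0"
    and relation: "\<And>x. x \<in> carrier_vec (Suc n) \<Longrightarrow> (\<Sum>j\<le>n + 1. \<kappa> j * (h j \<bullet> x)) = 0"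
    and separating: "\<And>x. x \<in> carrier_vec (Suc n) \<Longrightarrow> (\<And>j. j \<le> n \<Longrightarrow> h j \<bullet> x = 0) \<Longrightarrow> x = 0\<^sub>v (Suc n)"

definition comb :: "nat \<Rightarrow> (nat \<Rightarrow> complex vec) \<Rightarrow> (nat \<Rightarrow> complex) \<Rightarrow> complex vec" where
  "comb n e a = vec (Suc n) (\<lambda>i. \<Sum>j\<le>n. a j * e j $ i)"

lemma comb_carrier [simp]: "comb n e a \<in> carrier_vec (Suc n)"
  by (simp add: comb_def)

lemma scalar_comb:
  assumes "\<And>j. j \<le> n \<Longrightarrow> e j \<in> carrier_vec (Suc n)"
  shows "h \<bullet> comb n e a = (\<Sum>j\<le>n. a j * (h \<bullet> e j))"
proof -
  have "h \<bullet> comb n e a = (\<Sum>i\<le>n. \<Sum>j\<le>n. a j * (h $ i * e j $ i))"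
    unfolding comb_def scalar_vec by (simp add: sum_distrib_left mult_ac)
  also have "\<dots> = (\<Sum>j\<le>n. \<Sum>i\<le>n. a j * (h $ i * e j $ i))" by (rule sum.swap)
  also have "\<dots> = (\<Sum>j\<le>n. a j * (h \<bullet> e j))"
  proof (rule sum.cong)
    fix j assume "j \<in> {..n}"
    then have "h \<bullet> e j = (\<Sum>i\<le>n. h $ i * e j $ i)"
      using lin_form_eq[OF assms, of j h] by (simp add: lin_form_def)
    then show "(\<Sum>i\<le>n. a j * (h $ i * e j $ i)) = a j * (h \<bullet> e j)" by (simp add: sum_distrib_left)
  qed simp
  finally show ?thesis .
qed

lemma scalar_comb_dual:
  assumes "\<And>i. i \<le> n \<Longrightarrow> e i \<in> carrier_vec (Suc n)"
    and "\<And>i. i \<le> n \<Longrightarrow> h \<bullet> e i = (if i = j then 1 else 0)" and "j \<le> n"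
  shows "h \<bullet> comb n e a = a j"
proof -
  have "h \<bullet> comb n e a = (\<Sum>i\<le>n. a i * (h \<bullet> e i))" by (rule scalar_comb[OF assms(1)])
  also have "\<dots> = (\<Sum>i\<le>n. if i = j then a j else 0)" using assms(2) by (intro sum.cong) auto
  finally show ?thesis using assms(3) by simp
qed

text \<open>A dual vector exists because \<open>n\<close> equations in \<open>n + 1\<close> unknowns
  have a nontrivial solution, which the remaining form cannot kill in general position. The scalars
  expand the last form in the dual basis; \<open>\<kappa> j = 0\<close> with
  \<open>j \<le> n\<close> would put \<open>e j\<close> on all hyperplanes other than
  \<open>j\<close>.\<close>

theorem general_position_frame:
  assumes "general_position n h"
  shows "\<exists>e \<kappa>. hyperplane_frame n h e \<kappa>"
proof -
  have h: "h j \<in> carrier_vec (Suc n)" if "j \<le> n + 1" for j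
    using assms that by (auto simp: general_position_def)
  have gp: "x = 0\<^sub>v (Suc n)"
    if I: "I \<subseteq> {..n + 1}" "card I = n + 1" and x: "x \<in> carrier_vec (Suc n)" "\<And>j. j \<in> I \<Longrightarrow> h j \<bullet> x = 0" for I x
  proof (rule ccontr)
    assume "x \<noteq> 0\<^sub>v (Suc n)"
    then have "proj_pt x \<in> hyperplane n (h j)" if "j \<in> I" for j
      using hyperplane_proj_pt[OF x(1)] x(2)[OF that] h[of j] I(1) that by auto
    then have "proj_pt x \<in> (\<Inter>j\<in>I. hyperplane n (h j))" by blast
    then show False using assms I unfolding general_position_def by blast
  qed
  have "\<exists>x. x \<in> carrier_vec (Suc n) \<and> (\<forall>j\<le>n. h j \<bullet> x = (if i = j then 1 else 0))" if i: "i \<le> n" for i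
  proof -
    have "card ({..n} - {i}) < card {..n}" using i by simp
    from underdetermined_system[OF _ _ this, of "\<lambda>k t. h t $ k"]
    obtain c where c: "\<exists>k\<le>n. c k \<noteq> 0" "\<And>t. t \<le> n \<Longrightarrow> t \<noteq> i \<Longrightarrow> (\<Sum>k\<le>n. c k * h t $ k) = 0" by auto
    define x where "x = vec (Suc n) c"
    have x: "x \<in> carrier_vec (Suc n)" by (simp add: x_def)
    have zero: "h t \<bullet> x = 0" if "t \<le> n" "t \<noteq> i" for t
      using c(2)[OF that] by (simp add: x_def scalar_vec mult.commute)
    have "x \<noteq> 0\<^sub>v (Suc n)"
    proof
      assume "x = 0\<^sub>v (Suc n)"
      then have "x $ k = 0" if "k \<le> n" for k using that by simp
      then show False using c(1) by (auto simp: x_def)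
    qed
    then have "h i \<bullet> x \<noteq> 0" using gp[of "{..n}" x] x zero by auto
    then show ?thesis
      using x zero h i by (intro exI[of _ "(1 / (h i \<bullet> x)) \<cdot>\<^sub>v x"]) auto
  qed
  then obtain e where e: "\<And>i. i \<le> n \<Longrightarrow> e i \<in> carrier_vec (Suc n)"
    "\<And>i j. i \<le> n \<Longrightarrow> j \<le> n \<Longrightarrow> h j \<bullet> e i = (if i = j then 1 else 0)" by metis
  define \<kappa> where "\<kappa> = (\<lambda>j. if j \<le> n then h (n + 1) \<bullet> e j else - 1)"
  have sep: "x = 0\<^sub>v (Suc n)" if "x \<in> carrier_vec (Suc n)" "\<And>j. j \<le> n \<Longrightarrow> h j \<bullet> x = 0" for x
    using gp[of "{..n}" x] that by auto
  have "hyperplane_frame n h e \<kappa>"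
  proof (unfold_locales)
    fix j assume j: "j \<le> n + 1"
    show "\<kappa> j \<noteq> 0"
    proof (cases "j \<le> n")
      case True
      have "e j \<noteq> 0\<^sub>v (Suc n)"
      proof
        assume "e j = 0\<^sub>v (Suc n)"
        then show False using e(2)[OF True True] h[of j] True by simp
      qed
      moreover have "card ({..n + 1} - {j}) = n + 1" using j by simp
      ultimately obtain i where "i \<in> {..n + 1} - {j}" "h i \<bullet> e j \<noteq> 0"
        using gp[of "{..n + 1} - {j}" "e j"] e(1)[OF True] by blast
      then have "i = n + 1" using e(2)[OF True, of i] by (cases "i \<le> n") auto
      then show ?thesis using \<open>h i \<bullet> e j \<noteq> 0\<close> True by (simp add: \<kappa>_def)
    qed (simp add: \<kappa>_def)
  next
    fix x :: "complex vec" assume x: "x \<in> carrier_vec (Suc n)"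
    define y where "y = comb n e (\<lambda>j. h j \<bullet> x)"
    have y: "y \<in> carrier_vec (Suc n)" by (simp add: y_def)
    have "h j \<bullet> (x - y) = 0" if j: "j \<le> n" for j
    proof -
      have "h j \<bullet> y = h j \<bullet> x"
        unfolding y_def by (rule scalar_comb_dual[OF e(1) e(2)[OF _ j] j])
      then show ?thesis using scalar_prod_minus_distrib[of "h j" "Suc n" x y] h[of j] x y j by simp
    qed
    from sep[OF _ this] have "x - y = 0\<^sub>v (Suc n)" using x y by simp
    then have "x = y"
    proof -
      assume 0: "x - y = 0\<^sub>v (Suc n)"
      show "x = y"
      proof (rule eq_vecI)
        fix i assume "i < dim_vec y"
        then have "(x - y) $ i = 0" "i < Suc n" using 0 y by auto
        then show "x $ i = y $ i" using x y by simp
      qed (use x y in simp)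
    qed
    then have "h (n + 1) \<bullet> x = h (n + 1) \<bullet> y" by (rule arg_cong)
    also have "\<dots> = (\<Sum>j\<le>n. (h j \<bullet> x) * (h (n + 1) \<bullet> e j))"
      unfolding y_def by (rule scalar_comb[OF e(1)])
    finally have "h (n + 1) \<bullet> x = (\<Sum>j\<le>n. (h j \<bullet> x) * (h (n + 1) \<bullet> e j))" .
    then show "(\<Sum>j\<le>n + 1. \<kappa> j * (h j \<bullet> x)) = 0"
      by (simp add: \<kappa>_def One_nat_def mult.commute)
  qed (use h e sep in auto)
  then show ?thesis by blast
qed

context hyperplane_frame
begin

definition frame_point :: "(nat \<Rightarrow> complex poly) \<Rightarrow> complex \<Rightarrow> complex vec" where
  "frame_point F a = comb n e (\<lambda>j. poly (F j) a / \<kappa> j)"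

lemma frame_point_carrier [simp]: "frame_point F a \<in> carrier_vec (Suc n)"
  by (simp add: frame_point_def)

lemma scalar_frame_point:
  assumes F: "(\<Sum>j\<le>n + 1. F j) = 0" and j: "j \<le> n + 1"
  shows "\<kappa> j * (h j \<bullet> frame_point F a) = poly (F j) a"
proof -
  have 1: "\<kappa> j * (h j \<bullet> frame_point F a) = poly (F j) a" if j: "j \<le> n" for j
  proof -
    have "h j \<bullet> frame_point F a = poly (F j) a / \<kappa> j"
      unfolding frame_point_def by (rule scalar_comb_dual[OF e dual[OF _ j] j])
    then show ?thesis using j \<kappa>[of j] by simp
  qed
  show ?thesis
  proof (cases "j \<le> n")
    case False
    then have jn: "j = Suc n" using j by simp
    have "(\<Sum>j\<le>n. poly (F j) a) + \<kappa> j * (h j \<bullet> frame_point F a) = 0"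
      using relation[of "frame_point F a"] 1 jn by (simp add: One_nat_def)
    moreover have "(\<Sum>j\<le>n. poly (F j) a) + poly (F j) a = 0"
      using arg_cong[OF F, of "\<lambda>p. poly p a"] jn by (simp add: poly_sum One_nat_def)
    ultimately show ?thesis by (metis add_left_cancel)
  qed (rule 1)
qed

lemma frame_point_eqI:
  assumes "x \<in> carrier_vec (Suc n)" "(\<Sum>j\<le>n + 1. F j) = 0"
    "\<And>j. j \<le> n \<Longrightarrow> poly (F j) a = \<kappa> j * (h j \<bullet> x)"
  shows "frame_point F a = x"
proof -
  have "h j \<bullet> (frame_point F a - x) = 0" if "j \<le> n" for j
  proof -
    have "\<kappa> j * (h j \<bullet> frame_point F a) = \<kappa> j * (h j \<bullet> x)"
      using scalar_frame_point[OF assms(2)] assms(3)[OF that] that by simp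
    then have "h j \<bullet> frame_point F a = h j \<bullet> x" using \<kappa>[of j] that by simp
    then show ?thesis
      using scalar_prod_minus_distrib[of "h j" "Suc n" "frame_point F a" x] h[of j] that assms(1) by simp
  qed
  from separating[OF _ this] have 0: "frame_point F a - x = 0\<^sub>v (Suc n)" using assms(1) by simp
  show ?thesis
  proof (rule eq_vecI)
    fix i assume "i < dim_vec x"
    then have "(frame_point F a - x) $ i = 0" "i < Suc n" using 0 assms(1) by auto
    then show "frame_point F a $ i = x $ i" using assms(1) by simp
  qed (use assms(1) in \<open>simp add: frame_point_def comb_def\<close>)
qed

text \<open>Up to scaling, the \<open>F\<^sub>j\<close> are the pullbacks of the hyperplanes.\<close>

theorem orb_rational_curve_frame_point:
  fixes m :: "nat \<Rightarrow> nat" and B :: "complex \<Rightarrow> real"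
  assumes F: "(\<Sum>j\<le>n + 1. F j) = 0" and F0: "\<And>j. j \<le> n + 1 \<Longrightarrow> F j \<noteq> 0"
    and D: "\<And>j. j \<le> n + 1 \<Longrightarrow> degree (F j) \<le> D" "\<exists>j\<le>n + 1. degree (F j) = D"
    and no_common_root: "\<And>a. \<exists>j\<le>n + 1. poly (F j) a \<noteq> 0"
    and R: "hom_poly n d R0" "hom_poly n d R1" "A \<noteq> 0"
      "\<And>a. R0 (frame_point F a) = poly A a" "\<And>a. R1 (frame_point F a) = poly A a * a"
    and B: "\<And>a. B a \<ge> 1" "\<And>a j. j \<le> n + 1 \<Longrightarrow> poly (F j) a = 0 \<Longrightarrow>
      real (m j) / real (order a (F j)) \<le> B a"
    and B': "B' \<ge> 1" "\<And>j. j \<le> n + 1 \<Longrightarrow> degree (F j) < D \<Longrightarrow> real (m j) / real (D - degree (F j)) \<le> B'"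
    and cost: "(\<Sum>a | \<exists>j\<le>n + 1. poly (F j) a = 0. 1 - 1 / B a) + (1 - 1 / B') < 2"
  shows "\<exists>g. orb_rational_curve n h m 1 (proj_space 1) g \<and> (\<forall>a. proj_pt (frame_point F a) \<in> g ` proj_space 1)"
proof -
  define G where "G = (\<lambda>i. \<Sum>j\<le>n. smult (e j $ i / \<kappa> j) (F j))"
  have vec_G: "vec (Suc n) (\<lambda>i. poly (G i) a) = frame_point F a" for a
    by (intro eq_vecI) (auto simp: frame_point_def comb_def G_def poly_sum intro!: sum.cong)
  have pullG: "(\<Sum>i\<le>n. smult (h j $ i) (G i)) = smult (1 / \<kappa> j) (F j)" if j: "j \<le> n + 1" for j
  proof (rule poly_ext)
    fix a
    have "poly (\<Sum>i\<le>n. smult (h j $ i) (G i)) a = h j \<bullet> frame_point F a"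
      unfolding vec_G[symmetric] by (simp add: scalar_vec poly_sum)
    then show "poly (\<Sum>i\<le>n. smult (h j $ i) (G i)) a = poly (smult (1 / \<kappa> j) (F j)) a"
      using scalar_frame_point[OF F j, of a] \<kappa>[OF j] by (simp add: field_simps)
  qed
  interpret poly_curve n D G
  proof
    show "degree (G i) \<le> D" for i
      unfolding G_def using D(1)
      by (intro degree_sum_le) (auto intro!: order_trans[OF degree_smult_le])
    show "\<exists>i\<le>n. coeff (G i) D \<noteq> 0"
    proof (rule ccontr)
      assume neg: "\<not> ?thesis"
      obtain j where j: "j \<le> n + 1" "degree (F j) = D" using D(2) by blast
      have "coeff (smult (1 / \<kappa> j) (F j)) D = 0"
        unfolding pullG[OF j(1), symmetric] using neg by (simp add: coeff_sum)
      then show False using \<kappa>[OF j(1)] F0[OF j(1)] j(2) by auto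
    qed
    show "\<exists>i\<le>n. poly (G i) a \<noteq> 0" for a
    proof (rule ccontr)
      assume neg: "\<not> ?thesis"
      obtain j where j: "j \<le> n + 1" "poly (F j) a \<noteq> 0" using no_common_root by blast
      have "poly (smult (1 / \<kappa> j) (F j)) a = 0"
        unfolding pullG[OF j(1), symmetric] using neg by (simp add: poly_sum)
      then show False using \<kappa>[OF j(1)] j(2) by auto
    qed
  qed
  have pull: "pull (h j) = smult (1 / \<kappa> j) (F j)" if "j \<le> n + 1" for j
    using pullG[OF that] by (simp add: pull_def)
  have vfin: "vfin a = frame_point F a" for a by (simp add: vfin_def vec_G)
  have root: "poly (pull (h j)) a = 0 \<longleftrightarrow> poly (F j) a = 0"
    and order: "order a (pull (h j)) = order a (F j)"
    and degree: "degree (pull (h j)) = degree (F j)" and pull0: "pull (h j) \<noteq> 0"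
    if "j \<le> n + 1" for j a
    using \<kappa>[OF that] F0[OF that] pull[OF that] by (auto simp: order_smult)
  have Z: "{a. \<exists>j\<le>n + 1. poly (pull (h j)) a = 0} = {a. \<exists>j\<le>n + 1. poly (F j) a = 0}"
    using root by blast
  have "orb_rational_curve n h m 1 (proj_space 1) crv"
  proof (rule orb_rational_curveI[where B = B and B' = B', OF h pull0 R(1-3)])
    show "R0 (vfin a) = poly A a" "R1 (vfin a) = poly A a * a" for a
      unfolding vfin by (rule R)+
    show "real (m j) / real (order a (pull (h j))) \<le> B a"
      if "j \<le> n + 1" "poly (pull (h j)) a = 0" for a j
      using B(2) that root order by simp
    show "real (m j) / real (D - degree (pull (h j))) \<le> B'"
      if "j \<le> n + 1" "degree (pull (h j)) < D" for j
      using B'(2) that degree by simp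
    show "(\<Sum>a | \<exists>j\<le>n + 1. poly (pull (h j)) a = 0. 1 - 1 / B a) + (1 - 1 / B') < 2"
      unfolding Z by (rule cost)
  qed (use B B' in auto)
  moreover have "proj_pt (frame_point F a) \<in> crv ` proj_space 1" for a
    by (rule image_eqI[of _ _ "pt_fin a"]) (simp_all add: vfin)
  ultimately show ?thesis by blast
qed

lemma generic_nonzero:
  assumes "\<And>S. S \<noteq> {} \<Longrightarrow> S \<subset> {..n + 1} \<Longrightarrow> (\<Sum>j\<in>S. z j) \<noteq> 0" "j \<le> n + 1"
  shows "z j \<noteq> 0"
proof -
  have "card {j} < card {..n + 1}" by simp
  then have "{j} \<noteq> {..n + 1}" by (metis less_irrefl)
  then show ?thesis using assms(1)[of "{j}"] assms(2) by auto
qed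

text \<open>Excluding the vanishing of all proper nonempty partial sums amounts to the nonvanishing
  of a finite product of linear forms, which is a basic open set.\<close>

theorem uniruledI:
  assumes "\<And>x. x \<in> carrier_vec (Suc n) \<Longrightarrow>
    (\<And>S. S \<noteq> {} \<Longrightarrow> S \<subset> {..n + 1} \<Longrightarrow> (\<Sum>j\<in>S. \<kappa> j * (h j \<bullet> x)) \<noteq> 0) \<Longrightarrow>
    \<exists>N C g. orb_rational_curve n h m N C g \<and> proj_pt x \<in> g ` C"
  shows "uniruled n h m"
proof -
  let ?S = "{S. S \<noteq> {} \<and> S \<subset> {..n + 1}}"
  define f where "f = (\<lambda>x. \<Prod>S\<in>?S. \<Sum>j\<in>S. \<kappa> j * lin_form n (h j) x)"
  have "?S \<subseteq> Pow {..n + 1}" by auto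
  then have finS: "finite ?S" by (rule finite_subset) simp
  have "\<exists>d. hom_poly n d (\<lambda>x. \<Prod>S\<in>A. \<Sum>j\<in>S. \<kappa> j * lin_form n (h j) x)" if "finite A" for A
    using that
  proof (induction A rule: finite_induct)
    case empty
    then show ?case using hom_poly.const[of n 1] by auto
  next
    case (insert S A)
    then obtain d where "hom_poly n d (\<lambda>x. \<Prod>S\<in>A. \<Sum>j\<in>S. \<kappa> j * lin_form n (h j) x)" by blast
    moreover have "hom_poly n 1 (\<lambda>x. \<Sum>j\<in>S. \<kappa> j * lin_form n (h j) x)"
      by (intro hom_poly_sum hom_poly_scale hom_poly_lin_form)
    ultimately have "hom_poly n (1 + d) (\<lambda>x. (\<Sum>j\<in>S. \<kappa> j * lin_form n (h j) x) *
        (\<Prod>S\<in>A. \<Sum>j\<in>S. \<kappa> j * lin_form n (h j) x))" by (intro hom_poly.mult)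
    then show ?case using insert by auto
  qed
  from this[OF finS] obtain d where d: "hom_poly n d f" by (auto simp: f_def)
  let ?U = "{p \<in> proj_space n. \<forall>x\<in>p. f x \<noteq> 0}"
  have f: "f x \<noteq> 0 \<longleftrightarrow> (\<forall>S. S \<noteq> {} \<longrightarrow> S \<subset> {..n + 1} \<longrightarrow> (\<Sum>j\<in>S. \<kappa> j * (h j \<bullet> x)) \<noteq> 0)"
    if x: "x \<in> carrier_vec (Suc n)" for x
    using finS by (simp add: f_def lin_form_eq[OF x]) blast
  \<comment> \<open>Coordinates 1 for \<open>j \<le> n\<close>, hence \<open>-(n + 1)\<close> for
    the last: a proper partial sum is a positive count, or a count below \<open>n + 1\<close> minus
    \<open>n + 1\<close>. So the open set is nonempty.\<close>
  define x where "x = comb n e (\<lambda>j. 1 / \<kappa> j)"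
  have x: "x \<in> carrier_vec (Suc n)" by (simp add: x_def)
  have hx: "\<kappa> j * (h j \<bullet> x) = 1" if j: "j \<le> n" for j
  proof -
    have "h j \<bullet> x = 1 / \<kappa> j" unfolding x_def by (rule scalar_comb_dual[OF e dual[OF _ j] j])
    then show ?thesis using j \<kappa>[of j] by simp
  qed
  have hx': "\<kappa> (Suc n) * (h (Suc n) \<bullet> x) = - of_nat (Suc n)"
  proof -
    have "(\<Sum>j\<le>n. \<kappa> j * (h j \<bullet> x)) = of_nat (Suc n)" using hx by simp
    then show ?thesis using relation[OF x] by (simp add: One_nat_def add_eq_0_iff2 add_eq_0_iff)
  qed
  have "f x \<noteq> 0"
    unfolding f[OF x]
  proof (intro allI impI)
    fix S assume S: "S \<noteq> {}" "S \<subset> {..n + 1}"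
    have finS: "finite S" using S(2) by (auto intro: finite_subset)
    show "(\<Sum>j\<in>S. \<kappa> j * (h j \<bullet> x)) \<noteq> 0"
    proof (cases "Suc n \<in> S")
      case False
      have "j \<le> n" if "j \<in> S" for j using that S(2) False by (cases "j = Suc n") auto
      then have "(\<Sum>j\<in>S. \<kappa> j * (h j \<bullet> x)) = (\<Sum>j\<in>S. 1)" using hx by (intro sum.cong) auto
      then show ?thesis using S(1) finS by simp
    next
      case True
      have le: "j \<le> n" if "j \<in> S - {Suc n}" for j using that S(2) by (cases "j = Suc n") auto
      have "(\<Sum>j\<in>S. \<kappa> j * (h j \<bullet> x)) = - of_nat (Suc n) + (\<Sum>j\<in>S - {Suc n}. \<kappa> j * (h j \<bullet> x))"
        using True finS hx' by (simp add: sum.remove)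
      also have "(\<Sum>j\<in>S - {Suc n}. \<kappa> j * (h j \<bullet> x)) = (\<Sum>j\<in>S - {Suc n}. 1)"
        using hx le by (intro sum.cong) auto
      finally have eq: "(\<Sum>j\<in>S. \<kappa> j * (h j \<bullet> x)) = of_nat (card (S - {Suc n})) - of_nat (Suc n)" by simp
      have "S - {Suc n} \<subset> {..n}"
      proof
        show "S - {Suc n} \<subseteq> {..n}" using le by auto
        show "S - {Suc n} \<noteq> {..n}"
        proof
          assume "S - {Suc n} = {..n}"
          then have "S = insert (Suc n) {..n}" using True by blast
          also have "\<dots> = {..n + 1}" by auto
          finally show False using S(2) by simp
        qed
      qed
      then have "card (S - {Suc n}) < card {..n}" by (intro psubset_card_mono) auto
      then have "card (S - {Suc n}) \<noteq> Suc n" by simp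
      then show ?thesis unfolding eq by (metis eq_iff_diff_eq_0 of_nat_eq_iff)
    qed
  qed
  have "x \<noteq> 0\<^sub>v (Suc n)" using hx[of 0] h[of 0] by auto
  have fx: "f y \<noteq> 0" if "y \<in> proj_pt x" for y
  proof -
    obtain c where "c \<noteq> 0" "y = c \<cdot>\<^sub>v x" using \<open>y \<in> proj_pt x\<close> by (auto elim: mem_proj_ptE)
    then show ?thesis using hom_poly_smult[OF d x] \<open>f x \<noteq> 0\<close> by simp
  qed
  have "proj_pt x \<in> ?U" using fx proj_spaceI[OF x \<open>x \<noteq> 0\<^sub>v (Suc n)\<close>] by simp
  moreover have "\<exists>N C g. orb_rational_curve n h m N C g \<and> p \<in> g ` C" if p: "p \<in> ?U" for p
  proof -
    obtain y where y: "y \<in> p" using p proj_space_nonempty by blast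
    have y': "p = proj_pt y" "y \<in> carrier_vec (Suc n)" using mem_proj_spaceD[of p n y] p y by auto
    have "f y \<noteq> 0" using p y by blast
    then have "(\<Sum>j\<in>S. \<kappa> j * (h j \<bullet> y)) \<noteq> 0" if "S \<noteq> {}" "S \<subset> {..n + 1}" for S
      using f[OF y'(2)] that by simp
    from assms[OF y'(2) this] show ?thesis unfolding y'(1) .
  qed
  ultimately show ?thesis
    unfolding uniruled_def by (intro exI[of _ ?U] conjI openin_zariski_basic[OF d] ballI) auto
qed

end

section \<open>Curves with a single orbifold point at infinity\<close>

lemma order_power: "p \<noteq> 0 \<Longrightarrow> order a (p ^ k) = k * order a (p :: 'a::idom poly)"
  by (induction k) (auto simp: order_mult)

text \<open>The first factor is the ramification index of \<open>w\<close> at \<open>b\<close>. Once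
  its zero at \<open>poly w b\<close> is split off, \<open>F\<close> leaves a factor that does not
  vanish there.\<close>

lemma order_pcompose:
  fixes F w :: "complex poly"
  assumes "F \<noteq> 0" "degree w > 0"
  shows "order b (pcompose F w) =
    order b (w - [:poly w b:]) * order (poly w b) F"
proof -
  let ?a = "poly w b"
  obtain Q where Q: "F = [:- ?a, 1:] ^ order ?a F * Q" "\<not> [:- ?a, 1:] dvd Q"
    using order_decomp[OF assms(1)] by blast
  have Qa: "poly (pcompose Q w) b \<noteq> 0" using Q(2) by (simp add: poly_pcompose poly_eq_0_iff_dvd)
  have w0: "w - [:?a:] \<noteq> 0" using assms(2) by (metis degree_pCons_0 eq_iff_diff_eq_0 less_irrefl)
  have "pcompose F w = (w - [:?a:]) ^ order ?a F * pcompose Q w"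
  proof (rule poly_ext)
    fix t
    have "poly F s = (s - ?a) ^ order ?a F * poly Q s" for s
      by (subst Q(1)) simp
    then show "poly (pcompose F w) t = poly ((w - [:?a:]) ^ order ?a F * pcompose Q w) t"
      by (simp add: poly_pcompose)
  qed
  moreover have "pcompose Q w \<noteq> 0" using Qa by auto
  ultimately show ?thesis
    using w0 Qa by (simp add: order_mult order_power order_0I mult.commute)
qed

lemma sum_orders_eq_degree:
  fixes p :: "complex poly"
  assumes "p \<noteq> 0"
  shows "(\<Sum>b | poly p b = 0. order b p) = degree p"
proof -
  have "degree p = size (proots p)" by (simp add: size_proots_complex)
  also have "\<dots> = (\<Sum>b | poly p b = 0. order b p)"
    using assms by (simp add: size_multiset_overloaded_eq)
  finally show ?thesis ..
qed

lemma degree_diff_const: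
  fixes w :: "'a::comm_ring_1 poly"
  assumes "degree w > 0"
  shows "degree (w - [:a:]) = degree w"
  using degree_add_eq_left[of "- [:a:]" w] assms by (simp only: degree_minus degree_pCons_0 diff_conv_add_uminus)

lemma surj_poly:
  fixes w :: "complex poly"
  assumes "degree w > 0"
  shows "\<exists>b. poly w b = a"
proof -
  have "degree (w - [:a:]) > 0"
    using assms by (simp add: degree_diff_const)
  then have "\<not> constant (poly (w - [:a:]))" by (simp add: constant_degree)
  then obtain b where "poly (w - [:a:]) b = 0" using fundamental_theorem_of_algebra by blast
  then show ?thesis by (intro exI[of _ b]) simp
qed

definition fiber :: "complex poly \<Rightarrow> complex \<Rightarrow> complex set" where
  "fiber w a = {b. poly w b = a}"

lemma fiber_facts:
  fixes w :: "complex poly"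
  assumes w: "degree w > 0"
  shows "finite (fiber w a)" "card (fiber w a) > 0"
    "(\<Sum>b\<in>fiber w a. order b (w - [:a:])) = degree w"
    "b \<in> fiber w a \<Longrightarrow> order b (w - [:a:]) = Suc (order b (pderiv w))"
proof -
  have deg: "degree (w - [:a:]) = degree w"
    using w by (rule degree_diff_const)
  then have w0: "w - [:a:] \<noteq> 0" using w by auto
  have fib: "fiber w a = {b. poly (w - [:a:]) b = 0}" by (simp add: fiber_def)
  show fin: "finite (fiber w a)" unfolding fib by (rule poly_roots_finite[OF w0])
  have "fiber w a \<noteq> {}" using surj_poly[OF w] by (auto simp: fiber_def)
  then show "card (fiber w a) > 0" using fin by (simp add: card_gt_0_iff)
  show "(\<Sum>b\<in>fiber w a. order b (w - [:a:])) = degree w"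
    unfolding fib using sum_orders_eq_degree[OF w0] deg by simp
  assume b: "b \<in> fiber w a"
  then have "poly (w - [:a:]) b = 0" unfolding fib by simp
  from order_pderiv[OF w0 this] show "order b (w - [:a:]) = Suc (order b (pderiv w))"
    by (simp add: pderiv_diff pderiv_pCons)
qed

text \<open>Over \<open>a\<close>, the degree minus the number of preimages is the total order of
  the derivative along the fibre. The fibres are disjoint and the derivative has degree
  \<open>degree w - 1\<close>, whence the strict inequality.\<close>

lemma riemann_hurwitz:
  fixes w :: "complex poly"
  assumes w: "degree w > 0" and Z: "finite Z"
  shows "(\<Sum>a\<in>Z. 1 - real (card (fiber w a)) / real (degree w)) < 1"
proof -
  have dw: "pderiv w \<noteq> 0" using w by (simp add: pderiv_eq_0_iff)
  have "(\<Sum>a\<in>Z. real (degree w) - real (card (fiber w a))) =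
      (\<Sum>a\<in>Z. \<Sum>b\<in>fiber w a. real (order b (pderiv w)))"
  proof (rule sum.cong)
    fix a
    have "real (degree w) = (\<Sum>b\<in>fiber w a. real (order b (w - [:a:])))"
      using fiber_facts(3)[OF w, of a] by (metis of_nat_sum)
    also have "\<dots> = (\<Sum>b\<in>fiber w a. real (order b (pderiv w)) + 1)"
      using fiber_facts(4)[OF w] by (intro sum.cong) auto
    finally show "real (degree w) - real (card (fiber w a)) =
        (\<Sum>b\<in>fiber w a. real (order b (pderiv w)))" by (simp add: sum.distrib)
  qed simp
  also have "\<dots> = (\<Sum>b\<in>(\<Union>a\<in>Z. fiber w a). real (order b (pderiv w)))"
    using Z fiber_facts(1)[OF w] by (intro sum.UNION_disjoint[symmetric]) (auto simp: fiber_def)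
  also have "\<dots> \<le> real (degree (pderiv w))"
  proof -
    let ?A = "\<Union>a\<in>Z. fiber w a"
    have finA: "finite ?A" using Z fiber_facts(1)[OF w] by blast
    have "(\<Sum>b\<in>?A. order b (pderiv w)) \<le>
        (\<Sum>b\<in>?A \<union> {b. poly (pderiv w) b = 0}. order b (pderiv w))"
      using finA poly_roots_finite[OF dw] by (intro sum_mono2) auto
    also have "\<dots> = (\<Sum>b | poly (pderiv w) b = 0. order b (pderiv w))"
      using finA poly_roots_finite[OF dw] by (intro sum.mono_neutral_right) (auto simp: order_0I)
    also have "\<dots> = degree (pderiv w)" by (rule sum_orders_eq_degree[OF dw])
    finally show ?thesis by (metis of_nat_le_iff of_nat_sum)
  qed
  also have "\<dots> < real (degree w)" using w by (simp add: degree_pderiv)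
  finally have lt: "(\<Sum>a\<in>Z. real (degree w) - real (card (fiber w a))) < real (degree w)" .
  have "(\<Sum>a\<in>Z. 1 - real (card (fiber w a)) / real (degree w)) =
      (\<Sum>a\<in>Z. real (degree w) - real (card (fiber w a))) / real (degree w)"
    using w by (simp add: sum_divide_distrib diff_divide_distrib)
  also have "\<dots> < 1" using lt w by simp
  finally show ?thesis .
qed

context hyperplane_frame
begin

text \<open>The last hyperplane can only be met at infinity, and infinity costs less than 1 for any
  multiplicity; hence \<open>m (n + 1)\<close> does not enter the sum.\<close>

theorem uniruled_if_sum_gt_1:
  assumes m: "\<And>j. j \<le> n \<Longrightarrow> m j \<ge> 1" and sum: "(\<Sum>j\<le>n. 1 / real (m j)) > 1"
  shows "uniruled n h m"
proof (rule uniruledI)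
  fix x assume x: "x \<in> carrier_vec (Suc n)"
    and gen: "\<And>S. S \<noteq> {} \<Longrightarrow> S \<subset> {..n + 1} \<Longrightarrow> (\<Sum>j\<in>S. \<kappa> j * (h j \<bullet> x)) \<noteq> 0"
  define z where "z = (\<lambda>j. \<kappa> j * (h j \<bullet> x))"
  have z0: "z j \<noteq> 0" if "j \<le> n + 1" for j
    using generic_nonzero[of z] gen that by (simp add: z_def)
  have z_sum: "(\<Sum>j\<le>n. z j) + z (n + 1) = 0" using relation[OF x] by (simp add: z_def One_nat_def)
  obtain y where y: "\<And>j. j \<le> n \<Longrightarrow> poly (y j) 0 = 1" "\<exists>j\<le>n. degree (y j) > 0"
    "(\<Sum>j\<le>n. smult (z j) (y j ^ m j)) = [:\<Sum>j\<le>n. z j:]"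
    using sum_of_powers_constant[of "{..n}" m z] m sum by auto
  define f where "f = (\<lambda>j. if j \<le> n then smult (z j) (y j ^ m j) else [:z j:])"
  have f_sum: "(\<Sum>j\<le>n + 1. f j) = 0"
  proof -
    have "(\<Sum>j\<le>n + 1. f j) = [:(\<Sum>j\<le>n. z j) + z (n + 1):]"
      using y(3) by (simp add: f_def One_nat_def)
    then show ?thesis using z_sum by simp
  qed
  have f_0: "poly (f j) 0 = z j" if "j \<le> n + 1" for j
    using y(1) that by (cases "j \<le> n") (auto simp: f_def)
  let ?V = "frame_point f"
  have V: "\<kappa> j * lin_form n (h j) (?V t) = poly (f j) t" if "j \<le> n + 1" for j t
    using scalar_frame_point[OF f_sum that] by (simp add: lin_form_eq)
  \<comment> \<open>A linear form equal to 1 along the curve: multiplying by its powers raises the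
    degree of a form without changing its values there.\<close>
  define L where "L = (\<lambda>x. \<kappa> (n + 1) / z (n + 1) * lin_form n (h (n + 1)) x)"
  have L: "hom_poly n 1 L" "L (?V t) = 1" for t
  proof -
    show "hom_poly n 1 L" unfolding L_def by (intro hom_poly_scale hom_poly_lin_form)
    show "L (?V t) = 1" using V[of "n + 1" t] z0[of "n + 1"] by (simp add: L_def f_def)
  qed
  \<comment> \<open>The functions of \<open>t\<close> induced by homogeneous forms; they are closed
    under addition because \<open>L\<close> equalises degrees.\<close>
  define S where "S = {q. \<exists>d P. hom_poly n d P \<and> (\<forall>t. P (?V t) = poly q t)}"
  have raise: "\<exists>P'. hom_poly n d' P' \<and> (\<forall>t. P' (?V t) = P (?V t))" if "hom_poly n d P" "d \<le> d'" for d d' P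
  proof -
    have "hom_poly n (d + (d' - d) * 1) (\<lambda>x. P x * L x ^ (d' - d))"
      by (intro hom_poly.mult that(1) hom_poly_power L)
    then show ?thesis using that(2) L(2)
      by (intro exI[of _ "\<lambda>x. P x * L x ^ (d' - d)"]) simp
  qed
  have raise2: "\<exists>d P P'. hom_poly n d P \<and> hom_poly n d P' \<and> (\<forall>t. P (?V t) = poly q t) \<and>
      (\<forall>t. P' (?V t) = poly q' t)" if q: "q \<in> S" "q' \<in> S" for q q'
  proof -
    obtain d P d' P' where P: "hom_poly n d P" "\<forall>t. P (?V t) = poly q t"
      "hom_poly n d' P'" "\<forall>t. P' (?V t) = poly q' t" using q unfolding S_def by blast
    show ?thesis
      using raise[OF P(1) max.cobounded1[of d d']] raise[OF P(3) max.cobounded2[of d' d]] P(2,4) by metis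
  qed
  have f_in: "f j \<in> S" if "j \<le> n + 1" for j
  proof -
    have "hom_poly n 1 (\<lambda>x. \<kappa> j * lin_form n (h j) x)" by (intro hom_poly_scale hom_poly_lin_form)
    then show ?thesis unfolding S_def using V[OF that] by blast
  qed
  interpret poly_subalgebra S
  proof
    show "[:c:] \<in> S" for c unfolding S_def using hom_poly.const[of n c] by auto
    fix p q assume pq: "p \<in> S" "q \<in> S"
    from raise2[OF pq] obtain d P P' where P: "hom_poly n d P" "hom_poly n d P'"
      "\<forall>t. P (?V t) = poly p t" "\<forall>t. P' (?V t) = poly q t" by blast
    show "p + q \<in> S"
      unfolding S_def using hom_poly.add[OF P(1,2)] P(3,4)
      by (intro CollectI exI[of _ d] exI[of _ "\<lambda>x. P x + P' x"]) simp
    show "p * q \<in> S"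
      unfolding S_def using hom_poly.mult[OF P(1,2)] P(3,4)
      by (intro CollectI exI[of _ "d + d"] exI[of _ "\<lambda>x. P x * P' x"]) simp
  next
    obtain j where j: "j \<le> n" "degree (y j) > 0" using y(2) by blast
    have "degree (f j) = m j * degree (y j)"
      using j z0[of j] by (subst degree_power_eq[symmetric]) (auto simp: f_def)
    then have "degree (f j) > 0" using j m[of j] by simp
    then show "\<exists>p\<in>S. degree p > 0" using f_in[of j] j by auto
  qed
  \<comment> \<open>The parametrisation factors through \<open>w\<close>; \<open>p\<close> and
    \<open>p * w\<close> come from forms of equal degree, whose quotient recovers \<open>w\<close>,
    the parameter of the second factor.\<close>
  obtain w p where w: "degree w > 0" and p: "p \<in> S" "p \<noteq> 0" "p * w \<in> S"
    and comp: "\<And>q. q \<in> S \<Longrightarrow> \<exists>F. q = pcompose F w" using generator by blast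
  have "\<forall>j. \<exists>F. j \<le> n + 1 \<longrightarrow> f j = pcompose F w" using comp[OF f_in] by blast
  then obtain F where F: "\<And>j. j \<le> n + 1 \<Longrightarrow> f j = pcompose (F j) w" by metis
  obtain A where A: "p = pcompose A w" using comp[OF p(1)] by blast
  obtain d R0 R1 where R: "hom_poly n d R0" "hom_poly n d R1"
    "\<And>t. R0 (?V t) = poly p t" "\<And>t. R1 (?V t) = poly (p * w) t"
    using raise2[OF p(1) p(3)] by blast
  have Vw: "?V t = frame_point F (poly w t)" for t
  proof -
    have "poly (f j) t = poly (F j) (poly w t)" if "j \<le> n" for j
      using F[of j] that by (simp add: poly_pcompose)
    then show ?thesis unfolding frame_point_def comb_def by (intro eq_vecI) (auto intro!: sum.cong)
  qed
  have f0: "f j \<noteq> 0" if "j \<le> n + 1" for j using f_0[OF that] z0[OF that] by auto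
  have F0: "F j \<noteq> 0" if "j \<le> n + 1" for j using F[OF that] f0[OF that] by auto
  \<comment> \<open>\<open>w\<close> is surjective, so identities between the \<open>f j\<close>
    descend to the \<open>F j\<close>.\<close>
  have F_sum: "(\<Sum>j\<le>n + 1. F j) = 0"
  proof (rule poly_ext)
    fix s
    obtain t where t: "poly w t = s" using surj_poly[OF w] by blast
    have "poly (\<Sum>j\<le>n + 1. F j) s = poly (\<Sum>j\<le>n + 1. f j) t"
      unfolding poly_sum using F t by (intro sum.cong) (auto simp: poly_pcompose)
    then show "poly (\<Sum>j\<le>n + 1. F j) s = poly 0 s" unfolding f_sum by simp
  qed
  have F_last: "poly (F (n + 1)) s = z (n + 1)" for s
  proof -
    obtain t where t: "poly w t = s" using surj_poly[OF w] by blast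
    have "poly (F (n + 1)) s = poly (f (n + 1)) t" using F[of "n + 1"] t by (simp add: poly_pcompose)
    then show ?thesis by (simp add: f_def)
  qed
  define D where "D = Max (degree ` F ` {..n + 1})"
  have D: "\<And>j. j \<le> n + 1 \<Longrightarrow> degree (F j) \<le> D" "\<exists>j\<le>n + 1. degree (F j) = D"
  proof -
    show "degree (F j) \<le> D" if "j \<le> n + 1" for j unfolding D_def using that by (intro Max_ge) auto
    have "D \<in> degree ` F ` {..n + 1}" unfolding D_def by (intro Max_in) auto
    then show "\<exists>j\<le>n + 1. degree (F j) = D" by auto
  qed
  txt \<open>All ramification indices over \<open>a\<close> are at least the orbifold multiplicity at \<open>a\<close>.\<close>
  define B where "B = (\<lambda>a. real (degree w) / real (card (fiber w a)))"
  \<comment> \<open>A crude bound suffices: infinity only has to cost strictly less than 1.\<close>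
  define B' where "B' = 1 + real (\<Sum>j\<le>n + 1. m j)"
  have card_le: "card (fiber w a) \<le> degree w" for a
  proof -
    have "card (fiber w a) = (\<Sum>b\<in>fiber w a. 1)" by simp
    also have "\<dots> \<le> (\<Sum>b\<in>fiber w a. order b (w - [:a:]))"
      using fiber_facts(4)[OF w] by (intro sum_mono) auto
    finally show ?thesis using fiber_facts(3)[OF w] by simp
  qed
  have "\<exists>g. orb_rational_curve n h m 1 (proj_space 1) g \<and> (\<forall>a. proj_pt (frame_point F a) \<in> g ` proj_space 1)"
  proof (rule orb_rational_curve_frame_point[where B = B and B' = B' and A = A, OF F_sum F0 D _ R(1,2)])
    show "\<exists>j\<le>n + 1. poly (F j) a \<noteq> 0" for a using F_last z0[of "n + 1"] by (intro exI[of _ "n + 1"]) simp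
    show "A \<noteq> 0" using A p(2) by auto
    fix a
    obtain t where t: "poly w t = a" using surj_poly[OF w] by blast
    show "R0 (frame_point F a) = poly A a" using R(3)[of t] Vw[of t] t A by (simp add: poly_pcompose)
    show "R1 (frame_point F a) = poly A a * a" using R(4)[of t] Vw[of t] t A by (simp add: poly_pcompose)
    show "B a \<ge> 1" unfolding B_def using card_le[of a] fiber_facts(2)[OF w, of a] by simp
    fix j assume j: "j \<le> n + 1" "poly (F j) a = 0"
    then have jn: "j \<le> n" using F_last z0[of "n + 1"] by (cases "j = n + 1") auto
    let ?o = "order a (F j)"
    have o: "?o > 0" using j F0[OF j(1)] order_root by blast
    \<comment> \<open>The power \<open>y j ^ m j\<close> forces \<open>m j\<close> to divide the
      order of \<open>f j\<close> at \<open>b\<close>, which is positive and equals the ramification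
      index times the order of \<open>F j\<close>.\<close>
    have ge: "m j \<le> order b (w - [:a:]) * ?o" if b: "b \<in> fiber w a" for b
    proof -
      have wb: "poly w b = a" using b by (simp add: fiber_def)
      have "order b (f j) = order b (w - [:a:]) * ?o"
        using order_pcompose[OF F0[OF j(1)] w, of b] F[OF j(1)] wb by simp
      moreover have "y j \<noteq> 0" using y(1)[OF jn] by auto
      then have "order b (f j) = m j * order b (y j)"
        using jn z0[of j] by (simp add: f_def order_smult order_power)
      moreover have "order b (f j) \<noteq> 0"
        using F[OF j(1)] wb j(2) f0[OF j(1)] order_root[of "f j" b] by (simp add: poly_pcompose)
      ultimately show ?thesis by (metis dvd_imp_le dvd_triv_left neq0_conv)
    qed
    \<comment> \<open>Summed over the fibre, the ramification indices give \<open>degree w\<close>;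
      so \<open>m j / ?o\<close> is at most their mean, which is \<open>B a\<close>.\<close>
    have "card (fiber w a) * m j = (\<Sum>b\<in>fiber w a. m j)" by simp
    also have "\<dots> \<le> (\<Sum>b\<in>fiber w a. order b (w - [:a:]) * ?o)" using ge by (intro sum_mono)
    also have "\<dots> = degree w * ?o" using fiber_facts(3)[OF w] by (simp add: sum_distrib_right[symmetric])
    finally have "real (card (fiber w a)) * real (m j) \<le> real (degree w) * real ?o"
      by (metis of_nat_le_iff of_nat_mult)
    then show "real (m j) / real ?o \<le> B a"
      unfolding B_def using o fiber_facts(2)[OF w, of a] by (simp add: field_simps)
  next
    show "B' \<ge> 1" by (simp add: B'_def sum_nonneg)
    fix j assume j: "j \<le> n + 1" "degree (F j) < D"
    have "1 \<le> D - degree (F j)" using j(2) by linarith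
    then have "1 \<le> real (D - degree (F j))" by (metis of_nat_1 of_nat_le_iff)
    then have "real (m j) / real (D - degree (F j)) \<le> real (m j) / 1"
      by (intro divide_left_mono) auto
    also have "\<dots> = real (m j)" by simp
    also have "\<dots> \<le> B'"
      using member_le_sum[of j "{..n + 1}" m] j(1) unfolding B'_def by (simp del: of_nat_sum)
    finally show "real (m j) / real (D - degree (F j)) \<le> B'" .
  next
    let ?Z = "{a. \<exists>j\<le>n + 1. poly (F j) a = 0}"
    have Z: "?Z = (\<Union>j\<in>{..n + 1}. {a. poly (F j) a = 0})" by auto
    have "finite ?Z" unfolding Z using F0 by (intro finite_UN_I poly_roots_finite) auto
    from riemann_hurwitz[OF w this] have "(\<Sum>a\<in>?Z. 1 - 1 / B a) < 1" by (simp add: B_def)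
    moreover have "1 / B' > 0" by (simp add: B'_def add_pos_nonneg sum_nonneg)
    ultimately show "(\<Sum>a\<in>?Z. 1 - 1 / B a) + (1 - 1 / B') < 2" by linarith
  qed
  then obtain g where g: "orb_rational_curve n h m 1 (proj_space 1) g"
    "\<And>a. proj_pt (frame_point F a) \<in> g ` proj_space 1" by blast
  have "frame_point F (poly w 0) = x"
    unfolding Vw[symmetric] using f_0 by (intro frame_point_eqI x f_sum) (simp add: z_def)
  then show "\<exists>N C g. orb_rational_curve n h m N C g \<and> proj_pt x \<in> g ` C"
    using g(1) g(2)[of "poly w 0"] by auto
qed

end

section \<open>Rational normal curves osculating the hyperplanes\<close>

text \<open>Pair the relations with the coefficients of a polynomial of degree at most
  \<open>n\<close> that vanishes at all nodes except \<open>a i\<close>.\<close>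

lemma vandermonde:
  fixes a X :: "'i \<Rightarrow> complex"
  assumes J: "finite J" "inj_on a J" "card J \<le> Suc n"
    and eq: "\<And>k. k \<le> n \<Longrightarrow> (\<Sum>j\<in>J. X j * a j ^ k) = 0" and i: "i \<in> J"
  shows "X i = 0"
proof -
  define q where "q = (\<Prod>j\<in>J - {i}. [:- a j, 1:])"
  have "degree q \<le> sum (degree \<circ> (\<lambda>j. [:- a j, 1:])) (J - {i})"
    unfolding q_def by (rule degree_prod_sum_le) (use J in auto)
  then have dq: "degree q \<le> n" using J i by simp
  have "(\<Sum>j\<in>J. X j * poly q (a j)) = (\<Sum>j\<in>J. \<Sum>k\<le>n. coeff q k * (X j * a j ^ k))"
  proof (rule sum.cong)
    fix j
    have "poly q (a j) = (\<Sum>k\<le>n. coeff q k * a j ^ k)"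
      unfolding poly_altdef using dq by (intro sum.mono_neutral_left) (auto simp: coeff_eq_0)
    then show "X j * poly q (a j) = (\<Sum>k\<le>n. coeff q k * (X j * a j ^ k))"
      by (simp add: sum_distrib_left mult_ac)
  qed simp
  also have "\<dots> = (\<Sum>k\<le>n. coeff q k * (\<Sum>j\<in>J. X j * a j ^ k))"
    by (subst sum.swap) (simp add: sum_distrib_left)
  also have "\<dots> = 0" using eq by simp
  also have "(\<Sum>j\<in>J. X j * poly q (a j)) = X i * poly q (a i) + (\<Sum>j\<in>J - {i}. X j * poly q (a j))"
    using J i by (intro sum.remove) auto
  also have "(\<Sum>j\<in>J - {i}. X j * poly q (a j)) = 0"
    using J by (intro sum.neutral) (auto simp: q_def poly_prod)
  finally have "X i * poly q (a i) = 0" by simp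
  moreover have "poly q (a i) \<noteq> 0" using J i by (auto simp: q_def poly_prod inj_on_def)
  ultimately show ?thesis by simp
qed

context hyperplane_frame
begin

text \<open>Each of the \<open>n + 2\<close> points of contact costs
  \<open>1 - n / max (m j) n\<close>. The total is \<open>n + 2\<close> minus \<open>n\<close> times
  the given sum, so it is below 2 exactly when that sum exceeds 1.\<close>

theorem uniruled_if_truncated_sum_gt_1:
  assumes n: "n \<ge> 1" and sum: "(\<Sum>j\<le>n + 1. 1 / real (max (m j) n)) > 1"
  shows "uniruled n h m"
proof (rule uniruledI)
  fix x assume x: "x \<in> carrier_vec (Suc n)"
    and gen: "\<And>S. S \<noteq> {} \<Longrightarrow> S \<subset> {..n + 1} \<Longrightarrow> (\<Sum>j\<in>S. \<kappa> j * (h j \<bullet> x)) \<noteq> 0"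
  define z where "z = (\<lambda>j. \<kappa> j * (h j \<bullet> x))"
  have gen': "(\<Sum>j\<in>S. z j) \<noteq> 0" if "S \<noteq> {}" "S \<subset> {..n + 1}" for S
    using gen that by (simp add: z_def)
  have z0: "z j \<noteq> 0" if "j \<le> n + 1" for j
    using gen' that by (rule generic_nonzero)
  have z_sum: "(\<Sum>j\<le>n + 1. z j) = 0" using relation[OF x] by (simp add: z_def)
  have wt_hom_pow: "wt_hom {..n} (\<lambda>_. 1) (Suc k) (\<lambda>b. \<Sum>j\<le>n. z j * b j ^ Suc k)" for k
  proof (intro wt_hom_sum wt_hom_scale)
    fix j assume "j \<in> {..n}"
    from wt_hom_power[OF this, of "\<lambda>_. 1" "Suc k"]
    show "wt_hom {..n} (\<lambda>_. 1) (Suc k) (\<lambda>b. b j ^ Suc k)" by simp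
  qed
  have "\<exists>b. (\<exists>i\<in>{..n}. b i \<noteq> 0) \<and> (\<forall>k<n. (\<Sum>j\<le>n. z j * b j ^ Suc k) = 0)"
    by (rule nontrivial_common_zero[where d = Suc, OF _ wt_hom_pow]) auto
  then obtain b where b: "\<exists>i\<le>n. b i \<noteq> 0" "\<And>k. k < n \<Longrightarrow> (\<Sum>j\<le>n. z j * b j ^ Suc k) = 0" by auto
  \<comment> \<open>The normalisation \<open>a (n + 1) = 0\<close> makes the last coordinate
    constant, so its hyperplane is met at infinity. The condition for \<open>k = 0\<close> is the
    relation between the \<open>z j\<close>.\<close>
  define a where "a = (\<lambda>j. if j \<le> n then b j else 0)"
  have a_sum: "(\<Sum>j\<le>n + 1. z j * a j ^ k) = 0" if "k \<le> n" for k
  proof (cases k)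
    case 0
    then show ?thesis using z_sum by simp
  next
    case (Suc l)
    then show ?thesis using b(2)[of l] that by (simp add: a_def One_nat_def)
  qed
  have inj: "inj_on a {..n + 1}"
  proof (rule ccontr)
    assume "\<not> inj_on a {..n + 1}"
    then have "card (a ` {..n + 1}) < card {..n + 1}"
      by (metis card_image_le eq_card_imp_inj_on finite_atMost le_neq_implies_less)
    then have card: "card (a ` {..n + 1}) \<le> Suc n" by simp
    \<comment> \<open>If values coincide, at most \<open>n + 1\<close> are distinct, so Vandermonde
      makes the sum of the \<open>z j\<close> over each level set of \<open>a\<close> vanish. The
      level set of a nonzero value omits \<open>n + 1\<close>, contrary to genericity.\<close>
    let ?X = "\<lambda>v. \<Sum>j\<in>{j \<in> {..n + 1}. a j = v}. z j"
    have "(\<Sum>v\<in>a ` {..n + 1}. ?X v * v ^ k) = 0" if k: "k \<le> n" for k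
    proof -
      have "(\<Sum>v\<in>a ` {..n + 1}. ?X v * v ^ k) =
          (\<Sum>v\<in>a ` {..n + 1}. \<Sum>j\<in>{j \<in> {..n + 1}. a j = v}. z j * a j ^ k)"
        unfolding sum_distrib_right by (intro sum.cong) auto
      also have "\<dots> = (\<Sum>j\<le>n + 1. z j * a j ^ k)" by (rule sum.group) auto
      finally show ?thesis using a_sum[OF k] by simp
    qed
    then have X0: "?X v = 0" if "v \<in> a ` {..n + 1}" for v
      using vandermonde[of "a ` {..n + 1}" "\<lambda>v. v" n ?X v] card that by simp
    obtain i where i: "i \<le> n" "b i \<noteq> 0" using b(1) by blast
    have ai: "a i \<noteq> 0" "a (n + 1) = 0" using i by (simp_all add: a_def)
    have "i \<in> {j \<in> {..n + 1}. a j = a i}" using i by simp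
    then have "{j \<in> {..n + 1}. a j = a i} \<noteq> {}" by blast
    moreover have "{j \<in> {..n + 1}. a j = a i} \<subset> {..n + 1}"
    proof
      show "{j \<in> {..n + 1}. a j = a i} \<noteq> {..n + 1}" using ai by (metis (mono_tags, lifting) atMost_iff mem_Collect_eq order_refl)
    qed auto
    ultimately have "?X (a i) \<noteq> 0" by (rule gen')
    then show False using X0 i by simp
  qed
  have a_last: "a (n + 1) = 0" by (simp add: a_def)
  have a0: "a j \<noteq> 0" if "j \<le> n" for j
  proof
    assume "a j = 0"
    then have "j = n + 1" using inj_onD[OF inj, of j "n + 1"] a_last that by simp
    then show False using that by simp
  qed
  define F where "F = (\<lambda>j. smult (z j) ([:1, a j:] ^ n))"
  have poly_F: "poly (F j) t = z j * (1 + a j * t) ^ n" for j t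
    by (simp add: F_def mult.commute)
  have expand: "(\<Sum>j\<in>J. c j * (1 + a j * t) ^ n) =
      (\<Sum>k\<le>n. of_nat (n choose k) * t ^ k * (\<Sum>j\<in>J. c j * a j ^ k))" for J c t
  proof -
    have "(1 + a j * t) ^ n = (\<Sum>k\<le>n. of_nat (n choose k) * (a j * t) ^ k)" for j
      using binomial_ring[of "a j * t" 1 n] by (simp add: add.commute)
    then have "(\<Sum>j\<in>J. c j * (1 + a j * t) ^ n) =
        (\<Sum>j\<in>J. \<Sum>k\<le>n. of_nat (n choose k) * t ^ k * (c j * a j ^ k))"
      by (simp add: sum_distrib_left power_mult_distrib mult_ac)
    then show ?thesis by (simp add: sum.swap[of _ "{..n}" J] sum_distrib_left)
  qed
  have F_sum: "(\<Sum>j\<le>n + 1. F j) = 0"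
  proof (rule poly_ext)
    fix t
    have "poly (\<Sum>j\<le>n + 1. F j) t = (\<Sum>j\<le>n + 1. z j * (1 + a j * t) ^ n)"
      unfolding poly_sum poly_F ..
    also have "\<dots> = 0" unfolding expand using a_sum by (intro sum.neutral) auto
    finally show "poly (\<Sum>j\<le>n + 1. F j) t = poly 0 t" by simp
  qed
  have F0: "F j \<noteq> 0" if "j \<le> n + 1" for j using z0[OF that] by (simp add: F_def)
  have deg_F: "degree (F j) = n" if "j \<le> n" for j
    using a0[OF that] z0[of j] that by (simp add: F_def degree_power_eq)
  have deg_F_last: "degree (F (n + 1)) = 0" by (simp add: F_def a_last degree_power_eq)
  let ?r = "\<lambda>j. - 1 / a j"
  have root: "poly (F j) t = 0 \<longleftrightarrow> j \<le> n \<and> t = ?r j" if "j \<le> n + 1" for j t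
  proof (cases "j \<le> n")
    case True
    have "1 + a j * t = 0 \<longleftrightarrow> t = ?r j" using a0[OF True] by (auto simp: field_simps add_eq_0_iff)
    then show ?thesis using True z0[OF that] n by (simp add: poly_F)
  next
    case False
    then have "j = n + 1" using that by simp
    then show ?thesis using z0[OF that] a_last by (simp add: poly_F)
  qed
  have inj_r: "inj_on ?r {..n}"
  proof (rule inj_onI)
    fix i j assume ij: "i \<in> {..n}" "j \<in> {..n}" "?r i = ?r j"
    then have "a i = a j" using a0[of i] a0[of j] by (simp add: field_simps)
    then show "i = j" using inj_onD[OF inj, of i j] ij by simp
  qed
  have Z: "{t. \<exists>j\<le>n + 1. poly (F j) t = 0} = ?r ` {..n}"
  proof (intro equalityI subsetI)
    fix t assume "t \<in> ?r ` {..n}"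
    then obtain j where "j \<le> n" "t = ?r j" by auto
    then show "t \<in> {t. \<exists>j\<le>n + 1. poly (F j) t = 0}" using root[of j] by (intro CollectI exI[of _ j]) simp
  qed (use root in auto)
  have order_F: "order (?r j) (F j) = n" if j: "j \<le> n" for j
  proof -
    have "[:1, a j:] = smult (a j) [:- ?r j, 1:]" using a0[OF j] by simp
    then have "F j = smult (z j * a j ^ n) ([:- ?r j, 1:] ^ n)" by (simp only: F_def smult_power smult_smult)
    moreover have "z j * a j ^ n \<noteq> 0" using z0[of j] a0[OF j] j by simp
    ultimately have "order (?r j) (F j) = order (?r j) ([:- ?r j, 1:] ^ n)"
      by (metis order_smult)
    then show ?thesis unfolding order_power_n_n .
  qed
  define M where "M = (\<lambda>j. max 1 (real (m j) / real n))"
  define B where "B = (\<lambda>t. if t \<in> ?r ` {..n} then M (inv_into {..n} ?r t) else 1)"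
  have B_r: "B (?r j) = M j" if "j \<le> n" for j
    using that inv_into_f_f[OF inj_r, of j] by (auto simp: B_def)
  have M1: "M j \<ge> 1" for j by (simp add: M_def)
  have M_eq: "1 / M j = real n * (1 / real (max (m j) n))" for j
    using n by (auto simp: M_def max_def field_simps)
  have cost: "(\<Sum>t\<in>?r ` {..n}. 1 - 1 / B t) + (1 - 1 / M (n + 1)) < 2"
  proof -
    have "(\<Sum>t\<in>?r ` {..n}. 1 - 1 / B t) = (\<Sum>j\<le>n. 1 - 1 / M j)"
      using B_r by (subst sum.reindex[OF inj_r]) (auto intro!: sum.cong)
    then have "(\<Sum>t\<in>?r ` {..n}. 1 - 1 / B t) + (1 - 1 / M (n + 1)) = (\<Sum>j\<le>n + 1. 1 - 1 / M j)"
      by (simp add: One_nat_def)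
    also have "\<dots> = real n + 2 - real n * (\<Sum>j\<le>n + 1. 1 / real (max (m j) n))"
      unfolding M_eq sum_subtractf sum_distrib_left by simp
    also have "\<dots> < real n + 2 - real n * 1"
      using sum n by (intro diff_strict_left_mono mult_strict_left_mono) auto
    finally show ?thesis by simp
  qed
  have V: "\<kappa> j * lin_form n (h j) (frame_point F t) = poly (F j) t" if "j \<le> n + 1" for j t
    using scalar_frame_point[OF F_sum that] by (simp add: lin_form_eq)
  define R0 where "R0 = (\<lambda>x. \<kappa> (n + 1) / z (n + 1) * lin_form n (h (n + 1)) x)"
  have R0: "hom_poly n 1 R0" "R0 (frame_point F t) = 1" for t
  proof -
    show "hom_poly n 1 R0" unfolding R0_def by (intro hom_poly_scale hom_poly_lin_form)
    show "R0 (frame_point F t) = 1" using V[of "n + 1" t] z0[of "n + 1"] by (simp add: R0_def poly_F a_last)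
  qed
  \<comment> \<open>A combination of the powers \<open>(1 + a j * t) ^ n\<close> in which only the
    term linear in \<open>t\<close> survives: \<open>n\<close> conditions on \<open>n + 1\<close>
    unknowns. It yields the form \<open>R1\<close> recovering the parameter; the surviving power sum
    \<open>g\<close> is nonzero by Vandermonde.\<close>
  obtain c where c: "\<exists>j\<in>{..n}. c j \<noteq> 0" "\<And>k. k \<le> n \<Longrightarrow> k \<noteq> 1 \<Longrightarrow> (\<Sum>j\<le>n. c j * a j ^ k) = 0"
    using underdetermined_system[of "{..n} - {1}" "{..n}" "\<lambda>j k. a j ^ k"] n by auto
  define g where "g = (\<Sum>j\<le>n. c j * a j)"
  have g0: "g \<noteq> 0"
  proof
    assume "g = 0"
    then have "(\<Sum>j\<le>n. c j * a j ^ k) = 0" if "k \<le> n" for k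
      using c(2)[OF that] by (cases "k = 1") (simp_all add: g_def)
    moreover have "inj_on a {..n}" using inj by (rule inj_on_subset) auto
    ultimately have "c j = 0" if "j \<in> {..n}" for j using vandermonde[of "{..n}" a n c j] that by simp
    then show False using c(1) by blast
  qed
  define R1 where "R1 = (\<lambda>x. \<Sum>j\<le>n. c j / (of_nat n * g * z j) * (\<kappa> j * lin_form n (h j) x))"
  have R1: "hom_poly n 1 R1" unfolding R1_def by (intro hom_poly_sum hom_poly_scale hom_poly_lin_form)
  have R1_val: "R1 (frame_point F t) = t" for t
  proof -
    have "R1 (frame_point F t) = (\<Sum>j\<le>n. c j / (of_nat n * g) * (1 + a j * t) ^ n)"
      unfolding R1_def using V z0 by (intro sum.cong) (auto simp: poly_F)
    also have "\<dots> = (\<Sum>j\<le>n. c j * (1 + a j * t) ^ n) / (of_nat n * g)"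
      by (simp add: sum_divide_distrib)
    also have "(\<Sum>j\<le>n. c j * (1 + a j * t) ^ n) =
        (\<Sum>k\<le>n. if k = 1 then of_nat n * t * g else 0)"
      unfolding expand
    proof (rule sum.cong)
      fix k assume "k \<in> {..n}"
      then show "of_nat (n choose k) * t ^ k * (\<Sum>j\<le>n. c j * a j ^ k) = (if k = 1 then of_nat n * t * g else 0)"
        using c(2)[of k] by (auto simp: g_def One_nat_def)
    qed simp
    also have "\<dots> / (of_nat n * g) = t" using n g0 by simp
    finally show ?thesis .
  qed
  have "\<exists>g. orb_rational_curve n h m 1 (proj_space 1) g \<and> (\<forall>a. proj_pt (frame_point F a) \<in> g ` proj_space 1)"
  proof (rule orb_rational_curve_frame_point[where B = B and B' = "M (n + 1)" and A = 1 and D = n, OF F_sum F0 _ _ _ R0(1) R1])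
    show "degree (F j) \<le> n" if "j \<le> n + 1" for j
      using that deg_F[of j] deg_F_last by (cases "j = n + 1") auto
    show "\<exists>j\<le>n + 1. degree (F j) = n" using deg_F[of 0] by auto
    show "\<exists>j\<le>n + 1. poly (F j) t \<noteq> 0" for t using root[of "n + 1" t] by (intro exI[of _ "n + 1"]) simp
    show "R0 (frame_point F t) = poly 1 t" "R1 (frame_point F t) = poly 1 t * t" for t using R0 R1_val by simp_all
    show "B t \<ge> 1" for t using M1 by (simp add: B_def)
    show "real (m j) / real (order t (F j)) \<le> B t" if "j \<le> n + 1" "poly (F j) t = 0" for t j
      using root[OF that(1), of t] that(2) order_F[of j] B_r[of j] by (auto simp: M_def)
    show "M (n + 1) \<ge> 1" by (rule M1)
    show "real (m j) / real (n - degree (F j)) \<le> M (n + 1)" if "j \<le> n + 1" "degree (F j) < n" for j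
      using that deg_F[of j] deg_F_last by (cases "j = n + 1") (auto simp: M_def)
    show "(\<Sum>t | \<exists>j\<le>n + 1. poly (F j) t = 0. 1 - 1 / B t) + (1 - 1 / M (n + 1)) < 2"
      unfolding Z by (rule cost)
  qed simp_all
  then obtain g where g: "orb_rational_curve n h m 1 (proj_space 1) g"
    "\<And>a. proj_pt (frame_point F a) \<in> g ` proj_space 1" by blast
  have "frame_point F 0 = x"
    by (intro frame_point_eqI x F_sum) (simp add: poly_F z_def)
  then show "\<exists>N C g. orb_rational_curve n h m N C g \<and> proj_pt x \<in> g ` C"
    using g(1) g(2)[of 0] by auto
qed

end

section \<open>Comparison of the numerical conditions\<close>

theorem proposition7p17:
  fixes n :: nat and h :: "nat \<Rightarrow> complex vec" and m :: "nat \<Rightarrow> nat"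
  assumes "n \<ge> 2" and "orbifold_type n h m" and "fano n m"
  shows "(uniruled n h m \<or>
          ((\<Sum>j\<le>n + 1. 1 / real (m j)) > 1 \<and>
           (\<Sum>j\<in>{..n + 1} - {n}. 1 / real (m j)) \<le> 1 \<and>
           (n = 3 \<longrightarrow> (\<Sum>j\<le>n + 1. 1 / real (max (m j) n)) \<le> 1))) \<and>
         (n = 3 \<longrightarrow> uniruled n h m \<or> (m 0 = 2 \<and> m 1 \<ge> 3 \<and> m 2 \<ge> 4))"
proof -
  have m2: "m j \<ge> 2" if "j \<le> n + 1" for j
    using assms(2) that by (auto simp: orbifold_type_def)
  have mono: "m i \<le> m j" if "i \<le> j" "j \<le> n + 1" for i j
    using assms(2) that by (auto simp: orbifold_type_def mono_on_def)
  have "general_position n h" using assms(2) by (simp add: orbifold_type_def)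
  then obtain e \<kappa> where "hyperplane_frame n h e \<kappa>" using general_position_frame by blast
  then interpret hyperplane_frame n h e \<kappa> .
  have fano: "(\<Sum>j\<le>n + 1. 1 / real (m j)) > 1"
    using assms(3) by (simp add: fano_def sum_subtractf)
  \<comment> \<open>Since \<open>m n \<le> m (n + 1)\<close>, exchanging \<open>n + 1\<close> for
    \<open>n\<close> in the index set can only increase the sum.\<close>
  have small: "uniruled n h m" if gt: "(\<Sum>j\<in>{..n + 1} - {n}. 1 / real (m j)) > 1"
  proof (rule uniruled_if_sum_gt_1)
    show "m j \<ge> 1" if "j \<le> n" for j using m2[of j] that by simp
    have "{..n + 1} - {n} = insert (n + 1) {..<n}" by auto
    then have "1 < 1 / real (m (n + 1)) + (\<Sum>j<n. 1 / real (m j))" using gt by simp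
    also have "\<dots> \<le> 1 / real (m n) + (\<Sum>j<n. 1 / real (m j))"
      using mono[of n "n + 1"] m2[of n] by (intro add_right_mono divide_left_mono) auto
    also have "\<dots> = (\<Sum>j\<le>n. 1 / real (m j))" by (simp add: lessThan_Suc_atMost[symmetric])
    finally show "(\<Sum>j\<le>n. 1 / real (m j)) > 1" .
  qed
  have large: "uniruled n h m" if "(\<Sum>j\<le>n + 1. 1 / real (max (m j) n)) > 1"
    using uniruled_if_truncated_sum_gt_1[OF _ that] assms(1) by simp
  have "uniruled n h m" if n: "n = 3" and neg: "\<not> (m 0 = 2 \<and> m 1 \<ge> 3 \<and> m 2 \<ge> 4)"
  proof (cases "m 0 \<ge> 3")
    case True
    \<comment> \<open>All multiplicities are at least 3, so truncation at \<open>n = 3\<close>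
      changes nothing and the Fano inequality is the required one.\<close>
    have "max (m j) n = m j" if "j \<le> n + 1" for j using mono[of 0 j] that True n by simp
    then have "(\<Sum>j\<le>n + 1. 1 / real (max (m j) n)) = (\<Sum>j\<le>n + 1. 1 / real (m j))"
      by (intro sum.cong) auto
    then show ?thesis using large fano by simp
  next
    case False
    then have m0: "m 0 = 2" using m2[of 0] by simp
    have set: "{..n + 1} - {n} = {0, 1, 2, 4}" using n by auto
    have pos: "1 / real (m j) > 0" if "j \<le> n + 1" for j using m2[OF that] by simp
    \<comment> \<open>Besides \<open>m 0 = 2\<close>, either \<open>m 1 = 2\<close>, or
      \<open>m 1 = m 2 = 3\<close> by monotonicity; the first two, respectively three, reciprocals
      already give 1 or \<open>7 / 6\<close>.\<close>
    have "1 / real (m 0) + 1 / real (m 1) + 1 / real (m 2) + 1 / real (m 4) > 1"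
    proof (cases "m 1 = 2")
      case True
      then have "1 / real (m 0) + 1 / real (m 1) = 1" using m0 by simp
      moreover have "1 / real (m 2) > 0" "1 / real (m 4) > 0" using pos[of 2] pos[of 4] n by simp_all
      ultimately show ?thesis by linarith
    next
      case False
      then have "m 1 = 3" "m 2 = 3" using neg m0 m2[of 1] mono[of 1 2] n by auto
      then have "1 / real (m 0) + 1 / real (m 1) + 1 / real (m 2) = 7 / 6" using m0 by simp
      moreover have "1 / real (m 4) > 0" using pos[of 4] n by simp
      ultimately show ?thesis by linarith
    qed
    then show ?thesis by (intro small) (simp add: set)
  qed
  then show ?thesis using fano small large by force
qed

end
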